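(* Let $(A,\circ,\Delta_A)$ be a finite-dimensional Novikov bialgebra over $\mathbf{k}$ and $(B,\diamond,(\cdot,\cdot))$ a finite-dimensional quadratic right Novikov algebra. Let $L=A\otimes B$ be the induced Lie algebra, let $\Delta_B:B\to B\otimes B$ be defined by $(\Delta_B(a),b\otimes c)=(a,b\diamond c)$, and let $\delta:L\to L\otimes L$ be $\delta(a\otimes b)=(\mathrm{id}-\tau)(\Delta_A(a)\bullet\Delta_B(b))$, so that $(L,[\cdot,\cdot],\delta)$ is a Lie bialgebra. Let $(A\oplus A^*,A,A^* )$ be the Manin triple of Novikov algebras corresponding to the Novikov bialgebra $(A,\circ,\Delta_A)$, and let $(L\oplus L^*,L,L^* )=((A\otimes B)\oplus(A^*\otimes B^* ),A\otimes B,A^*\otimes B^* )$ be the Manin triple of Lie algebras, associated with the form $\mathcal{B}(x+\xi,y+\eta)=\langle\xi,y\rangle+\langle\eta,x\rangle$ ($x,y\in L$, $\xi,\eta\in L^*$), obtained from the Manin triple of Lie algebras $((A\oplus A^* )\otimes B,A\otimes B,A^*\otimes B)$. Then the Lie bialgebra $(L,[\cdot,\cdot],\delta)$ coincides with the Lie bialgebra obtained from the Manin triple $(L\oplus L^*,L,L^* )$. That is, passing from the Novikov bialgebra $(A,\circ,\Delta_A)$ to the Lie bialgebra $(L,[\cdot,\cdot],\delta)$ and then to its Manin triple of Lie algebras gives the same result as passing from $(A,\circ,\Delta_A)$ to its Manin triple of Novikov algebras and then to the Manin triple of Lie algebras $((A\otimes B)\oplus(A^*\otimes B^* ),A\otimes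 B,A^*\otimes B^* )$.
   Context: $\mathbf{k}$ is a field of characteristic zero; $\tau$ is the flip $x\otimes y\mapsto y\otimes x$. A Novikov algebra $(A,\circ)$: $(a\circ b)\circ c-a\circ(b\circ c)=(b\circ a)\circ c-b\circ(a\circ c)$ and $(a\circ b)\circ c=(a\circ c)\circ b$. A right Novikov algebra $(B,\diamond)$: $(a\diamond b)\diamond c-a\diamond(b\diamond c)=(a\diamond c)\diamond b-a\diamond(c\diamond b)$ and $a\diamond(b\diamond c)=b\diamond(a\diamond c)$; quadratic: equipped with a symmetric nondegenerate form with $(a\diamond b,c)=-(a,b\diamond c+c\diamond b)$. Pairing on tensors: $(a_1\otimes a_2,b\otimes c)=(a_1,b)(a_2,c)$. A Novikov coalgebra $(A,\Delta)$: $(\mathrm{id}\otimes\Delta)\Delta-(\tau\otimes\mathrm{id})(\mathrm{id}\otimes\Delta)\Delta=(\Delta\otimes\mathrm{id})\Delta-(\tau\otimes\mathrm{id})(\Delta\otimes\mathrm{id})\Delta$ and $(\tau\otimes\mathrm{id})(\mathrm{id}\otimes\Delta)\tau\Delta=(\Delta\otimes\mathrm{id})\Delta$. With $L_A(a)b=a\circ b$, $R_A(a)b=b\circ a$, $L_{A,\star}=L_A+R_A$, a Novikov bialgebra $(A,\circ,\Delta)$ is a Novikov algebra and Novikov coalgebra such that for all $a,b$: $\Delta(a\circ b)=(R_A(b)\otimes\mathrm{id})\Delta(a)+(\mathrm{id}\otimes L_{A,\star}(a))(\Delta(b)+\tau\Delta(b))$; $(L_{A,\star}(a)\otimes\mathrm{id})\Delta(b)-(\mathrm{id}\otimes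 L_{A,\star}(a))\tau\Delta(b)=(L_{A,\star}(b)\otimes\mathrm{id})\Delta(a)-(\mathrm{id}\otimes L_{A,\star}(b))\tau\Delta(a)$; $(\mathrm{id}\otimes R_A(a)-R_A(a)\otimes\mathrm{id})(\Delta(b)+\tau\Delta(b))=(\mathrm{id}\otimes R_A(b)-R_A(b)\otimes\mathrm{id})(\Delta(a)+\tau\Delta(a))$. Manin triple of a Novikov bialgebra: let $\cdot$ be the Novikov product on $A^*$ dual to $\Delta_A$. There is a Novikov product on $A\oplus A^*$ with $(A,\circ)$ and $(A^*,\cdot)$ as subalgebras for which $\mathcal{B}(a+f,b+g)=\langle f,b\rangle+\langle g,a\rangle$ is invariant, i.e. $\mathcal{B}(xy,z)=-\mathcal{B}(y,xz+zx)$; explicitly, $a f=L_{A,\star}^*(a)f-R_{A^*}^*(f)a$ and $f a=L_{A^*,\star}^*(f)a-R_A^*(a)f$ for $a\in A,f\in A^*$, where $L_{A^*},R_{A^*}$ are left and right multiplications of $(A^*,\cdot)$, $L_{A^*,\star}=L_{A^*}+R_{A^*}$, and $\langle\varphi^*(x)\xi,v\rangle=-\langle\xi,\varphi(x)v\rangle$. Induced Lie algebra of a Novikov algebra $(A,\circ)$ and right Novikov algebra $(B,\diamond)$: $A\otimes B$ with $[a_1\otimes b_1,a_2\otimes b_2]=a_1\circ a_2\otimes b_1\diamond b_2-a_2\circ a_1\otimes b_2\diamond b_1$. For $\Delta_A(a)=\sum a_{(1)}\otimes a_{(2)}$, $\Delta_B(b)=\sum b_{1}\otimes b_{2}$: $\Delta_A(a)\bullet\Delta_B(b)=\sum(a_{(1)}\otimes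 b_1)\otimes(a_{(2)}\otimes b_2)$. Let $\varphi:B\to B^*$, $\langle\varphi(a),b\rangle=(a,b)$, and let $f\diamond'g=\varphi(\varphi^{-1}(f)\diamond\varphi^{-1}(g))$ on $B^*$, a right Novikov product. The space $L^*=(A\otimes B)^*=A^*\otimes B^*$ carries the Lie bracket induced from $(A^*,\cdot)$ and $(B^*,\diamond')$, and $L\oplus L^*$ carries the Lie bracket transported from the induced Lie algebra $(A\oplus A^* )\otimes B$ along the linear isomorphism that is the identity on $A\otimes B$ and $\mathrm{id}_{A^*}\otimes\varphi$ on $A^*\otimes B$. A Manin triple of Lie algebras $(L\oplus L^*,L,L^* )$ (with $L,L^*$ isotropic Lie subalgebras and $\mathcal{B}$ invariant) yields the Lie bialgebra $(L,[\cdot,\cdot],\delta)$ whose cobracket $\delta$ is the linear dual of the bracket on $L^*$; this is the standard bijective correspondence between finite-dimensional Lie bialgebras and such Manin triples. *)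

theory Defs
  imports Complex_Main "HOL-Library.Function_Algebras" "HOL-Library.Product_Plus"
begin

section \<open>Vector spaces, duals, direct sums\<close>

text \<open>Duals and tensor products of vector spaces given by types are proper subspaces of
  function types, so a space is a scalar multiplication on an ambient type together with a
  subspace of that type.\<close>

record ('k, 'v) space =
  smult :: "'k \<Rightarrow> 'v \<Rightarrow> 'v"
  points :: "'v set"

definition vspace :: "('k::field, 'v::ab_group_add) space \<Rightarrow> bool" where
  "vspace V \<longleftrightarrow> vector_space (smult V) \<and> module.subspace (smult V) (points V)"

definition fin_dim_space :: "('k::field, 'v::ab_group_add) space \<Rightarrow> bool" where
  "fin_dim_space V \<longleftrightarrow> vspace V \<and> (\<exists>S. finite S \<and> points V = module.span (smult V) S)"

definition linear_map ::
  "('k, 'v::ab_group_add) space \<Rightarrow> ('k, 'w::ab_group_add) space \<Rightarrow> ('v \<Rightarrow> 'w) \<Rightarrow> bool" where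
  "linear_map V W f \<longleftrightarrow> (\<forall>x\<in>points V. f x \<in> points W)
     \<and> (\<forall>x\<in>points V. \<forall>y\<in>points V. f (x + y) = f x + f y)
     \<and> (\<forall>c. \<forall>x\<in>points V. f (smult V c x) = smult W c (f x))"

definition bilinear_map ::
  "('k, 'v::ab_group_add) space \<Rightarrow> ('k, 'w::ab_group_add) space \<Rightarrow> ('k, 'u::ab_group_add) space
    \<Rightarrow> ('v \<Rightarrow> 'w \<Rightarrow> 'u) \<Rightarrow> bool" where
  "bilinear_map V W U \<beta> \<longleftrightarrow> (\<forall>x\<in>points V. linear_map W U (\<beta> x))
     \<and> (\<forall>y\<in>points W. linear_map V U (\<lambda>x. \<beta> x y))"

definition scalars :: "('k::field, 'k) space" where
  "scalars = \<lparr>smult = (*), points = UNIV\<rparr>"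

definition pointwise_smult :: "'k::field \<Rightarrow> ('x \<Rightarrow> 'k) \<Rightarrow> 'x \<Rightarrow> 'k" where
  "pointwise_smult c f = (\<lambda>x. c * f x)"

text \<open>Functionals are extended by zero outside the space, which makes them unique as functions
  on the ambient type.\<close>

definition dual :: "('k::field, 'v::ab_group_add) space \<Rightarrow> ('k, 'v \<Rightarrow> 'k) space" where
  "dual V = \<lparr>smult = pointwise_smult,
             points = {f. linear_map V scalars f \<and> (\<forall>x. x \<notin> points V \<longrightarrow> f x = 0)}\<rparr>"

definition dsum :: "('k, 'v) space \<Rightarrow> ('k, 'w) space \<Rightarrow> ('k, 'v \<times> 'w) space" where
  "dsum V W = \<lparr>smult = (\<lambda>c (v, w). (smult V c v, smult W c w)), points = points V \<times> points W\<rparr>"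

text \<open>For an endomorphism \<open>\<phi>\<close> of \<open>V\<close>, the operator \<open>f \<mapsto> - f \<circ> \<phi>\<close> on the dual of \<open>V\<close>.\<close>

definition neg_transpose ::
  "('k::field, 'v::ab_group_add) space \<Rightarrow> ('v \<Rightarrow> 'v) \<Rightarrow> ('v \<Rightarrow> 'k) \<Rightarrow> 'v \<Rightarrow> 'k" where
  "neg_transpose V \<phi> f = (\<lambda>v. if v \<in> points V then - f (\<phi> v) else 0)"

text \<open>The same for an endomorphism \<open>\<phi>\<close> of the dual of \<open>V\<close>, acting on the bidual, which is
  identified with the finite-dimensional space \<open>V\<close>.\<close>

definition neg_transpose_bidual ::
  "('k::field, 'v::ab_group_add) space \<Rightarrow> (('v \<Rightarrow> 'k) \<Rightarrow> 'v \<Rightarrow> 'k) \<Rightarrow> 'v \<Rightarrow> 'v" where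
  "neg_transpose_bidual V \<phi> v =
     (THE u. u \<in> points V \<and> (\<forall>g\<in>points (dual V). g u = - \<phi> g v))"

text \<open>\<open>\<B>(x + \<xi>, y + \<eta>) = \<langle>\<xi>, y\<rangle> + \<langle>\<eta>, x\<rangle>\<close> on the direct sum of a space and its dual.\<close>

definition std_form :: "'v \<times> ('v \<Rightarrow> 'k::field) \<Rightarrow> 'v \<times> ('v \<Rightarrow> 'k) \<Rightarrow> 'k" where
  "std_form u v = snd u (fst v) + snd v (fst u)"


section \<open>Tensor products\<close>

text \<open>Over a field, the tensor product of \<open>V\<close> and \<open>W\<close> embeds into the bilinear functions on
  \<open>V* \<times> W*\<close> by sending \<open>v \<otimes> w\<close> to \<open>(\<xi>, \<eta>) \<mapsto> \<xi>(v) \<eta>(w)\<close>; it is realised as the image, the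
  set of all finite sums of elementary tensors.\<close>

type_synonym ('k, 'v, 'w) tensor = "('v \<Rightarrow> 'k) \<times> ('w \<Rightarrow> 'k) \<Rightarrow> 'k"

definition ten :: "('k::field, 'v::ab_group_add) space \<Rightarrow> ('k, 'w::ab_group_add) space
    \<Rightarrow> 'v \<Rightarrow> 'w \<Rightarrow> ('k, 'v, 'w) tensor" where
  "ten V W v w = (\<lambda>(\<xi>, \<eta>). if \<xi> \<in> points (dual V) \<and> \<eta> \<in> points (dual W) then \<xi> v * \<eta> w else 0)"

definition tensor :: "('k::field, 'v::ab_group_add) space \<Rightarrow> ('k, 'w::ab_group_add) space
    \<Rightarrow> ('k, ('k, 'v, 'w) tensor) space" where
  "tensor V W = \<lparr>smult = pointwise_smult,
     points = {t. \<exists>ps. set ps \<subseteq> points V \<times> points W \<and> t = (\<Sum>(v, w)\<leftarrow>ps. ten V W v w)}\<rparr>"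

text \<open>Sweedler notation: \<open>tlift V W \<beta> t\<close> is \<open>\<Sum> \<beta>(v\<^sub>i, w\<^sub>i)\<close> for any representation
  \<open>t = \<Sum> v\<^sub>i \<otimes> w\<^sub>i\<close>. For bilinear \<open>\<beta>\<close> the value is independent of the representation (see
  \<open>tlift_sum\<close> below), so this is the linear map on the tensor product induced by \<open>\<beta>\<close>.\<close>

definition tlift :: "('k::field, 'v::ab_group_add) space \<Rightarrow> ('k, 'w::ab_group_add) space
    \<Rightarrow> ('v \<Rightarrow> 'w \<Rightarrow> 'u::ab_group_add) \<Rightarrow> ('k, 'v, 'w) tensor \<Rightarrow> 'u" where
  "tlift V W \<beta> t = (THE z. \<exists>ps. set ps \<subseteq> points V \<times> points W
     \<and> t = (\<Sum>(v, w)\<leftarrow>ps. ten V W v w) \<and> z = (\<Sum>(v, w)\<leftarrow>ps. \<beta> v w))"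

lemma linear_map_sum:
  assumes f: "linear_map V W f" and V: "vspace V" and I: "finite I"
    and x: "\<And>i. i \<in> I \<Longrightarrow> x i \<in> points V"
  shows "(\<Sum>i\<in>I. x i) \<in> points V \<and> f (\<Sum>i\<in>I. x i) = (\<Sum>i\<in>I. f (x i))"
proof -
  interpret vector_space "smult V" using V by (simp add: vspace_def)
  have sub: "subspace (points V)" using V by (simp add: vspace_def)
  have 0: "0 \<in> points V" using sub by (rule subspace_0)
  have f0: "f 0 = 0" using f 0 unfolding linear_map_def by (metis add.right_neutral add_left_cancel)
  show ?thesis using I x
  proof (induction I)
    case empty
    then show ?case using 0 f0 by simp
  next
    case (insert i I)
    then show ?case using f subspace_add[OF sub] by (auto simp: linear_map_def)
  qed
qed

lemma exists_dual:
  assumes V: "vspace V" and B: "module.independent (smult V) B" and b: "b \<in> B"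
  shows "\<exists>\<xi>\<in>points (dual V).
    \<forall>v\<in>points V. v \<in> module.span (smult V) B \<longrightarrow> \<xi> v = module.representation (smult V) B v b"
proof -
  interpret vector_space "smult V" using V by (simp add: vspace_def)
  have sub: "subspace (points V)" using V by (simp add: vspace_def)
  define C where "C = extend_basis B"
  have C: "independent C" "span C = UNIV" "B \<subseteq> C"
    using B by (auto simp: C_def independent_extend_basis extend_basis_superset)
  define \<xi> where "\<xi> v = (if v \<in> points V then representation C v b else 0)" for v
  have "\<xi> \<in> points (dual V)"
    using subspace_add[OF sub] subspace_scale[OF sub] C
    by (auto simp: dual_def linear_map_def scalars_def \<xi>_def representation_add representation_scale)
  moreover have "\<xi> v = representation B v b" if "v \<in> points V" "v \<in> span B" for v
    using that C by (simp add: \<xi>_def representation_extend)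
  ultimately show ?thesis by blast
qed

lemma dual_separates:
  assumes V: "vspace V" and v: "v \<in> points V" "v \<noteq> 0"
  shows "\<exists>\<xi>\<in>points (dual V). \<xi> v \<noteq> 0"
proof -
  interpret vector_space "smult V" using V by (simp add: vspace_def)
  have i: "independent {v}" using v by simp
  have "representation {v} v v = 1" using representation_basis[OF i] by simp
  then show ?thesis
    using exists_dual[OF V i, of v] v span_base[of v "{v}"] by (metis singletonI zero_neq_one)
qed

lemma sum_list_ten:
  assumes "\<xi> \<in> points (dual V)" "\<eta> \<in> points (dual W)"
  shows "(\<Sum>(v, w)\<leftarrow>ps. ten V W v w) (\<xi>, \<eta>) = (\<Sum>(v, w)\<leftarrow>ps. \<xi> v * \<eta> w)"
  using assms by (induction ps) (auto simp: ten_def)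

lemma bilinear_sum_eq_0:
  assumes V: "vspace V" and W: "vspace W" and \<beta>: "bilinear_map V W U \<beta>"
    and ps: "set ps \<subseteq> points V \<times> points W" and 0: "(\<Sum>(v, w)\<leftarrow>ps. ten V W v w) = 0"
  shows "(\<Sum>(v, w)\<leftarrow>ps. \<beta> v w) = 0"
proof -
  interpret V: vector_space "smult V" using V by (simp add: vspace_def)
  interpret W: vector_space "smult W" using W by (simp add: vspace_def)
  have subV: "V.subspace (points V)" using V by (simp add: vspace_def)
  have subW: "W.subspace (points W)" using W by (simp add: vspace_def)
  obtain B where B: "B \<subseteq> fst ` set ps" "V.independent B" "fst ` set ps \<subseteq> V.span B"
    using V.maximal_independent_subset by blast
  have fin: "finite B" using B(1) by (rule finite_subset) simp
  have BV: "B \<subseteq> points V" using B(1) ps by fastforce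
  define n where "n = length ps"
  define v where "v i = fst (ps ! i)" for i
  define w where "w i = snd (ps ! i)" for i
  have mem: "ps ! i \<in> set ps" if "i < n" for i using that by (simp add: n_def)
  have v: "v i \<in> points V" "v i \<in> V.span B" if "i < n" for i
    using mem[OF that] ps B(3) by (auto simp: v_def)
  have w: "w i \<in> points W" if "i < n" for i
    using mem[OF that] ps by (auto simp: w_def)
  have sl: "(\<Sum>(v, w)\<leftarrow>ps. F v w) = (\<Sum>i<n. F (v i) (w i))" for F :: "_ \<Rightarrow> _ \<Rightarrow> 'z::ab_group_add"
    by (simp add: sum_list_sum_nth n_def v_def w_def atLeast0LessThan case_prod_unfold)
  define r where "r i b = V.representation B (v i) b" for i b
  have rep: "(\<Sum>b\<in>B. smult V (r i b) b) = v i" if "i < n" for i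
    unfolding r_def using v(2)[OF that] B(2) fin by (intro V.sum_representation_eq) auto
  define u where "u b = (\<Sum>i<n. smult W (r i b) (w i))" for b
  have rw: "smult W (r i b) (w i) \<in> points W" if "i < n" for i b
    using W.subspace_scale[OF subW w[OF that]] .
  have uW: "u b \<in> points W" for b
    unfolding u_def using rw by (intro W.subspace_sum[OF subW]) auto
  have u0: "u b = 0" if b: "b \<in> B" for b
  proof (rule ccontr)
    assume "u b \<noteq> 0"
    then obtain \<eta> where \<eta>: "\<eta> \<in> points (dual W)" "\<eta> (u b) \<noteq> 0"
      using dual_separates[OF W uW] by blast
    obtain \<xi> where \<xi>: "\<xi> \<in> points (dual V)"
      "\<And>v. v \<in> points V \<Longrightarrow> v \<in> V.span B \<Longrightarrow> \<xi> v = V.representation B v b"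
      using exists_dual[OF V B(2) b] by blast
    have l: "linear_map W scalars \<eta>" using \<eta>(1) by (simp add: dual_def)
    have "\<eta> (u b) = (\<Sum>i<n. \<eta> (smult W (r i b) (w i)))"
      unfolding u_def using linear_map_sum[OF l W, of "{..<n}"] rw by simp
    also have "\<dots> = (\<Sum>i<n. \<xi> (v i) * \<eta> (w i))"
      using l w v by (intro sum.cong) (auto simp: linear_map_def scalars_def \<xi>(2) r_def)
    also have "\<dots> = (\<Sum>(v, w)\<leftarrow>ps. \<xi> v * \<eta> w)" by (simp add: sl)
    also have "\<dots> = 0" using sum_list_ten[OF \<xi>(1) \<eta>(1), of ps] 0 by simp
    finally show False using \<eta>(2) by simp
  qed
  have "(\<Sum>(v, w)\<leftarrow>ps. \<beta> v w) = (\<Sum>i<n. \<beta> (v i) (w i))" by (rule sl)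
  also have "\<dots> = (\<Sum>i<n. \<Sum>b\<in>B. \<beta> b (smult W (r i b) (w i)))"
  proof (intro sum.cong refl)
    fix i assume "i \<in> {..<n}"
    then have i: "i < n" by simp
    have l: "linear_map V U (\<lambda>x. \<beta> x (w i))" using \<beta> w[OF i] by (simp add: bilinear_map_def)
    have bV: "smult V (r i b) b \<in> points V" if "b \<in> B" for b
      using that BV V.subspace_scale[OF subV] by blast
    have "\<beta> (v i) (w i) = (\<Sum>b\<in>B. \<beta> (smult V (r i b) b) (w i))"
      using linear_map_sum[OF l V fin, of "\<lambda>b. smult V (r i b) b"] bV rep[OF i] by simp
    also have "\<dots> = (\<Sum>b\<in>B. \<beta> b (smult W (r i b) (w i)))"
    proof (intro sum.cong refl)
      fix b assume b: "b \<in> B"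
      show "\<beta> (smult V (r i b) b) (w i) = \<beta> b (smult W (r i b) (w i))"
        using \<beta> BV b w[OF i] unfolding bilinear_map_def linear_map_def by (metis subsetD)
    qed
    finally show "\<beta> (v i) (w i) = \<dots>" .
  qed
  also have "\<dots> = (\<Sum>b\<in>B. \<Sum>i<n. \<beta> b (smult W (r i b) (w i)))" by (rule sum.swap)
  also have "\<dots> = (\<Sum>b\<in>B. \<beta> b (u b))"
  proof (intro sum.cong refl)
    fix b assume "b \<in> B"
    then have l: "linear_map W U (\<beta> b)" using \<beta> BV by (auto simp: bilinear_map_def)
    show "(\<Sum>i<n. \<beta> b (smult W (r i b) (w i))) = \<beta> b (u b)"
      unfolding u_def using linear_map_sum[OF l W, of "{..<n}"] rw by simp
  qed
  also have "\<dots> = 0"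
  proof (intro sum.neutral ballI)
    fix b assume b: "b \<in> B"
    then have l: "linear_map W U (\<beta> b)" using \<beta> BV by (auto simp: bilinear_map_def)
    show "\<beta> b (u b) = 0" using linear_map_sum[OF l W, of "{}"] u0[OF b] by simp
  qed
  finally show ?thesis .
qed

lemma tlift_sum:
  assumes V: "vspace V" and W: "vspace W" and \<beta>: "bilinear_map V W U \<beta>"
    and ps: "set ps \<subseteq> points V \<times> points W"
  shows "tlift V W \<beta> (\<Sum>(v, w)\<leftarrow>ps. ten V W v w) = (\<Sum>(v, w)\<leftarrow>ps. \<beta> v w)"
proof -
  interpret V: vector_space "smult V" using V by (simp add: vspace_def)
  have subV: "V.subspace (points V)" using V by (simp add: vspace_def)
  define neg where "neg = map (\<lambda>(v, w). (- v :: 'b, w :: 'c))"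
  have neg_sub: "set (neg qs) \<subseteq> points V \<times> points W" if "set qs \<subseteq> points V \<times> points W" for qs
    using that V.subspace_neg[OF subV] by (auto simp: neg_def)
  have neg: "f (- x) = - f x" if "linear_map V X f" "x \<in> points V"
    for f :: "'b \<Rightarrow> 'y::ab_group_add" and X x
  proof -
    have "f (x + - x) = f x + f (- x)"
      using that V.subspace_neg[OF subV] unfolding linear_map_def by blast
    moreover have "f 0 = 0" using linear_map_sum[OF that(1) V, of "{}"] by simp
    ultimately show ?thesis by (simp add: eq_neg_iff_add_eq_0 add.commute)
  qed
  have neg_ten: "ten V W (- v) w = - ten V W v w" if "v \<in> points V" for v w
    using that by (auto simp: ten_def fun_eq_iff dual_def neg)
  have sum_neg: "(\<Sum>(v, w)\<leftarrow>neg qs. F v w) = - (\<Sum>(v, w)\<leftarrow>qs. F v w)"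
    if "set qs \<subseteq> points V \<times> points W"
      "\<And>v w. v \<in> points V \<Longrightarrow> w \<in> points W \<Longrightarrow> F (- v) w = - F v w"
    for F :: "'b \<Rightarrow> 'c \<Rightarrow> 'y::ab_group_add" and qs
    using that(1) by (induction qs) (auto simp: neg_def that(2))
  have neg_\<beta>: "\<beta> (- v) w = - \<beta> v w" if "v \<in> points V" "w \<in> points W" for v w
    using neg[of U "\<lambda>x. \<beta> x w"] \<beta> that by (auto simp: bilinear_map_def)
  have uniq: "(\<Sum>(v, w)\<leftarrow>qs. \<beta> v w) = (\<Sum>(v, w)\<leftarrow>ps. \<beta> v w)"
    if qs: "set qs \<subseteq> points V \<times> points W"
      and eq: "(\<Sum>(v, w)\<leftarrow>ps. ten V W v w) = (\<Sum>(v, w)\<leftarrow>qs. ten V W v w)" for qs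
  proof -
    have "(\<Sum>(v, w)\<leftarrow>qs @ neg ps. ten V W v w) = 0"
      using sum_neg[OF ps, of "ten V W"] eq neg_ten by simp
    then have "(\<Sum>(v, w)\<leftarrow>qs @ neg ps. \<beta> v w) = 0"
      using bilinear_sum_eq_0[OF V W \<beta>, of "qs @ neg ps"] qs neg_sub[OF ps] by simp
    then show ?thesis using sum_neg[OF ps, of \<beta>] neg_\<beta> by simp
  qed
  show ?thesis unfolding tlift_def
    by (rule the_equality) (use ps uniq in \<open>blast+\<close>)
qed

definition tmap where
  "tmap V W V' W' F G = tlift V W (\<lambda>v w. ten V' W' (F v) (G w))"

definition tflip where
  "tflip V W = tlift V W (\<lambda>v w. ten W V w v)"

text \<open>The identification of \<open>V \<otimes> (W \<otimes> U)\<close> with \<open>(V \<otimes> W) \<otimes> U\<close>.\<close>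

definition tassoc where
  "tassoc V W U = tlift V (tensor W U)
     (\<lambda>v t. tlift W U (\<lambda>w u. ten (tensor V W) U (ten V W v w) u) t)"

text \<open>\<open>\<langle>\<xi> \<otimes> \<eta>, t\<rangle>\<close>.\<close>

definition tpair :: "('k::field, 'v::ab_group_add) space \<Rightarrow> ('k, 'w::ab_group_add) space
    \<Rightarrow> ('v \<Rightarrow> 'k) \<Rightarrow> ('w \<Rightarrow> 'k) \<Rightarrow> ('k, 'v, 'w) tensor \<Rightarrow> 'k" where
  "tpair V W \<xi> \<eta> = tlift V W (\<lambda>v w. \<xi> v * \<eta> w)"

text \<open>The following maps into or between triple tensors all have values in \<open>(V \<otimes> V) \<otimes> V\<close>:
  \<open>id \<otimes> \<Delta>\<close> and \<open>\<Delta> \<otimes> id\<close> on \<open>V \<otimes> V\<close>, then \<open>\<tau> \<otimes> id\<close> and the cyclic permutation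
  \<open>x \<otimes> y \<otimes> z \<mapsto> y \<otimes> z \<otimes> x\<close>.\<close>

definition id_cop where
  "id_cop V \<Delta> t = tassoc V V V (tmap V V V (tensor V V) (\<lambda>x. x) \<Delta> t)"

definition cop_id where
  "cop_id V \<Delta> = tmap V V (tensor V V) V \<Delta> (\<lambda>x. x)"

definition flip_id where
  "flip_id V = tmap (tensor V V) V (tensor V V) V (tflip V V) (\<lambda>x. x)"

definition tcyc where
  "tcyc V = tlift (tensor V V) V
     (\<lambda>t z. tlift V V (\<lambda>x y. ten (tensor V V) V (ten V V y z) x) t)"

definition tleft where
  "tleft V F = tmap V V V V F (\<lambda>x. x)"

definition tright where
  "tright V F = tmap V V V V (\<lambda>x. x) F"


section \<open>Novikov algebras, coalgebras and bialgebras\<close>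

definition novikov_algebra ::
  "('k::field, 'v::ab_group_add) space \<Rightarrow> ('v \<Rightarrow> 'v \<Rightarrow> 'v) \<Rightarrow> bool" where
  "novikov_algebra V m \<longleftrightarrow> vspace V \<and> bilinear_map V V V m
     \<and> (\<forall>a\<in>points V. \<forall>b\<in>points V. \<forall>c\<in>points V.
          m (m a b) c - m a (m b c) = m (m b a) c - m b (m a c)
          \<and> m (m a b) c = m (m a c) b)"

definition right_novikov_algebra ::
  "('k::field, 'v::ab_group_add) space \<Rightarrow> ('v \<Rightarrow> 'v \<Rightarrow> 'v) \<Rightarrow> bool" where
  "right_novikov_algebra V m \<longleftrightarrow> vspace V \<and> bilinear_map V V V m
     \<and> (\<forall>a\<in>points V. \<forall>b\<in>points V. \<forall>c\<in>points V.
          m (m a b) c - m a (m b c) = m (m a c) b - m a (m c b)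
          \<and> m a (m b c) = m b (m a c))"

definition quadratic_right_novikov_algebra ::
  "('k::field, 'v::ab_group_add) space \<Rightarrow> ('v \<Rightarrow> 'v \<Rightarrow> 'v) \<Rightarrow> ('v \<Rightarrow> 'v \<Rightarrow> 'k) \<Rightarrow> bool" where
  "quadratic_right_novikov_algebra V m form \<longleftrightarrow> right_novikov_algebra V m
     \<and> bilinear_map V V scalars form
     \<and> (\<forall>a\<in>points V. \<forall>b\<in>points V. form a b = form b a)
     \<and> (\<forall>a\<in>points V. (\<forall>b\<in>points V. form a b = 0) \<longrightarrow> a = 0)
     \<and> (\<forall>a\<in>points V. \<forall>b\<in>points V. \<forall>c\<in>points V. form (m a b) c = - form a (m b c + m c b))"

definition novikov_coalgebra ::
  "('k::field, 'v::ab_group_add) space \<Rightarrow> ('v \<Rightarrow> ('k, 'v, 'v) tensor) \<Rightarrow> bool" where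
  "novikov_coalgebra V \<Delta> \<longleftrightarrow> vspace V \<and> linear_map V (tensor V V) \<Delta>
     \<and> (\<forall>a\<in>points V.
          id_cop V \<Delta> (\<Delta> a) - flip_id V (id_cop V \<Delta> (\<Delta> a))
            = cop_id V \<Delta> (\<Delta> a) - flip_id V (cop_id V \<Delta> (\<Delta> a))
          \<and> flip_id V (id_cop V \<Delta> (tflip V V (\<Delta> a))) = cop_id V \<Delta> (\<Delta> a))"

definition Rmul :: "('v \<Rightarrow> 'v \<Rightarrow> 'v) \<Rightarrow> 'v \<Rightarrow> 'v \<Rightarrow> 'v" where
  "Rmul m a b = m b a"

definition Lstar :: "('v \<Rightarrow> 'v \<Rightarrow> 'v::plus) \<Rightarrow> 'v \<Rightarrow> 'v \<Rightarrow> 'v" where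
  "Lstar m a b = m a b + m b a"

definition novikov_bialgebra ::
  "('k::field, 'v::ab_group_add) space \<Rightarrow> ('v \<Rightarrow> 'v \<Rightarrow> 'v) \<Rightarrow> ('v \<Rightarrow> ('k, 'v, 'v) tensor) \<Rightarrow> bool"
  where
  "novikov_bialgebra V m \<Delta> \<longleftrightarrow> novikov_algebra V m \<and> novikov_coalgebra V \<Delta>
     \<and> (\<forall>a\<in>points V. \<forall>b\<in>points V.
          \<Delta> (m a b) = tleft V (Rmul m b) (\<Delta> a)
                     + tright V (Lstar m a) (\<Delta> b + tflip V V (\<Delta> b))
          \<and> tleft V (Lstar m a) (\<Delta> b) - tright V (Lstar m a) (tflip V V (\<Delta> b))
            = tleft V (Lstar m b) (\<Delta> a) - tright V (Lstar m b) (tflip V V (\<Delta> a))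
          \<and> tright V (Rmul m a) (\<Delta> b + tflip V V (\<Delta> b)) - tleft V (Rmul m a) (\<Delta> b + tflip V V (\<Delta> b))
            = tright V (Rmul m b) (\<Delta> a + tflip V V (\<Delta> a)) - tleft V (Rmul m b) (\<Delta> a + tflip V V (\<Delta> a)))"

text \<open>The product on the dual space that is dual to a coproduct or cobracket.\<close>

definition dual_product :: "('k::field, 'v::ab_group_add) space \<Rightarrow> ('v \<Rightarrow> ('k, 'v, 'v) tensor)
    \<Rightarrow> ('v \<Rightarrow> 'k) \<Rightarrow> ('v \<Rightarrow> 'k) \<Rightarrow> 'v \<Rightarrow> 'k" where
  "dual_product V \<Delta> f g = (\<lambda>a. if a \<in> points V then tpair V V f g (\<Delta> a) else 0)"

definition novikov_double :: "('k::field, 'v::ab_group_add) space \<Rightarrow> ('v \<Rightarrow> 'v \<Rightarrow> 'v)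
    \<Rightarrow> ('v \<Rightarrow> ('k, 'v, 'v) tensor) \<Rightarrow> 'v \<times> ('v \<Rightarrow> 'k) \<Rightarrow> 'v \<times> ('v \<Rightarrow> 'k) \<Rightarrow> 'v \<times> ('v \<Rightarrow> 'k)" where
  "novikov_double V m \<Delta> = (let n = dual_product V \<Delta> in (\<lambda>(a, f). \<lambda>(b, g).
     (m a b - neg_transpose_bidual V (Rmul n g) a + neg_transpose_bidual V (Lstar n f) b,
      n f g + neg_transpose V (Lstar m a) g - neg_transpose V (Rmul m b) f)))"

definition novikov_manin_triple :: "('k::field, 'v::ab_group_add) space \<Rightarrow> ('v \<Rightarrow> 'v \<Rightarrow> 'v)
    \<Rightarrow> (('v \<Rightarrow> 'k) \<Rightarrow> ('v \<Rightarrow> 'k) \<Rightarrow> 'v \<Rightarrow> 'k)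
    \<Rightarrow> ('v \<times> ('v \<Rightarrow> 'k) \<Rightarrow> 'v \<times> ('v \<Rightarrow> 'k) \<Rightarrow> 'v \<times> ('v \<Rightarrow> 'k)) \<Rightarrow> bool" where
  "novikov_manin_triple V m n M \<longleftrightarrow>
     novikov_algebra V m \<and> novikov_algebra (dual V) n \<and> novikov_algebra (dsum V (dual V)) M
     \<and> (\<forall>a\<in>points V. \<forall>b\<in>points V. M (a, 0) (b, 0) = (m a b, 0))
     \<and> (\<forall>f\<in>points (dual V). \<forall>g\<in>points (dual V). M (0, f) (0, g) = (0, n f g))
     \<and> (\<forall>x\<in>points (dsum V (dual V)). \<forall>y\<in>points (dsum V (dual V)). \<forall>z\<in>points (dsum V (dual V)).
          std_form (M x y) z = - std_form y (M x z + M z x))"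


section \<open>Lie bialgebras and Manin triples of Lie algebras\<close>

definition lie_algebra ::
  "('k::field, 'v::ab_group_add) space \<Rightarrow> ('v \<Rightarrow> 'v \<Rightarrow> 'v) \<Rightarrow> bool" where
  "lie_algebra V br \<longleftrightarrow> vspace V \<and> bilinear_map V V V br
     \<and> (\<forall>x\<in>points V. br x x = 0)
     \<and> (\<forall>x\<in>points V. \<forall>y\<in>points V. \<forall>z\<in>points V.
          br x (br y z) + br y (br z x) + br z (br x y) = 0)"

definition lie_coalgebra ::
  "('k::field, 'v::ab_group_add) space \<Rightarrow> ('v \<Rightarrow> ('k, 'v, 'v) tensor) \<Rightarrow> bool" where
  "lie_coalgebra V \<delta> \<longleftrightarrow> vspace V \<and> linear_map V (tensor V V) \<delta>
     \<and> (\<forall>x\<in>points V. \<delta> x = - tflip V V (\<delta> x))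
     \<and> (\<forall>x\<in>points V. let t = id_cop V \<delta> (\<delta> x) in t + tcyc V t + tcyc V (tcyc V t) = 0)"

definition lie_bialgebra :: "('k::field, 'v::ab_group_add) space \<Rightarrow> ('v \<Rightarrow> 'v \<Rightarrow> 'v)
    \<Rightarrow> ('v \<Rightarrow> ('k, 'v, 'v) tensor) \<Rightarrow> bool" where
  "lie_bialgebra V br \<delta> \<longleftrightarrow> lie_algebra V br \<and> lie_coalgebra V \<delta>
     \<and> (\<forall>x\<in>points V. \<forall>y\<in>points V.
          \<delta> (br x y) = (tleft V (br x) (\<delta> y) + tright V (br x) (\<delta> y))
                     - (tleft V (br y) (\<delta> x) + tright V (br y) (\<delta> x)))"

definition lie_manin_triple :: "('k::field, 'v::ab_group_add) space \<Rightarrow> ('v \<Rightarrow> 'v \<Rightarrow> 'v)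
    \<Rightarrow> (('v \<Rightarrow> 'k) \<Rightarrow> ('v \<Rightarrow> 'k) \<Rightarrow> 'v \<Rightarrow> 'k)
    \<Rightarrow> ('v \<times> ('v \<Rightarrow> 'k) \<Rightarrow> 'v \<times> ('v \<Rightarrow> 'k) \<Rightarrow> 'v \<times> ('v \<Rightarrow> 'k)) \<Rightarrow> bool" where
  "lie_manin_triple L br br' D \<longleftrightarrow>
     lie_algebra L br \<and> lie_algebra (dual L) br' \<and> lie_algebra (dsum L (dual L)) D
     \<and> (\<forall>x\<in>points L. \<forall>y\<in>points L. D (x, 0) (y, 0) = (br x y, 0))
     \<and> (\<forall>\<xi>\<in>points (dual L). \<forall>\<eta>\<in>points (dual L). D (0, \<xi>) (0, \<eta>) = (0, br' \<xi> \<eta>))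
     \<and> (\<forall>x\<in>points L. \<forall>y\<in>points L. std_form (x, 0::'v \<Rightarrow> 'k) (y, 0) = 0)
     \<and> (\<forall>\<xi>\<in>points (dual L). \<forall>\<eta>\<in>points (dual L). std_form (0, \<xi>) (0, \<eta>) = 0)
     \<and> (\<forall>u\<in>points (dsum L (dual L)). \<forall>v\<in>points (dsum L (dual L)). \<forall>w\<in>points (dsum L (dual L)).
          std_form (D u v) w = std_form u (D v w))"

text \<open>The Lie bialgebra obtained from a Manin triple with total bracket \<open>D\<close>: the bracket of the
  subalgebra \<open>L\<close>, and the cobracket that is dual to the bracket of the subalgebra \<open>L*\<close>.\<close>

definition bracket_of_manin_triple ::
  "('v \<times> ('v \<Rightarrow> 'k::field) \<Rightarrow> 'v \<times> ('v \<Rightarrow> 'k) \<Rightarrow> 'v \<times> ('v \<Rightarrow> 'k)) \<Rightarrow> 'v \<Rightarrow> 'v \<Rightarrow> 'v" where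
  "bracket_of_manin_triple D x y = fst (D (x, 0) (y, 0))"

definition cobracket_of_manin_triple :: "('k::field, 'v::ab_group_add) space
    \<Rightarrow> ('v \<times> ('v \<Rightarrow> 'k) \<Rightarrow> 'v \<times> ('v \<Rightarrow> 'k) \<Rightarrow> 'v \<times> ('v \<Rightarrow> 'k)) \<Rightarrow> 'v \<Rightarrow> ('k, 'v, 'v) tensor" where
  "cobracket_of_manin_triple L D x = (THE t. t \<in> points (tensor L L)
     \<and> (\<forall>\<xi>\<in>points (dual L). \<forall>\<eta>\<in>points (dual L). tpair L L \<xi> \<eta> t = snd (D (0, \<xi>) (0, \<eta>)) x))"

text \<open>The Manin triple of a Lie bialgebra:
  \<open>[x + \<xi>, y + \<eta>] = ([x, y] - ad*(\<eta>) x + ad*(\<xi>) y) + ([\<xi>, \<eta>] + ad*(x) \<eta> - ad*(y) \<xi>)\<close>.\<close>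

definition lie_double :: "('k::field, 'v::ab_group_add) space \<Rightarrow> ('v \<Rightarrow> 'v \<Rightarrow> 'v)
    \<Rightarrow> ('v \<Rightarrow> ('k, 'v, 'v) tensor) \<Rightarrow> 'v \<times> ('v \<Rightarrow> 'k) \<Rightarrow> 'v \<times> ('v \<Rightarrow> 'k) \<Rightarrow> 'v \<times> ('v \<Rightarrow> 'k)" where
  "lie_double L br \<delta> = (let br' = dual_product L \<delta> in (\<lambda>(x, \<xi>). \<lambda>(y, \<eta>).
     (br x y - neg_transpose_bidual L (br' \<eta>) x + neg_transpose_bidual L (br' \<xi>) y,
      br' \<xi> \<eta> + neg_transpose L (br x) \<eta> - neg_transpose L (br y) \<xi>)))"


section \<open>From Novikov to Lie\<close>

text \<open>The Lie bracket on \<open>V \<otimes> W\<close> induced by a Novikov product \<open>m\<close> on \<open>V\<close> and a right Novikov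
  product \<open>d\<close> on \<open>W\<close>.\<close>

definition induced_bracket :: "('k::field, 'v::ab_group_add) space \<Rightarrow> ('v \<Rightarrow> 'v \<Rightarrow> 'v)
    \<Rightarrow> ('k, 'w::ab_group_add) space \<Rightarrow> ('w \<Rightarrow> 'w \<Rightarrow> 'w)
    \<Rightarrow> ('k, 'v, 'w) tensor \<Rightarrow> ('k, 'v, 'w) tensor \<Rightarrow> ('k, 'v, 'w) tensor" where
  "induced_bracket V m W d s t =
     tlift V W (\<lambda>a\<^sub>1 b\<^sub>1. tlift V W (\<lambda>a\<^sub>2 b\<^sub>2.
       ten V W (m a\<^sub>1 a\<^sub>2) (d b\<^sub>1 b\<^sub>2) - ten V W (m a\<^sub>2 a\<^sub>1) (d b\<^sub>2 b\<^sub>1)) t) s"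

definition form_coproduct :: "('k::field, 'v::ab_group_add) space \<Rightarrow> ('v \<Rightarrow> 'v \<Rightarrow> 'v)
    \<Rightarrow> ('v \<Rightarrow> 'v \<Rightarrow> 'k) \<Rightarrow> 'v \<Rightarrow> ('k, 'v, 'v) tensor" where
  "form_coproduct B d form a = (THE t. t \<in> points (tensor B B)
     \<and> (\<forall>b\<in>points B. \<forall>c\<in>points B.
          tpair B B (\<lambda>x. form x b) (\<lambda>y. form y c) t = form a (d b c)))"

definition bullet :: "('k::field, 'v::ab_group_add) space \<Rightarrow> ('k, 'w::ab_group_add) space
    \<Rightarrow> ('k, 'v, 'v) tensor \<Rightarrow> ('k, 'w, 'w) tensor
    \<Rightarrow> ('k, ('k, 'v, 'w) tensor, ('k, 'v, 'w) tensor) tensor" where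
  "bullet V W s t = tlift V V (\<lambda>a\<^sub>1 a\<^sub>2. tlift W W (\<lambda>b\<^sub>1 b\<^sub>2.
     ten (tensor V W) (tensor V W) (ten V W a\<^sub>1 b\<^sub>1) (ten V W a\<^sub>2 b\<^sub>2)) t) s"

definition induced_cobracket :: "('k::field, 'v::ab_group_add) space \<Rightarrow> ('v \<Rightarrow> ('k, 'v, 'v) tensor)
    \<Rightarrow> ('k, 'w::ab_group_add) space \<Rightarrow> ('w \<Rightarrow> ('k, 'w, 'w) tensor)
    \<Rightarrow> ('k, 'v, 'w) tensor \<Rightarrow> ('k, ('k, 'v, 'w) tensor, ('k, 'v, 'w) tensor) tensor" where
  "induced_cobracket A \<Delta>\<^sub>A B \<Delta>\<^sub>B = tlift A B (\<lambda>a b.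
     let t = bullet A B (\<Delta>\<^sub>A a) (\<Delta>\<^sub>B b) in t - tflip (tensor A B) (tensor A B) t)"

definition form_map :: "('k::field, 'v::ab_group_add) space \<Rightarrow> ('v \<Rightarrow> 'v \<Rightarrow> 'k) \<Rightarrow> 'v \<Rightarrow> 'v \<Rightarrow> 'k" where
  "form_map B form a = (\<lambda>b. if b \<in> points B then form a b else 0)"

definition dual_form_product :: "('k::field, 'v::ab_group_add) space \<Rightarrow> ('v \<Rightarrow> 'v \<Rightarrow> 'v)
    \<Rightarrow> ('v \<Rightarrow> 'v \<Rightarrow> 'k) \<Rightarrow> ('v \<Rightarrow> 'k) \<Rightarrow> ('v \<Rightarrow> 'k) \<Rightarrow> 'v \<Rightarrow> 'k" where
  "dual_form_product B d form f g = (let \<phi> = form_map B form; \<psi> = inv_into (points B) \<phi>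
     in \<phi> (d (\<psi> f) (\<psi> g)))"

text \<open>The identification of \<open>A* \<otimes> B*\<close> with the dual of \<open>A \<otimes> B\<close>.\<close>

definition dual_tensor_iso :: "('k::field, 'v::ab_group_add) space \<Rightarrow> ('k, 'w::ab_group_add) space
    \<Rightarrow> ('k, 'v \<Rightarrow> 'k, 'w \<Rightarrow> 'k) tensor \<Rightarrow> ('k, 'v, 'w) tensor \<Rightarrow> 'k" where
  "dual_tensor_iso A B s = (\<lambda>x. if x \<in> points (tensor A B)
     then tlift (dual A) (dual B) (\<lambda>f g. tpair A B f g x) s else 0)"

text \<open>The bracket on \<open>(A \<otimes> B)*\<close> that corresponds to the one on \<open>A* \<otimes> B*\<close> induced by products
  on \<open>A*\<close> and \<open>B*\<close>.\<close>

definition dual_induced_bracket where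
  "dual_induced_bracket A n B d' \<xi> \<eta> =
     (let \<kappa> = dual_tensor_iso A B; \<iota> = inv_into (points (tensor (dual A) (dual B))) \<kappa>
      in \<kappa> (induced_bracket (dual A) n (dual B) d' (\<iota> \<xi>) (\<iota> \<eta>)))"

text \<open>The isomorphism from \<open>(A \<oplus> A*) \<otimes> B\<close> to \<open>(A \<otimes> B) \<oplus> (A \<otimes> B)*\<close> that is the identity on
  \<open>A \<otimes> B\<close> and \<open>id \<otimes> \<phi>\<close> on \<open>A* \<otimes> B\<close>, where \<open>\<phi>\<close> is the map from \<open>B\<close> to \<open>B*\<close> given by the form;
  the bracket of the Lie algebra \<open>(A \<oplus> A*) \<otimes> B\<close> is transported along it.\<close>

definition double_iso :: "('k::field, 'v::ab_group_add) space \<Rightarrow> ('k, 'w::ab_group_add) space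
    \<Rightarrow> ('w \<Rightarrow> 'w \<Rightarrow> 'k) \<Rightarrow> ('k, 'v \<times> ('v \<Rightarrow> 'k), 'w) tensor
    \<Rightarrow> ('k, 'v, 'w) tensor \<times> (('k, 'v, 'w) tensor \<Rightarrow> 'k)" where
  "double_iso A B form = tlift (dsum A (dual A)) B (\<lambda>(a, f) b.
     (ten A B a b, dual_tensor_iso A B (ten (dual A) (dual B) f (form_map B form b))))"

definition transported_bracket where
  "transported_bracket A M B d form u v =
     (let E = dsum A (dual A); \<Psi> = double_iso A B form; \<iota> = inv_into (points (tensor E B)) \<Psi>
      in \<Psi> (induced_bracket E M B d (\<iota> u) (\<iota> v)))"

end

theory Submission
  imports Defs
begin

text \<open>Everything reduces to the canonical form \<open>\<langle>a + f, b + g\<rangle> = f(b) + g(a)\<close> on a space plus its dual.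
  It is nondegenerate, so products on such a space can be compared by pairing them, and if it is
  invariant then the products of a vector with a covector are forced by the products of the two
  halves. Both constructions of a Lie bracket on \<open>L \<oplus> L*\<close> leave this form invariant, hence they agree as
  soon as they agree on \<open>L\<close> and on \<open>L*\<close>; and on \<open>L*\<close> both are dual to the cobracket \<open>\<delta>\<close>.

  The Novikov double. For an invariant form, right multiplications are selfadjoint, and the two
  Novikov identities together amount to the single law \<open>\<langle>xy, zw\<rangle> = \<langle>xw, zy\<rangle>\<close>. Splitting the four
  arguments into vectors and covectors, this law becomes the Novikov identities of \<open>A\<close> and of \<open>A*\<close> and
  the three compatibility conditions of a Novikov bialgebra, which correspond to the three ways, up to
  symmetry, of filling the law with two vectors and two covectors
  (\<open>novikov_bialgebra_manin_triple\<close>).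

  The Lie double. Tensoring a Novikov algebra with a right Novikov algebra gives a Lie algebra
  (\<open>induced_bracket_lie_algebra\<close>), in particular for \<open>(A \<oplus> A*) \<otimes> B\<close>. The form of \<open>B\<close> identifies this
  space with \<open>L \<oplus> L*\<close>, where \<open>L = A \<otimes> B\<close>, in such a way that the canonical form becomes the product
  of the forms of \<open>A \<oplus> A*\<close> and \<open>B\<close>; its invariance follows from theirs
  (\<open>induced_lie_manin_triple\<close>). On pure tensors the bracket of \<open>L*\<close> is the transpose of \<open>\<delta>\<close>
  (\<open>induced_cobracket_dual\<close>).

  From the double back to the bialgebra. Given a Manin triple whose bracket on \<open>L*\<close> is dual to \<open>\<delta>\<close>,
  the axioms for \<open>\<delta>\<close> are the Jacobi identity of the double, evaluated on covectors for coJacobi and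
  on two vectors and two covectors for the cocycle condition (\<open>lie_bialgebra_of_manin_triple\<close>), and
  the bracket of the double is the standard one (\<open>lie_double_eq\<close>). In particular the Lie bialgebra
  property of \<open>L\<close> is a consequence of the Manin triple.

  A tensor is itself a bilinear function of two covectors, so equations between tensors are checked
  by evaluation.\<close>


section \<open>Linear and bilinear maps\<close>

lemma vspace_add: "vspace V \<Longrightarrow> x \<in> points V \<Longrightarrow> y \<in> points V \<Longrightarrow> x + y \<in> points V"
  and vspace_0: "vspace V \<Longrightarrow> 0 \<in> points V"
  and vspace_smult: "vspace V \<Longrightarrow> x \<in> points V \<Longrightarrow> smult V c x \<in> points V"
  and vspace_neg: "vspace V \<Longrightarrow> x \<in> points V \<Longrightarrow> - x \<in> points V"
  and vspace_diff: "vspace V \<Longrightarrow> x \<in> points V \<Longrightarrow> y \<in> points V \<Longrightarrow> x - y \<in> points V"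
proof -
  assume "vspace V"
  then interpret vector_space "smult V" by (simp add: vspace_def)
  have sub: "subspace (points V)" using \<open>vspace V\<close> by (simp add: vspace_def)
  show "0 \<in> points V" by (rule subspace_0[OF sub])
  show "x + y \<in> points V" if "x \<in> points V" "y \<in> points V" by (rule subspace_add[OF sub that])
  show "smult V c x \<in> points V" if "x \<in> points V" by (rule subspace_scale[OF sub that])
  show "- x \<in> points V" if "x \<in> points V" by (rule subspace_neg[OF sub that])
  show "x - y \<in> points V" if "x \<in> points V" "y \<in> points V" by (rule subspace_diff[OF sub that])
qed

lemma vspace_sum: "vspace V \<Longrightarrow> (\<And>i. i \<in> I \<Longrightarrow> x i \<in> points V) \<Longrightarrow> (\<Sum>i\<in>I. x i) \<in> points V"
  by (induction I rule: infinite_finite_induct) (auto simp: vspace_0 vspace_add)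

lemma smult_right_distrib: "vspace V \<Longrightarrow> smult V c (x + y) = smult V c x + smult V c y"
  and smult_left_distrib: "vspace V \<Longrightarrow> smult V (c + d) x = smult V c x + smult V d x"
  and smult_smult: "vspace V \<Longrightarrow> smult V c (smult V d x) = smult V (c * d) x"
  and smult_one: "vspace V \<Longrightarrow> smult V 1 x = x"
  and smult_minus: "vspace V \<Longrightarrow> smult V c (x - y) = smult V c x - smult V c y"
  and smult_0: "vspace V \<Longrightarrow> smult V c 0 = 0"
proof -
  assume "vspace V"
  then interpret vector_space "smult V" by (simp add: vspace_def)
  show "smult V c (x + y) = smult V c x + smult V c y" by (rule scale_right_distrib)
  show "smult V (c + d) x = smult V c x + smult V d x" by (rule scale_left_distrib)
  show "smult V c (smult V d x) = smult V (c * d) x" by (rule scale_scale)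
  show "smult V 1 x = x" by (rule scale_one)
  show "smult V c (x - y) = smult V c x - smult V c y" by (rule scale_right_diff_distrib)
  show "smult V c 0 = 0" by (rule scale_zero_right)
qed

lemma vspaceI:
  assumes "\<And>c x y. smult V c (x + y) = smult V c x + smult V c y"
    and "\<And>c d x. smult V (c + d) x = smult V c x + smult V d x"
    and "\<And>c d x. smult V c (smult V d x) = smult V (c * d) x" and "\<And>x. smult V 1 x = x"
    and "0 \<in> points V" and "\<And>x y. x \<in> points V \<Longrightarrow> y \<in> points V \<Longrightarrow> x + y \<in> points V"
    and "\<And>c x. x \<in> points V \<Longrightarrow> smult V c x \<in> points V"
  shows "vspace V"
proof -
  interpret vector_space "smult V" by unfold_locales (use assms in auto)
  show ?thesis using assms vector_space_axioms by (auto simp: vspace_def subspace_def)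
qed

lemma vspace_scalars: "vspace scalars"
  by (rule vspaceI) (auto simp: scalars_def algebra_simps)

lemma scalars_simps [simp]: "points scalars = UNIV" "smult scalars c x = c * x"
  by (auto simp: scalars_def)

lemma linear_mapI:
  assumes "\<And>x. x \<in> points V \<Longrightarrow> f x \<in> points W"
    and "\<And>x y. x \<in> points V \<Longrightarrow> y \<in> points V \<Longrightarrow> f (x + y) = f x + f y"
    and "\<And>c x. x \<in> points V \<Longrightarrow> f (smult V c x) = smult W c (f x)"
  shows "linear_map V W f"
  using assms by (auto simp: linear_map_def)

lemma linear_map_in: "linear_map V W f \<Longrightarrow> x \<in> points V \<Longrightarrow> f x \<in> points W"
  and linear_map_add: "linear_map V W f \<Longrightarrow> x \<in> points V \<Longrightarrow> y \<in> points V \<Longrightarrow> f (x + y) = f x + f y"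
  and linear_map_smult: "linear_map V W f \<Longrightarrow> x \<in> points V \<Longrightarrow> f (smult V c x) = smult W c (f x)"
  by (auto simp: linear_map_def)

lemma linear_map_0: "linear_map V W f \<Longrightarrow> vspace V \<Longrightarrow> f 0 = 0"
  using linear_map_sum[of V W f "{}"] by simp

lemma linear_map_diff:
  assumes "linear_map V W f" "vspace V" "x \<in> points V" "y \<in> points V"
  shows "f (x - y) = f x - f y"
  using linear_map_add[OF assms(1) vspace_diff[OF assms(2-4)] assms(4)] by simp

lemma linear_map_neg:
  assumes "linear_map V W f" "vspace V" "x \<in> points V"
  shows "f (- x) = - f x"
  using linear_map_diff[OF assms(1,2) vspace_0[OF assms(2)] assms(3)] linear_map_0[OF assms(1,2)]
  by simp

lemma linear_map_id: "linear_map V V (\<lambda>x. x)"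
  by (simp add: linear_map_def)

lemma linear_map_zero: "vspace W \<Longrightarrow> linear_map V W (\<lambda>x. 0)"
  by (simp add: linear_map_def vspace_0 smult_0)

lemma linear_map_plus:
  "vspace W \<Longrightarrow> linear_map V W f \<Longrightarrow> linear_map V W g \<Longrightarrow> linear_map V W (\<lambda>x. f x + g x)"
  by (simp add: linear_map_def vspace_add smult_right_distrib)

lemma linear_map_minus:
  "vspace W \<Longrightarrow> linear_map V W f \<Longrightarrow> linear_map V W g \<Longrightarrow> linear_map V W (\<lambda>x. f x - g x)"
  by (simp add: linear_map_def vspace_diff smult_minus)

lemma linear_map_uminus: "vspace W \<Longrightarrow> linear_map V W f \<Longrightarrow> linear_map V W (\<lambda>x. - f x)"
  using linear_map_minus[of W V "\<lambda>x. 0" f] linear_map_zero[of W V] by simp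

lemma linear_map_comp: "linear_map V W f \<Longrightarrow> linear_map W U g \<Longrightarrow> linear_map V U (\<lambda>x. g (f x))"
  by (simp add: linear_map_def)

lemma linear_map_mult_left: "linear_map V scalars f \<Longrightarrow> linear_map V scalars (\<lambda>x. c * f x)"
  and linear_map_mult_right: "linear_map V scalars f \<Longrightarrow> linear_map V scalars (\<lambda>x. f x * c)"
  by (simp_all add: linear_map_def algebra_simps)

lemma linear_map_scale_vector:
  "vspace W \<Longrightarrow> w \<in> points W \<Longrightarrow> linear_map V scalars f \<Longrightarrow> linear_map V W (\<lambda>x. smult W (f x) w)"
  by (simp add: linear_map_def vspace_smult smult_left_distrib smult_smult)

lemma linear_map_cong:
  "vspace V \<Longrightarrow> (\<And>x. x \<in> points V \<Longrightarrow> f x = g x) \<Longrightarrow> linear_map V W f \<longleftrightarrow> linear_map V W g"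
  by (simp add: linear_map_def vspace_add vspace_smult)

lemma bilinear_mapI:
  assumes "\<And>x. x \<in> points V \<Longrightarrow> linear_map W U (\<beta> x)"
    and "\<And>y. y \<in> points W \<Longrightarrow> linear_map V U (\<lambda>x. \<beta> x y)"
  shows "bilinear_map V W U \<beta>"
  using assms by (auto simp: bilinear_map_def)

lemma bilinear_right: "bilinear_map V W U \<beta> \<Longrightarrow> x \<in> points V \<Longrightarrow> linear_map W U (\<beta> x)"
  and bilinear_left: "bilinear_map V W U \<beta> \<Longrightarrow> y \<in> points W \<Longrightarrow> linear_map V U (\<lambda>x. \<beta> x y)"
  by (auto simp: bilinear_map_def)

lemma bilinear_in:
  "bilinear_map V W U \<beta> \<Longrightarrow> x \<in> points V \<Longrightarrow> y \<in> points W \<Longrightarrow> \<beta> x y \<in> points U"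
  by (rule linear_map_in[OF bilinear_right])

lemma bilinear_map_comp:
  "bilinear_map V W U \<beta> \<Longrightarrow> linear_map U X h \<Longrightarrow> bilinear_map V W X (\<lambda>v w. h (\<beta> v w))"
  by (simp add: bilinear_map_def linear_map_def)

lemma bilinear_map_comp2:
  "bilinear_map V W U \<beta> \<Longrightarrow> linear_map V' V f \<Longrightarrow> linear_map W' W g
    \<Longrightarrow> bilinear_map V' W' U (\<lambda>v w. \<beta> (f v) (g w))"
  by (simp add: bilinear_map_def linear_map_def)

lemma bilinear_map_flip: "bilinear_map V W U \<beta> \<Longrightarrow> bilinear_map W V U (\<lambda>w v. \<beta> v w)"
  by (simp add: bilinear_map_def)

lemma bilinear_map_minus:
  "vspace U \<Longrightarrow> bilinear_map V W U \<beta> \<Longrightarrow> bilinear_map V W U \<gamma>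
    \<Longrightarrow> bilinear_map V W U (\<lambda>v w. \<beta> v w - \<gamma> v w)"
  by (auto simp: bilinear_map_def intro: linear_map_minus)

lemma bilinear_map_plus:
  "vspace U \<Longrightarrow> bilinear_map V W U \<beta> \<Longrightarrow> bilinear_map V W U \<gamma>
    \<Longrightarrow> bilinear_map V W U (\<lambda>v w. \<beta> v w + \<gamma> v w)"
  by (auto simp: bilinear_map_def intro: linear_map_plus)

lemma bilinear_map_mult:
  "linear_map V scalars f \<Longrightarrow> linear_map W scalars g \<Longrightarrow> bilinear_map V W scalars (\<lambda>v w. f v * g w)"
  by (intro bilinear_mapI linear_map_mult_left linear_map_mult_right)

lemma bilinear_map_cong:
  assumes "vspace V" "vspace W" "\<And>x y. x \<in> points V \<Longrightarrow> y \<in> points W \<Longrightarrow> \<beta> x y = \<gamma> x y"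
  shows "bilinear_map V W U \<beta> \<longleftrightarrow> bilinear_map V W U \<gamma>"
  unfolding bilinear_map_def using assms by (auto cong: linear_map_cong)


section \<open>Duals, direct sums and tensor products\<close>

lemma pointwise_smult_apply [simp]: "pointwise_smult c f x = c * f x"
  by (simp add: pointwise_smult_def)

lemma smult_dual [simp]: "smult (dual V) = pointwise_smult"
  and smult_tensor [simp]: "smult (tensor V W) = pointwise_smult"
  by (auto simp: dual_def tensor_def)

lemma dual_iff: "f \<in> points (dual V) \<longleftrightarrow> linear_map V scalars f \<and> (\<forall>x. x \<notin> points V \<longrightarrow> f x = 0)"
  by (simp add: dual_def)

lemma dual_linear: "f \<in> points (dual V) \<Longrightarrow> linear_map V scalars f"
  by (simp add: dual_iff)

lemma dual_outside: "f \<in> points (dual V) \<Longrightarrow> x \<notin> points V \<Longrightarrow> f x = 0"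
  by (simp add: dual_iff)

lemma dual_add: "f \<in> points (dual V) \<Longrightarrow> x \<in> points V \<Longrightarrow> y \<in> points V \<Longrightarrow> f (x + y) = f x + f y"
  and dual_smult: "f \<in> points (dual V) \<Longrightarrow> x \<in> points V \<Longrightarrow> f (smult V c x) = c * f x"
  and dual_diff: "f \<in> points (dual V) \<Longrightarrow> vspace V \<Longrightarrow> x \<in> points V \<Longrightarrow> y \<in> points V
    \<Longrightarrow> f (x - y) = f x - f y"
  and dual_neg: "f \<in> points (dual V) \<Longrightarrow> vspace V \<Longrightarrow> x \<in> points V \<Longrightarrow> f (- x) = - f x"
  and dual_0: "f \<in> points (dual V) \<Longrightarrow> vspace V \<Longrightarrow> f 0 = 0"
  using linear_map_add linear_map_smult linear_map_diff linear_map_neg linear_map_0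
  by (fastforce dest!: dual_linear)+

lemma dual_eqI:
  assumes "f \<in> points (dual V)" "g \<in> points (dual V)" "\<And>x. x \<in> points V \<Longrightarrow> f x = g x"
  shows "f = g"
proof
  show "f x = g x" for x using assms(3) dual_outside[OF assms(1)] dual_outside[OF assms(2)] by (cases "x \<in> points V") simp_all
qed

lemma vspace_dual: "vspace (dual V)" if "vspace V"
proof (rule vspaceI)
  show "x + y \<in> points (dual V)" if "x \<in> points (dual V)" "y \<in> points (dual V)" for x y
    using that linear_map_plus[OF vspace_scalars] by (auto simp: dual_iff plus_fun_def)
  show "smult (dual V) c x \<in> points (dual V)" if "x \<in> points (dual V)" for c x
    using that linear_map_mult_left by (auto simp: dual_iff pointwise_smult_def)
  show "0 \<in> points (dual V)"
    using linear_map_zero[OF vspace_scalars] by (auto simp: dual_iff zero_fun_def)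
qed (auto simp: fun_eq_iff algebra_simps)

lemma dual_eval: "linear_map (dual V) scalars (\<lambda>f. f v)"
  by (rule linear_mapI) auto

lemma eq_if_dual_eq:
  assumes "vspace V" "u \<in> points V" "v \<in> points V" "\<And>g. g \<in> points (dual V) \<Longrightarrow> g u = g v"
  shows "u = v"
  using dual_separates[OF assms(1) vspace_diff[OF assms(1-3)]] dual_diff[OF _ assms(1-3)] assms(4)
  by force

lemma points_dsum [simp]: "points (dsum V W) = points V \<times> points W"
  and smult_dsum [simp]: "smult (dsum V W) c (v, w) = (smult V c v, smult W c w)"
  by (auto simp: dsum_def)

lemma vspace_dsum: "vspace V \<Longrightarrow> vspace W \<Longrightarrow> vspace (dsum V W)"
  by (rule vspaceI)
    (auto simp: smult_right_distrib smult_left_distrib smult_smult smult_one vspace_add vspace_0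
      vspace_smult zero_prod_def)

lemma linear_map_fst: "linear_map (dsum V W) V fst"
  and linear_map_snd: "linear_map (dsum V W) W snd"
  by (auto simp: linear_map_def)

lemma linear_map_Pair:
  "linear_map U V f \<Longrightarrow> linear_map U W g \<Longrightarrow> linear_map U (dsum V W) (\<lambda>x. (f x, g x))"
  by (auto simp: linear_map_def)

lemma ten_in: "v \<in> points V \<Longrightarrow> w \<in> points W \<Longrightarrow> ten V W v w \<in> points (tensor V W)"
  by (auto simp: tensor_def intro!: exI[of _ "[(v, w)]"])

lemma ten_apply [simp]:
  "\<xi> \<in> points (dual V) \<Longrightarrow> \<eta> \<in> points (dual W) \<Longrightarrow> ten V W v w (\<xi>, \<eta>) = \<xi> v * \<eta> w"
  by (simp add: ten_def)

lemma tensor_add: "s \<in> points (tensor V W) \<Longrightarrow> t \<in> points (tensor V W) \<Longrightarrow> s + t \<in> points (tensor V W)"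
proof -
  assume "s \<in> points (tensor V W)" "t \<in> points (tensor V W)"
  then obtain ps qs where "set ps \<subseteq> points V \<times> points W" "s = (\<Sum>(v, w)\<leftarrow>ps. ten V W v w)"
    "set qs \<subseteq> points V \<times> points W" "t = (\<Sum>(v, w)\<leftarrow>qs. ten V W v w)"
    by (auto simp: tensor_def)
  then show ?thesis by (auto simp: tensor_def intro!: exI[of _ "ps @ qs"])
qed

lemma tensor_0: "0 \<in> points (tensor V W)"
  by (auto simp: tensor_def intro!: exI[of _ "[]"])

lemma tensor_induct :
  assumes t: "t \<in> points (tensor V W)" and 0: "P 0"
    and add: "\<And>v w t. v \<in> points V \<Longrightarrow> w \<in> points W \<Longrightarrow> t \<in> points (tensor V W) \<Longrightarrow> P t
      \<Longrightarrow> P (ten V W v w + t)"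
  shows "P t"
proof -
  obtain ps where ps: "set ps \<subseteq> points V \<times> points W" "t = (\<Sum>(v, w)\<leftarrow>ps. ten V W v w)"
    using t by (auto simp: tensor_def)
  have "(\<Sum>(v, w)\<leftarrow>ps. ten V W v w) \<in> points (tensor V W) \<and> P (\<Sum>(v, w)\<leftarrow>ps. ten V W v w)"
    using ps(1) by (induction ps) (auto simp: 0 add tensor_0 intro!: tensor_add ten_in)
  then show ?thesis using ps(2) by simp
qed

lemma ten_smult: "v \<in> points V \<Longrightarrow> ten V W (smult V c v) w = pointwise_smult c (ten V W v w)"
  by (auto simp: fun_eq_iff ten_def dual_smult)

lemma vspace_tensor: "vspace (tensor V W)" if "vspace V" "vspace W"
proof (rule vspaceI)
  show "smult (tensor V W) c t \<in> points (tensor V W)" if "t \<in> points (tensor V W)" for c t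
    using that
  proof (rule tensor_induct)
    have "smult (tensor V W) c 0 = 0" by (auto simp: fun_eq_iff)
    then show "smult (tensor V W) c 0 \<in> points (tensor V W)" by (simp add: tensor_0)
  next
    fix v w t
    assume add: "v \<in> points V" "w \<in> points W" "smult (tensor V W) c t \<in> points (tensor V W)"
    have "smult (tensor V W) c (ten V W v w + t) = ten V W (smult V c v) w + smult (tensor V W) c t"
      using add by (auto simp: ten_smult fun_eq_iff algebra_simps)
    then show "smult (tensor V W) c (ten V W v w + t) \<in> points (tensor V W)"
      using add \<open>vspace V\<close> by (auto intro!: tensor_add ten_in vspace_smult)
  qed
qed (auto simp: fun_eq_iff algebra_simps tensor_add tensor_0)

lemma bilinear_ten:
  assumes "vspace V" "vspace W"
  shows "bilinear_map V W (tensor V W) (ten V W)"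
  by (intro bilinear_mapI linear_mapI ten_in)
    (auto simp: fun_eq_iff ten_def dual_add dual_smult algebra_simps)

lemma linear_eq_on_tensor:
  assumes "vspace V" "vspace W" and f: "linear_map (tensor V W) U f" and g: "linear_map (tensor V W) U g"
    and eq: "\<And>v w. v \<in> points V \<Longrightarrow> w \<in> points W \<Longrightarrow> f (ten V W v w) = g (ten V W v w)"
    and t: "t \<in> points (tensor V W)"
  shows "f t = g t"
  using t
proof (rule tensor_induct)
  show "f 0 = g 0"
    using linear_map_0[OF f vspace_tensor] linear_map_0[OF g vspace_tensor] assms by simp
next
  fix v w t assume "v \<in> points V" "w \<in> points W" "t \<in> points (tensor V W)" "f t = g t"
  then show "f (ten V W v w + t) = g (ten V W v w + t)" by (simp add: linear_map_add[OF f] linear_map_add[OF g] ten_in eq)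
qed

lemma bilinear_eq_on_tensor:
  assumes "vspace V" "vspace W" "vspace V'" "vspace W'"
    and f: "bilinear_map (tensor V W) (tensor V' W') U f"
    and g: "bilinear_map (tensor V W) (tensor V' W') U g"
    and eq: "\<And>v w v' w'. v \<in> points V \<Longrightarrow> w \<in> points W \<Longrightarrow> v' \<in> points V' \<Longrightarrow> w' \<in> points W'
      \<Longrightarrow> f (ten V W v w) (ten V' W' v' w') = g (ten V W v w) (ten V' W' v' w')"
    and s: "s \<in> points (tensor V W)" and t: "t \<in> points (tensor V' W')"
  shows "f s t = g s t"
proof (rule linear_eq_on_tensor[OF assms(1,2) bilinear_left[OF f t] bilinear_left[OF g t] _ s])
  fix v w assume "v \<in> points V" "w \<in> points W"
  then show "f (ten V W v w) t = g (ten V W v w) t"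
    by (intro linear_eq_on_tensor[OF assms(3,4) bilinear_right[OF f] bilinear_right[OF g] _ t])
      (auto simp: ten_in eq)
qed

lemma tlift_ten:
  assumes "vspace V" "vspace W" "bilinear_map V W U \<beta>" "v \<in> points V" "w \<in> points W"
  shows "tlift V W \<beta> (ten V W v w) = \<beta> v w"
  using tlift_sum[OF assms(1-3), of "[(v, w)]"] assms(4,5) by simp

lemma tlift_add:
  assumes "vspace V" "vspace W" "bilinear_map V W U \<beta>"
    and "s \<in> points (tensor V W)" "t \<in> points (tensor V W)"
  shows "tlift V W \<beta> (s + t) = tlift V W \<beta> s + tlift V W \<beta> t"
proof -
  obtain ps qs where "set ps \<subseteq> points V \<times> points W" "s = (\<Sum>(v, w)\<leftarrow>ps. ten V W v w)"
    "set qs \<subseteq> points V \<times> points W" "t = (\<Sum>(v, w)\<leftarrow>qs. ten V W v w)"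
    using assms(4,5) by (auto simp: tensor_def)
  then show ?thesis
    using tlift_sum[OF assms(1-3), of ps] tlift_sum[OF assms(1-3), of qs]
      tlift_sum[OF assms(1-3), of "ps @ qs"] by simp
qed

lemma tlift_zero: "vspace V \<Longrightarrow> vspace W \<Longrightarrow> bilinear_map V W U \<beta> \<Longrightarrow> tlift V W \<beta> 0 = 0"
  using tlift_sum[of V W U \<beta> "[]"] by simp

lemma tlift_linear:
  assumes V: "vspace V" and W: "vspace W" and U: "vspace U" and \<beta>: "bilinear_map V W U \<beta>"
  shows "linear_map (tensor V W) U (tlift V W \<beta>)"
proof (rule linear_mapI)
  note [simp] = tlift_zero[OF V W \<beta>] tlift_add[OF V W \<beta>] tlift_ten[OF V W \<beta>] ten_in
  show "tlift V W \<beta> t \<in> points U" if "t \<in> points (tensor V W)" for t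
    using that
  proof (rule tensor_induct)
    show "tlift V W \<beta> 0 \<in> points U" by (simp add: U vspace_0)
    show "tlift V W \<beta> (ten V W v w + t) \<in> points U"
      if "v \<in> points V" "w \<in> points W" "t \<in> points (tensor V W)" "tlift V W \<beta> t \<in> points U" for v w t
      using that by (simp add: vspace_add[OF U] bilinear_in[OF \<beta>])
  qed
  show "tlift V W \<beta> (s + t) = tlift V W \<beta> s + tlift V W \<beta> t"
    if "s \<in> points (tensor V W)" "t \<in> points (tensor V W)" for s t
    using that by simp
  show "tlift V W \<beta> (smult (tensor V W) c t) = smult U c (tlift V W \<beta> t)"
    if "t \<in> points (tensor V W)" for c t
    using that
  proof (rule tensor_induct)
    have "smult (tensor V W) c 0 = 0" by (auto simp: fun_eq_iff)
    then show "tlift V W \<beta> (smult (tensor V W) c 0) = smult U c (tlift V W \<beta> 0)"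
      by (simp add: smult_0 U)
  next
    fix v w t
    assume add: "v \<in> points V" "w \<in> points W" "t \<in> points (tensor V W)"
      "tlift V W \<beta> (smult (tensor V W) c t) = smult U c (tlift V W \<beta> t)"
    have "smult (tensor V W) c (ten V W v w + t) = ten V W (smult V c v) w + smult (tensor V W) c t"
      using add by (auto simp: ten_smult fun_eq_iff algebra_simps)
    moreover have "smult (tensor V W) c t \<in> points (tensor V W)"
      by (rule vspace_smult[OF vspace_tensor[OF V W] add(3)])
    moreover have "\<beta> (smult V c v) w = smult U c (\<beta> v w)"
      using linear_map_smult[OF bilinear_left[OF \<beta>]] add by blast
    ultimately show "tlift V W \<beta> (smult (tensor V W) c (ten V W v w + t))
        = smult U c (tlift V W \<beta> (ten V W v w + t))"
      using add U by (simp add: vspace_smult[OF V] smult_right_distrib)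
  qed
qed

text \<open>This makes Sweedler-style formulas with nested lifts linear in the outer argument, and so allows
  the outer lift to be formed.\<close>

lemma tlift_linear_parameter:
  assumes X: "vspace X" and V: "vspace V" and W: "vspace W" and U: "vspace U"
    and \<beta>: "\<And>x. x \<in> points X \<Longrightarrow> bilinear_map V W U (\<beta> x)"
    and lin: "\<And>v w. v \<in> points V \<Longrightarrow> w \<in> points W \<Longrightarrow> linear_map X U (\<lambda>x. \<beta> x v w)"
    and t: "t \<in> points (tensor V W)"
  shows "linear_map X U (\<lambda>x. tlift V W (\<beta> x) t)"
  using t
proof (rule tensor_induct)
  have "linear_map X U (\<lambda>x. tlift V W (\<beta> x) 0) \<longleftrightarrow> linear_map X U (\<lambda>x. 0)"
    by (rule linear_map_cong[OF X]) (simp add: tlift_zero[OF V W \<beta>])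
  then show "linear_map X U (\<lambda>x. tlift V W (\<beta> x) 0)" using linear_map_zero[OF U] by simp
next
  fix v w t
  assume add: "v \<in> points V" "w \<in> points W" "t \<in> points (tensor V W)"
    "linear_map X U (\<lambda>x. tlift V W (\<beta> x) t)"
  have "linear_map X U (\<lambda>x. tlift V W (\<beta> x) (ten V W v w + t))
      \<longleftrightarrow> linear_map X U (\<lambda>x. \<beta> x v w + tlift V W (\<beta> x) t)"
    by (rule linear_map_cong[OF X]) (simp add: tlift_add[OF V W \<beta>] tlift_ten[OF V W \<beta>] ten_in add)
  then show "linear_map X U (\<lambda>x. tlift V W (\<beta> x) (ten V W v w + t))"
    using linear_map_plus[OF U lin add(4)] add by simp
qed

lemma tlift_cong:
  assumes "\<And>v w. v \<in> points V \<Longrightarrow> w \<in> points W \<Longrightarrow> \<beta> v w = \<gamma> v w"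
  shows "tlift V W \<beta> t = tlift V W \<gamma> t"
proof -
  have "(\<Sum>(v, w)\<leftarrow>ps. \<beta> v w) = (\<Sum>(v, w)\<leftarrow>ps. \<gamma> v w)" if "set ps \<subseteq> points V \<times> points W" for ps
    using that by (induction ps) (auto simp: assms)
  then have "(\<exists>ps. set ps \<subseteq> points V \<times> points W \<and> t = (\<Sum>(v, w)\<leftarrow>ps. ten V W v w) \<and> z = (\<Sum>(v, w)\<leftarrow>ps. \<beta> v w))
     \<longleftrightarrow> (\<exists>ps. set ps \<subseteq> points V \<times> points W \<and> t = (\<Sum>(v, w)\<leftarrow>ps. ten V W v w) \<and> z = (\<Sum>(v, w)\<leftarrow>ps. \<gamma> v w))" for z
    by metis
  then show ?thesis unfolding tlift_def by simp
qed

text \<open>Two nested lifts, which is how products on tensor products and the tensor product of two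
  coproducts are built.\<close>

lemma
  assumes V1: "vspace V1" and V2: "vspace V2" and W1: "vspace W1" and W2: "vspace W2" and U: "vspace U"
    and \<gamma>1: "\<And>w1 w2. w1 \<in> points W1 \<Longrightarrow> w2 \<in> points W2 \<Longrightarrow> bilinear_map V1 V2 U (\<lambda>v1 v2. \<gamma> v1 v2 w1 w2)"
    and \<gamma>2: "\<And>v1 v2. v1 \<in> points V1 \<Longrightarrow> v2 \<in> points V2 \<Longrightarrow> bilinear_map W1 W2 U (\<gamma> v1 v2)"
  shows nested_tlift_bilinear: "bilinear_map (tensor V1 V2) (tensor W1 W2) U
      (\<lambda>s t. tlift V1 V2 (\<lambda>v1 v2. tlift W1 W2 (\<gamma> v1 v2) t) s)" (is ?bil)
    and nested_tlift_ten: "\<And>v1 v2 w1 w2. v1 \<in> points V1 \<Longrightarrow> v2 \<in> points V2 \<Longrightarrow> w1 \<in> points W1 \<Longrightarrow> w2 \<in> points W2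
      \<Longrightarrow> tlift V1 V2 (\<lambda>v1 v2. tlift W1 W2 (\<gamma> v1 v2) (ten W1 W2 w1 w2)) (ten V1 V2 v1 v2) = \<gamma> v1 v2 w1 w2"
proof -
  have inner: "bilinear_map V1 V2 U (\<lambda>v1 v2. tlift W1 W2 (\<gamma> v1 v2) t)" if t: "t \<in> points (tensor W1 W2)" for t
  proof (rule bilinear_mapI)
    show "linear_map V2 U (\<lambda>v2. tlift W1 W2 (\<gamma> v1 v2) t)" if "v1 \<in> points V1" for v1
      using that \<gamma>2 bilinear_right[OF \<gamma>1 that] by (intro tlift_linear_parameter V2 W1 W2 U t) auto
    show "linear_map V1 U (\<lambda>v1. tlift W1 W2 (\<gamma> v1 v2) t)" if "v2 \<in> points V2" for v2
      using that \<gamma>2 bilinear_left[OF \<gamma>1 that] by (intro tlift_linear_parameter V1 W1 W2 U t) auto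
  qed
  show ?bil
  proof (rule bilinear_mapI)
    show "linear_map (tensor W1 W2) U (\<lambda>t. tlift V1 V2 (\<lambda>v1 v2. tlift W1 W2 (\<gamma> v1 v2) t) s)"
      if s: "s \<in> points (tensor V1 V2)" for s
      using inner tlift_linear[OF W1 W2 U \<gamma>2] by (intro tlift_linear_parameter vspace_tensor V1 V2 W1 W2 U s) auto
    show "linear_map (tensor V1 V2) U (\<lambda>s. tlift V1 V2 (\<lambda>v1 v2. tlift W1 W2 (\<gamma> v1 v2) t) s)"
      if "t \<in> points (tensor W1 W2)" for t
      using inner[OF that] by (intro tlift_linear V1 V2 U)
  qed
  show "tlift V1 V2 (\<lambda>v1 v2. tlift W1 W2 (\<gamma> v1 v2) (ten W1 W2 w1 w2)) (ten V1 V2 v1 v2) = \<gamma> v1 v2 w1 w2"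
    if "v1 \<in> points V1" "v2 \<in> points V2" "w1 \<in> points W1" "w2 \<in> points W2" for v1 v2 w1 w2
    using that tlift_ten[OF V1 V2 inner] tlift_ten[OF W1 W2 \<gamma>2] by (simp add: ten_in)
qed


section \<open>Tensors as bilinear functions on the duals\<close>

lemma tensor_outside:
  fixes V :: "('k::field, 'v::ab_group_add) space" and W :: "('k, 'w::ab_group_add) space"
  assumes "t \<in> points (tensor V W)" "\<not> (\<xi> \<in> points (dual V) \<and> \<eta> \<in> points (dual W))"
  shows "t (\<xi>, \<eta>) = 0"
  using assms(1)
proof (rule tensor_induct)
  show "(0::('k, 'v, 'w) tensor) (\<xi>, \<eta>) = 0" by simp
  show "(ten V W v w + t) (\<xi>, \<eta>) = 0" if "t (\<xi>, \<eta>) = 0" for v w t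
    using that assms(2) by (auto simp: ten_def)
qed

lemma tensor_eqI:
  fixes V :: "('k::field, 'v::ab_group_add) space" and W :: "('k, 'w::ab_group_add) space"
  assumes "s \<in> points (tensor V W)" "t \<in> points (tensor V W)"
    and "\<And>\<xi> \<eta>. \<xi> \<in> points (dual V) \<Longrightarrow> \<eta> \<in> points (dual W) \<Longrightarrow> s (\<xi>, \<eta>) = t (\<xi>, \<eta>)"
  shows "s = t"
proof
  fix p :: "('v \<Rightarrow> 'k) \<times> ('w \<Rightarrow> 'k)"
  obtain \<xi> \<eta> where p: "p = (\<xi>, \<eta>)" by (cases p)
  show "s p = t p"
    using assms(3) tensor_outside[OF assms(1), of \<xi> \<eta>] tensor_outside[OF assms(2), of \<xi> \<eta>]
    unfolding p by metis
qed

lemma tensor_eval_linear: "linear_map (tensor V W) scalars (\<lambda>t. t p)"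
  by (rule linear_mapI) auto

lemma tpair_eq:
  assumes V: "vspace V" and W: "vspace W" and "\<xi> \<in> points (dual V)" "\<eta> \<in> points (dual W)"
    and t: "t \<in> points (tensor V W)"
  shows "tpair V W \<xi> \<eta> t = t (\<xi>, \<eta>)"
proof -
  have b: "bilinear_map V W scalars (\<lambda>v w. \<xi> v * \<eta> w)"
    by (intro bilinear_map_mult dual_linear assms)
  show ?thesis unfolding tpair_def
    by (rule linear_eq_on_tensor[OF V W tlift_linear[OF V W vspace_scalars b] tensor_eval_linear _ t])
      (simp add: tlift_ten[OF V W b] assms)
qed

lemma tensor_eval_bilinear:
  fixes V :: "('k::field, 'v::ab_group_add) space" and W :: "('k, 'w::ab_group_add) space"
  assumes "t \<in> points (tensor V W)" "vspace V" "vspace W"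
  shows "bilinear_map (dual V) (dual W) scalars (\<lambda>f g. t (f, g))"
  using assms(1)
proof (rule tensor_induct)
  note vd = vspace_dual[OF assms(2)] vspace_dual[OF assms(3)]
  show "bilinear_map (dual V) (dual W) scalars (\<lambda>f g. (0::('k, 'v, 'w) tensor) (f, g))"
    by (simp add: bilinear_map_def linear_map_zero[OF vspace_scalars])
  fix v w t
  assume IH: "bilinear_map (dual V) (dual W) scalars (\<lambda>f g. t (f, g))"
  have "bilinear_map (dual V) (dual W) scalars (\<lambda>f g. f v * g w + t (f, g))"
    by (intro bilinear_map_plus vspace_scalars bilinear_map_mult dual_eval IH)
  then show "bilinear_map (dual V) (dual W) scalars (\<lambda>f g. (ten V W v w + t) (f, g))"
    by (subst bilinear_map_cong[OF vd]) auto
qed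

text \<open>The pure tensor \<open>f \<otimes> g\<close> as a functional on \<open>V \<otimes> W\<close>.\<close>

definition prod_functional where
  "prod_functional V W f g = (\<lambda>t. if t \<in> points (tensor V W) then t (f, g) else 0)"

lemma prod_functional_apply [simp]:
  "t \<in> points (tensor V W) \<Longrightarrow> prod_functional V W f g t = t (f, g)"
  by (simp add: prod_functional_def)

lemma prod_functional_dual:
  "vspace V \<Longrightarrow> vspace W \<Longrightarrow> prod_functional V W f g \<in> points (dual (tensor V W))"
  using linear_map_cong[OF vspace_tensor, of V W "prod_functional V W f g" "\<lambda>t. t (f, g)"]
  by (auto simp: dual_iff tensor_eval_linear prod_functional_def)

lemma prod_functional_bilinear:
  assumes "vspace V" "vspace W"
  shows "bilinear_map (dual V) (dual W) (dual (tensor V W)) (prod_functional V W)"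
proof (intro bilinear_mapI linear_mapI prod_functional_dual assms)
  note b = tensor_eval_bilinear[OF _ assms]
  show "prod_functional V W f (g + h) = prod_functional V W f g + prod_functional V W f h"
    if "f \<in> points (dual V)" "g \<in> points (dual W)" "h \<in> points (dual W)" for f g h
    using linear_map_add[OF bilinear_right[OF b that(1)] that(2,3)]
    by (auto simp: prod_functional_def fun_eq_iff)
  show "prod_functional V W f (smult (dual W) c g) = smult (dual (tensor V W)) c (prod_functional V W f g)"
    if "f \<in> points (dual V)" "g \<in> points (dual W)" for f g c
    using linear_map_smult[OF bilinear_right[OF b that(1)] that(2)]
    by (auto simp: prod_functional_def fun_eq_iff)
  show "prod_functional V W (f + h) g = prod_functional V W f g + prod_functional V W h g"
    if "g \<in> points (dual W)" "f \<in> points (dual V)" "h \<in> points (dual V)" for f g h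
    using linear_map_add[OF bilinear_left[OF b that(1)] that(2,3)]
    by (auto simp: prod_functional_def fun_eq_iff)
  show "prod_functional V W (smult (dual V) c f) g = smult (dual (tensor V W)) c (prod_functional V W f g)"
    if "g \<in> points (dual W)" "f \<in> points (dual V)" for f g c
    using linear_map_smult[OF bilinear_left[OF b that(1)] that(2)]
    by (auto simp: prod_functional_def fun_eq_iff)
qed

definition pullback where
  "pullback V F f = (\<lambda>v. if v \<in> points V then f (F v) else 0)"

lemma pullback_apply [simp]: "v \<in> points V \<Longrightarrow> pullback V F f v = f (F v)"
  by (simp add: pullback_def)

lemma pullback_dual:
  assumes V: "vspace V" and F: "linear_map V W F" and f: "f \<in> points (dual W)"
  shows "pullback V F f \<in> points (dual V)"
  using linear_map_cong[OF V, of "pullback V F f" "\<lambda>v. f (F v)" scalars]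
    linear_map_comp[OF F dual_linear[OF f]]
  by (auto simp: dual_iff pullback_def)

lemma pullback_id: "f \<in> points (dual V) \<Longrightarrow> pullback V (\<lambda>x. x) f = f"
  by (auto simp: pullback_def fun_eq_iff dual_outside)

lemma neg_transpose_eq: "neg_transpose V F f = - pullback V F f"
  by (auto simp: neg_transpose_def pullback_def fun_eq_iff)

context
  fixes V :: "('k::field, 'v::ab_group_add) space" and W :: "('k, 'w::ab_group_add) space"
    and V' :: "('k, 'p::ab_group_add) space" and W' :: "('k, 'q::ab_group_add) space"
  assumes V: "vspace V" and W: "vspace W" and V': "vspace V'" and W': "vspace W'"
begin

lemma tmap_linear_in:
  assumes F: "linear_map V V' F" and G: "linear_map W W' G"
  shows "linear_map (tensor V W) (tensor V' W') (tmap V W V' W' F G)"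
  unfolding tmap_def
  by (intro tlift_linear V W vspace_tensor V' W' bilinear_map_comp2[OF bilinear_ten] F G)

lemma tmap_ten:
  assumes F: "linear_map V V' F" and G: "linear_map W W' G" and "v \<in> points V" "w \<in> points W"
  shows "tmap V W V' W' F G (ten V W v w) = ten V' W' (F v) (G w)"
  unfolding tmap_def
  by (rule tlift_ten[OF V W bilinear_map_comp2[OF bilinear_ten[OF V' W'] F G]]) fact+

lemma tmap_eval:
  assumes F: "linear_map V V' F" and G: "linear_map W W' G"
    and f: "f \<in> points (dual V')" and g: "g \<in> points (dual W')" and t: "t \<in> points (tensor V W)"
  shows "tmap V W V' W' F G t (f, g) = t (pullback V F f, pullback W G g)"
  by (rule linear_eq_on_tensor[OF V W linear_map_comp[OF tmap_linear_in[OF F G] tensor_eval_linear]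
        tensor_eval_linear _ t])
    (simp add: tmap_ten[OF F G] f g pullback_dual[OF V F] pullback_dual[OF W G])

end

context
  fixes V :: "('k::field, 'v::ab_group_add) space" and W :: "('k, 'w::ab_group_add) space"
  assumes V: "vspace V" and W: "vspace W"
begin

lemma tflip_linear: "linear_map (tensor V W) (tensor W V) (tflip V W)"
  unfolding tflip_def by (intro tlift_linear V W vspace_tensor bilinear_map_flip[OF bilinear_ten])

lemma tflip_ten: "v \<in> points V \<Longrightarrow> w \<in> points W \<Longrightarrow> tflip V W (ten V W v w) = ten W V w v"
  unfolding tflip_def by (rule tlift_ten[OF V W bilinear_map_flip[OF bilinear_ten[OF W V]]])

lemma tflip_eval:
  assumes f: "f \<in> points (dual V)" and g: "g \<in> points (dual W)" and t: "t \<in> points (tensor V W)"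
  shows "tflip V W t (g, f) = t (f, g)"
  by (rule linear_eq_on_tensor[OF V W linear_map_comp[OF tflip_linear tensor_eval_linear]
        tensor_eval_linear _ t])
    (simp add: tflip_ten f g)

end

lemma tlift_curried_bilinear:
  assumes V: "vspace V" and W: "vspace W" and U: "vspace U" and X: "vspace X"
    and 1: "\<And>v. v \<in> points V \<Longrightarrow> bilinear_map W U X (\<gamma> v)"
    and 2: "\<And>w u. w \<in> points W \<Longrightarrow> u \<in> points U \<Longrightarrow> linear_map V X (\<lambda>v. \<gamma> v w u)"
  shows "bilinear_map V (tensor W U) X (\<lambda>v. tlift W U (\<gamma> v))"
  by (intro bilinear_mapI tlift_linear tlift_linear_parameter V W U X 1 2)

lemma
  assumes V: "vspace V" and W: "vspace W" and U: "vspace U"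
  shows tassoc_linear: "linear_map (tensor V (tensor W U)) (tensor (tensor V W) U) (tassoc V W U)"
    and tassoc_eval: "f \<in> points (dual V) \<Longrightarrow> g \<in> points (dual W) \<Longrightarrow> h \<in> points (dual U)
      \<Longrightarrow> t \<in> points (tensor V (tensor W U))
      \<Longrightarrow> tassoc V W U t (prod_functional V W f g, h) = t (f, prod_functional W U g h)"
proof -
  let ?\<gamma> = "\<lambda>v w u. ten (tensor V W) U (ten V W v w) u"
  note VW = vspace_tensor[OF V W] and WU = vspace_tensor[OF W U]
  have 1: "bilinear_map W U (tensor (tensor V W) U) (?\<gamma> v)" if "v \<in> points V" for v
    by (rule bilinear_map_comp2[OF bilinear_ten[OF VW U]
          bilinear_right[OF bilinear_ten[OF V W] that] linear_map_id])
  have 2: "linear_map V (tensor (tensor V W) U) (\<lambda>v. ?\<gamma> v w u)"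
    if "w \<in> points W" "u \<in> points U" for w u
    by (rule linear_map_comp[OF bilinear_left[OF bilinear_ten[OF V W] that(1)]
          bilinear_left[OF bilinear_ten[OF VW U] that(2)]])
  have b: "bilinear_map V (tensor W U) (tensor (tensor V W) U) (\<lambda>v. tlift W U (?\<gamma> v))"
    by (intro tlift_curried_bilinear V W U vspace_tensor VW 1 2)
  show lin: "linear_map (tensor V (tensor W U)) (tensor (tensor V W) U) (tassoc V W U)"
    unfolding tassoc_def by (intro tlift_linear V W U vspace_tensor b)
  show "tassoc V W U t (prod_functional V W f g, h) = t (f, prod_functional W U g h)"
    if "f \<in> points (dual V)" "g \<in> points (dual W)" "h \<in> points (dual U)"
      "t \<in> points (tensor V (tensor W U))"
  proof (rule linear_eq_on_tensor[OF V WU linear_map_comp[OF lin tensor_eval_linear]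
        tensor_eval_linear _ that(4)])
    fix v s assume v: "v \<in> points V" and s: "s \<in> points (tensor W U)"
    have "tassoc V W U (ten V (tensor W U) v s) = tlift W U (?\<gamma> v) s"
      unfolding tassoc_def by (rule tlift_ten[OF V WU b v s])
    moreover have "tlift W U (?\<gamma> v) s (prod_functional V W f g, h) = f v * s (g, h)"
      by (rule linear_eq_on_tensor[OF W U
            linear_map_comp[OF bilinear_right[OF b v] tensor_eval_linear]
            linear_map_mult_left[OF tensor_eval_linear] _ s])
        (simp add: tlift_ten[OF W U 1[OF v]] v that ten_in prod_functional_dual V W)
    ultimately show "tassoc V W U (ten V (tensor W U) v s) (prod_functional V W f g, h)
        = ten V (tensor W U) v s (f, prod_functional W U g h)"
      using s by (simp add: that prod_functional_dual W U)
  qed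
qed

lemma
  assumes V: "vspace V"
  shows tcyc_linear: "linear_map (tensor (tensor V V) V) (tensor (tensor V V) V) (tcyc V)"
    and tcyc_eval: "f \<in> points (dual V) \<Longrightarrow> g \<in> points (dual V) \<Longrightarrow> h \<in> points (dual V)
      \<Longrightarrow> t \<in> points (tensor (tensor V V) V)
      \<Longrightarrow> tcyc V t (prod_functional V V f g, h) = t (prod_functional V V h f, g)"
proof -
  let ?\<gamma> = "\<lambda>z x y. ten (tensor V V) V (ten V V y z) x"
  note VV = vspace_tensor[OF V V]
  have 1: "bilinear_map V V (tensor (tensor V V) V) (?\<gamma> z)" if "z \<in> points V" for z
    by (rule bilinear_map_flip, rule bilinear_map_comp2[OF bilinear_ten[OF VV V]
          bilinear_left[OF bilinear_ten[OF V V] that] linear_map_id])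
  have 2: "linear_map V (tensor (tensor V V) V) (\<lambda>z. ?\<gamma> z x y)"
    if "x \<in> points V" "y \<in> points V" for x y
    by (rule linear_map_comp[OF bilinear_right[OF bilinear_ten[OF V V] that(2)]
          bilinear_left[OF bilinear_ten[OF VV V] that(1)]])
  have b: "bilinear_map (tensor V V) V (tensor (tensor V V) V) (\<lambda>s z. tlift V V (?\<gamma> z) s)"
    by (intro bilinear_map_flip[OF tlift_curried_bilinear] V vspace_tensor VV 1 2)
  show lin: "linear_map (tensor (tensor V V) V) (tensor (tensor V V) V) (tcyc V)"
    unfolding tcyc_def by (intro tlift_linear V vspace_tensor b)
  show "tcyc V t (prod_functional V V f g, h) = t (prod_functional V V h f, g)"
    if "f \<in> points (dual V)" "g \<in> points (dual V)" "h \<in> points (dual V)"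
      "t \<in> points (tensor (tensor V V) V)"
  proof (rule linear_eq_on_tensor[OF VV V linear_map_comp[OF lin tensor_eval_linear]
        tensor_eval_linear _ that(4)])
    fix s z assume s: "s \<in> points (tensor V V)" and z: "z \<in> points V"
    have "tcyc V (ten (tensor V V) V s z) = tlift V V (?\<gamma> z) s"
      unfolding tcyc_def by (rule tlift_ten[OF VV V b s z])
    moreover have "tlift V V (?\<gamma> z) s (prod_functional V V f g, h) = s (h, f) * g z"
      by (rule linear_eq_on_tensor[OF V V
            linear_map_comp[OF bilinear_left[OF b z] tensor_eval_linear]
            linear_map_mult_right[OF tensor_eval_linear] _ s])
        (simp add: tlift_ten[OF V V 1[OF z]] z that ten_in prod_functional_dual V)
    ultimately show "tcyc V (ten (tensor V V) V s z) (prod_functional V V f g, h)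
        = ten (tensor V V) V s z (prod_functional V V h f, g)"
      using s by (simp add: that prod_functional_dual V)
  qed
qed

text \<open>Contracting the last factor with \<open>h\<close> leaves a tensor in \<open>V \<otimes> W\<close>, which is determined by its
  values on pairs of functionals; so triple tensors are determined by pure products of
  functionals.\<close>

lemma tensor3_eqI:
  assumes V: "vspace V" and W: "vspace W" and U: "vspace U"
    and s: "s \<in> points (tensor (tensor V W) U)" and t: "t \<in> points (tensor (tensor V W) U)"
    and eq: "\<And>f g h. f \<in> points (dual V) \<Longrightarrow> g \<in> points (dual W) \<Longrightarrow> h \<in> points (dual U)
      \<Longrightarrow> s (prod_functional V W f g, h) = t (prod_functional V W f g, h)"
  shows "s = t"
proof (rule tensor_eqI[OF s t])
  note VW = vspace_tensor[OF V W]
  fix \<zeta> h assume \<zeta>: "\<zeta> \<in> points (dual (tensor V W))" and h: "h \<in> points (dual U)"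
  define C where "C = tlift (tensor V W) U (\<lambda>x u. smult (tensor V W) (h u) x)"
  have b: "bilinear_map (tensor V W) U (tensor V W) (\<lambda>x u. smult (tensor V W) (h u) x)"
  proof (rule bilinear_mapI)
    show "linear_map U (tensor V W) (\<lambda>u. smult (tensor V W) (h u) x)" if "x \<in> points (tensor V W)" for x
      by (rule linear_map_scale_vector[OF VW that dual_linear[OF h]])
    show "linear_map (tensor V W) (tensor V W) (\<lambda>x. smult (tensor V W) (h u) x)" for u
      using vspace_smult[OF VW] by (intro linear_mapI) (auto simp: fun_eq_iff algebra_simps)
  qed
  have C: "linear_map (tensor (tensor V W) U) (tensor V W) C"
    unfolding C_def by (rule tlift_linear[OF VW U VW b])
  have eval: "\<omega> (C x) = x (\<omega>, h)"
    if "\<omega> \<in> points (dual (tensor V W))" "x \<in> points (tensor (tensor V W) U)" for \<omega> x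
    by (rule linear_eq_on_tensor[OF VW U linear_map_comp[OF C dual_linear[OF that(1)]]
          tensor_eval_linear _ that(2)])
      (use that(1) h dual_smult[OF that(1)] in \<open>simp add: tlift_ten[OF VW U b, folded C_def] mult.commute\<close>)
  have "C s = C t"
  proof (rule tensor_eqI)
    show Cs: "C s \<in> points (tensor V W)" and Ct: "C t \<in> points (tensor V W)"
      using linear_map_in[OF C] s t by auto
    fix f g assume "f \<in> points (dual V)" "g \<in> points (dual W)"
    then show "C s (f, g) = C t (f, g)"
      using eq h Cs Ct eval[OF prod_functional_dual[OF V W] s] eval[OF prod_functional_dual[OF V W] t]
      by (metis prod_functional_apply)
  qed
  then show "s (\<zeta>, h) = t (\<zeta>, h)" using eval[OF \<zeta> s] eval[OF \<zeta> t] by simp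
qed

text \<open>The product on the dual space is the transpose of the coproduct, restricted to pure products
  of functionals; the triple tensors in the axioms of coalgebras evaluate to its iterates.\<close>

context
  fixes V :: "('k::field, 'v::ab_group_add) space" and \<Delta> :: "'v \<Rightarrow> ('k, 'v, 'v) tensor"
  assumes V: "vspace V" and \<Delta>: "linear_map V (tensor V V) \<Delta>"
begin

lemma dual_product_eval:
  assumes "f \<in> points (dual V)" "g \<in> points (dual V)" "a \<in> points V"
  shows "dual_product V \<Delta> f g a = \<Delta> a (f, g)"
  using tpair_eq[OF V V assms(1,2) linear_map_in[OF \<Delta> assms(3)]] assms(3)
  by (simp add: dual_product_def)

lemma dual_product_eq_pullback:
  assumes "f \<in> points (dual V)" "g \<in> points (dual V)"
  shows "dual_product V \<Delta> f g = pullback V \<Delta> (prod_functional V V f g)"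
proof
  fix a
  show "dual_product V \<Delta> f g a = pullback V \<Delta> (prod_functional V V f g) a"
    using dual_product_eval[OF assms, of a] linear_map_in[OF \<Delta>, of a]
    by (cases "a \<in> points V") (auto simp: dual_product_def pullback_def)
qed

lemma dual_product_bilinear: "bilinear_map (dual V) (dual V) (dual V) (dual_product V \<Delta>)"
proof -
  have "linear_map (dual (tensor V V)) (dual V) (pullback V \<Delta>)"
    by (intro linear_mapI pullback_dual[OF V \<Delta>]) (auto simp: pullback_def fun_eq_iff)
  from bilinear_map_comp[OF prod_functional_bilinear[OF V V] this]
  show ?thesis
    by (subst bilinear_map_cong[OF vspace_dual[OF V] vspace_dual[OF V]]) (rule dual_product_eq_pullback)
qed

lemma cop_id_linear: "linear_map (tensor V V) (tensor (tensor V V) V) (cop_id V \<Delta>)"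
  unfolding cop_id_def by (rule tmap_linear_in[OF V V vspace_tensor[OF V V] V \<Delta> linear_map_id])

lemma cop_id_eval:
  assumes "f \<in> points (dual V)" "g \<in> points (dual V)" "h \<in> points (dual V)" "t \<in> points (tensor V V)"
  shows "cop_id V \<Delta> t (prod_functional V V f g, h) = t (dual_product V \<Delta> f g, h)"
  unfolding cop_id_def
  by (simp add: tmap_eval[OF V V vspace_tensor[OF V V] V \<Delta> linear_map_id] assms prod_functional_dual V
      pullback_id dual_product_eq_pullback)

lemma id_cop_linear: "linear_map (tensor V V) (tensor (tensor V V) V) (id_cop V \<Delta>)"
  unfolding id_cop_def
  by (rule linear_map_comp[OF tmap_linear_in[OF V V V vspace_tensor[OF V V] linear_map_id \<Delta>]
        tassoc_linear[OF V V V]])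

lemma id_cop_eval:
  assumes "f \<in> points (dual V)" "g \<in> points (dual V)" "h \<in> points (dual V)" "t \<in> points (tensor V V)"
  shows "id_cop V \<Delta> t (prod_functional V V f g, h) = t (f, dual_product V \<Delta> g h)"
proof -
  note lin = tmap_linear_in[OF V V V vspace_tensor[OF V V] linear_map_id \<Delta>]
  show ?thesis unfolding id_cop_def
    by (simp add: tassoc_eval[OF V V V] linear_map_in[OF lin] assms
        tmap_eval[OF V V V vspace_tensor[OF V V] linear_map_id \<Delta>] prod_functional_dual V
        pullback_id dual_product_eq_pullback)
qed

end

lemma flip_id_eval:
  assumes V: "vspace V" and f: "f \<in> points (dual V)" and g: "g \<in> points (dual V)"
    and h: "h \<in> points (dual V)" and t: "t \<in> points (tensor (tensor V V) V)"
  shows "flip_id V t (prod_functional V V f g, h) = t (prod_functional V V g f, h)"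
proof -
  note VV = vspace_tensor[OF V V]
  have "pullback (tensor V V) (tflip V V) (prod_functional V V f g) = prod_functional V V g f"
    using tflip_eval[OF V V g f] linear_map_in[OF tflip_linear[OF V V]]
    by (auto simp: pullback_def fun_eq_iff prod_functional_def)
  then show ?thesis unfolding flip_id_def
    by (simp add: tmap_eval[OF VV V VV V tflip_linear[OF V V] linear_map_id] assms
        prod_functional_dual pullback_id)
qed


section \<open>Finite-dimensional spaces\<close>

lemma fin_dim_vspace: "fin_dim_space V \<Longrightarrow> vspace V"
  by (simp add: fin_dim_space_def)

lemma inv_into_linear:
  assumes V: "vspace V" and f: "linear_map V W f" and bij: "bij_betw f (points V) (points W)"
  shows "linear_map W V (inv_into (points V) f)"
proof (rule linear_mapI)
  let ?g = "inv_into (points V) f"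
  have g: "?g y \<in> points V" "f (?g y) = y" if "y \<in> points W" for y
    using bij_betw_inv_into_right[OF bij that] bij_betwE[OF bij_betw_inv_into[OF bij]] that by auto
  have gf: "?g (f x) = x" if "x \<in> points V" for x
    using bij_betw_inv_into_left[OF bij that] .
  show "?g y \<in> points V" if "y \<in> points W" for y by (rule g[OF that])
  show "?g (x + y) = ?g x + ?g y" if "x \<in> points W" "y \<in> points W" for x y
    using gf[OF vspace_add[OF V g(1)[OF that(1)] g(1)[OF that(2)]]]
    by (simp add: linear_map_add[OF f] g that)
  show "?g (smult W c x) = smult V c (?g x)" if "x \<in> points W" for c x
    using gf[OF vspace_smult[OF V g(1)[OF that]], of c] by (simp add: linear_map_smult[OF f] g that)
qed

lemma sum_fun_apply: "(\<Sum>i\<in>I. f i) x = (\<Sum>i\<in>I. f i x)"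
  by (induction I rule: infinite_finite_induct) auto

text \<open>A pair of dual bases, reduced to the one property that is used: the expansion of a vector.\<close>

definition coordinates ::
  "('k::field, 'v::ab_group_add) space \<Rightarrow> 'v set \<Rightarrow> ('v \<Rightarrow> 'v \<Rightarrow> 'k) \<Rightarrow> bool" where
  "coordinates V S \<epsilon> \<longleftrightarrow> finite S \<and> S \<subseteq> points V \<and> (\<forall>s\<in>S. \<epsilon> s \<in> points (dual V))
     \<and> (\<forall>v\<in>points V. v = (\<Sum>s\<in>S. smult V (\<epsilon> s v) s))"

lemma obtain_coordinates:
  assumes "fin_dim_space V"
  obtains S \<epsilon> where "coordinates V S \<epsilon>"
proof -
  have V: "vspace V" by (rule fin_dim_vspace[OF assms])
  interpret vector_space "smult V" using V by (simp add: vspace_def)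
  obtain T where T: "finite T" "points V = span T"
    using assms by (auto simp: fin_dim_space_def)
  obtain S where S: "S \<subseteq> T" "independent S" "T \<subseteq> span S"
    using maximal_independent_subset by blast
  have span: "span S = points V"
    using T S span_mono[OF S(1)] span_mono[OF S(3)] by (simp add: span_span)
  have fin: "finite S" using S(1) T(1) by (rule finite_subset)
  have "\<forall>s\<in>S. \<exists>\<xi>. \<xi> \<in> points (dual V) \<and> (\<forall>v\<in>points V. \<xi> v = representation S v s)"
    using exists_dual[OF V S(2)] span by blast
  then obtain \<epsilon> where \<epsilon>: "\<And>s. s \<in> S \<Longrightarrow> \<epsilon> s \<in> points (dual V)"
    "\<And>s v. s \<in> S \<Longrightarrow> v \<in> points V \<Longrightarrow> \<epsilon> s v = representation S v s"
    by metis
  have "v = (\<Sum>s\<in>S. smult V (\<epsilon> s v) s)" if "v \<in> points V" for v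
    using sum_representation_eq[OF S(2) _ fin order_refl, of v] that span by (simp add: \<epsilon>(2))
  moreover have "S \<subseteq> points V" using span_superset[of S] span by simp
  ultimately have "coordinates V S \<epsilon>" using fin \<epsilon>(1) unfolding coordinates_def by blast
  then show thesis by (rule that)
qed

lemma
  assumes "coordinates V S \<epsilon>"
  shows coordinates_finite: "finite S"
    and coordinates_points: "s \<in> S \<Longrightarrow> s \<in> points V"
    and coordinates_dual: "s \<in> S \<Longrightarrow> \<epsilon> s \<in> points (dual V)"
    and coordinates_sum: "v \<in> points V \<Longrightarrow> v = (\<Sum>s\<in>S. smult V (\<epsilon> s v) s)"
  using assms unfolding coordinates_def by blast+

lemma coordinates_linear:
  assumes V: "vspace V" and S: "coordinates V S \<epsilon>" and f: "linear_map V W f" and v: "v \<in> points V"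
  shows "f v = (\<Sum>s\<in>S. smult W (\<epsilon> s v) (f s))"
proof -
  have fin: "finite S" and pts: "\<And>s. s \<in> S \<Longrightarrow> s \<in> points V"
    and rep: "v = (\<Sum>s\<in>S. smult V (\<epsilon> s v) s)"
    using coordinates_finite[OF S] coordinates_points[OF S] coordinates_sum[OF S v] by blast+
  have "f v = f (\<Sum>s\<in>S. smult V (\<epsilon> s v) s)" using rep by (rule arg_cong)
  also have "\<dots> = (\<Sum>s\<in>S. f (smult V (\<epsilon> s v) s))"
    using linear_map_sum[OF f V fin, of "\<lambda>s. smult V (\<epsilon> s v) s"] vspace_smult[OF V pts] by blast
  also have "\<dots> = (\<Sum>s\<in>S. smult W (\<epsilon> s v) (f s))"
    by (intro sum.cong refl) (simp add: linear_map_smult[OF f] pts)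
  finally show ?thesis .
qed

lemma coordinates_bilinear:
  assumes V: "vspace V" and W: "vspace W" and U: "vspace U"
    and S: "coordinates V S \<epsilon>" and T: "coordinates W T \<eta>"
    and \<beta>: "bilinear_map V W U \<beta>" and v: "v \<in> points V" and w: "w \<in> points W"
  shows "\<beta> v w = (\<Sum>s\<in>S. smult U (\<epsilon> s v) (\<Sum>t\<in>T. smult U (\<eta> t w) (\<beta> s t)))"
proof -
  have "\<beta> v w = (\<Sum>s\<in>S. smult U (\<epsilon> s v) (\<beta> s w))"
    by (rule coordinates_linear[OF V S bilinear_left[OF \<beta> w] v])
  also have "\<dots> = (\<Sum>s\<in>S. smult U (\<epsilon> s v) (\<Sum>t\<in>T. smult U (\<eta> t w) (\<beta> s t)))"
    using coordinates_linear[OF W T bilinear_right[OF \<beta> coordinates_points[OF S]] w]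
    by (intro sum.cong refl) simp
  finally show ?thesis .
qed

lemma coordinates_functional:
  assumes V: "vspace V" and S: "coordinates V S \<epsilon>" and f: "f \<in> points (dual V)"
  shows "f = (\<Sum>s\<in>S. pointwise_smult (f s) (\<epsilon> s))"
proof (rule dual_eqI[OF f])
  show "(\<Sum>s\<in>S. pointwise_smult (f s) (\<epsilon> s)) \<in> points (dual V)"
    using vspace_smult[OF vspace_dual[OF V] coordinates_dual[OF S]]
    by (intro vspace_sum vspace_dual V) simp
  show "f v = (\<Sum>s\<in>S. pointwise_smult (f s) (\<epsilon> s)) v" if "v \<in> points V" for v
    using coordinates_linear[OF V S dual_linear[OF f] that] by (simp add: sum_fun_apply mult.commute)
qed

lemma linear_map_dual_expand:
  assumes V: "vspace V" and S: "coordinates V S \<epsilon>" and \<Phi>: "linear_map (dual V) W \<Phi>"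
    and f: "f \<in> points (dual V)"
  shows "\<Phi> f = (\<Sum>s\<in>S. smult W (f s) (\<Phi> (\<epsilon> s)))"
proof -
  have fin: "finite S" and \<epsilon>: "\<And>s. s \<in> S \<Longrightarrow> \<epsilon> s \<in> points (dual V)"
    using coordinates_finite[OF S] coordinates_dual[OF S] by blast+
  have "\<Phi> f = \<Phi> (\<Sum>s\<in>S. smult (dual V) (f s) (\<epsilon> s))"
    using coordinates_functional[OF V S f] unfolding smult_dual by (rule arg_cong)
  also have "\<dots> = (\<Sum>s\<in>S. \<Phi> (smult (dual V) (f s) (\<epsilon> s)))"
    using linear_map_sum[OF \<Phi> vspace_dual[OF V] fin, of "\<lambda>s. smult (dual V) (f s) (\<epsilon> s)"]
      vspace_smult[OF vspace_dual[OF V] \<epsilon>] by blast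
  also have "\<dots> = (\<Sum>s\<in>S. smult W (f s) (\<Phi> (\<epsilon> s)))"
    by (intro sum.cong refl linear_map_smult[OF \<Phi>] \<epsilon>)
  finally show ?thesis .
qed

text \<open>The vector is \<open>\<Sum> \<Phi>(\<epsilon>\<^sub>s) s\<close>, because a functional \<open>f\<close> is \<open>\<Sum> f(s) \<epsilon>\<^sub>s\<close>.\<close>

lemma reflexive:
  assumes fin: "fin_dim_space V" and \<Phi>: "linear_map (dual V) scalars \<Phi>"
  shows "\<exists>u\<in>points V. \<forall>f\<in>points (dual V). f u = \<Phi> f"
proof -
  have V: "vspace V" by (rule fin_dim_vspace[OF fin])
  obtain S \<epsilon> where S: "coordinates V S \<epsilon>" by (rule obtain_coordinates[OF fin])
  let ?u = "\<Sum>s\<in>S. smult V (\<Phi> (\<epsilon> s)) s"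
  have pts: "smult V (\<Phi> (\<epsilon> s)) s \<in> points V" if "s \<in> S" for s
    by (rule vspace_smult[OF V coordinates_points[OF S that]])
  have "f ?u = \<Phi> f" if f: "f \<in> points (dual V)" for f
  proof -
    have "f ?u = (\<Sum>s\<in>S. f (smult V (\<Phi> (\<epsilon> s)) s))"
      using linear_map_sum[OF dual_linear[OF f] V, of S "\<lambda>s. smult V (\<Phi> (\<epsilon> s)) s"] pts
        coordinates_finite[OF S] by simp
    also have "\<dots> = (\<Sum>s\<in>S. \<Phi> (\<epsilon> s) * f s)"
      by (intro sum.cong refl dual_smult[OF f] coordinates_points[OF S])
    also have "\<dots> = \<Phi> f"
      using linear_map_dual_expand[OF V S \<Phi> f] by (simp add: mult.commute)
    finally show ?thesis .
  qed
  moreover have "?u \<in> points V" by (rule vspace_sum[OF V pts])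
  ultimately show ?thesis by blast
qed

lemma neg_transpose_bidual_spec:
  assumes fin: "fin_dim_space V" and \<phi>: "linear_map (dual V) (dual V) \<phi>" and v: "v \<in> points V"
  shows "neg_transpose_bidual V \<phi> v \<in> points V
    \<and> (\<forall>g\<in>points (dual V). g (neg_transpose_bidual V \<phi> v) = - \<phi> g v)"
proof -
  have V: "vspace V" by (rule fin_dim_vspace[OF fin])
  have lin: "linear_map (dual V) scalars (\<lambda>g. - \<phi> g v)"
    by (intro linear_map_uminus vspace_scalars linear_map_comp[OF \<phi> dual_eval])
  obtain u where u: "u \<in> points V" "\<And>g. g \<in> points (dual V) \<Longrightarrow> g u = - \<phi> g v"
    using reflexive[OF fin lin] by blast
  show ?thesis unfolding neg_transpose_bidual_def
  proof (rule theI[where a = u])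
    show "u \<in> points V \<and> (\<forall>g\<in>points (dual V). g u = - \<phi> g v)" using u by blast
    show "w = u" if "w \<in> points V \<and> (\<forall>g\<in>points (dual V). g w = - \<phi> g v)" for w
      using that u by (intro eq_if_dual_eq[OF V]) auto
  qed
qed

text \<open>Existence of the coproduct that is dual to a product on a finite-dimensional space: the tensor
  is \<open>\<Sum> \<beta>(\<epsilon>\<^sub>s, \<eta>\<^sub>t) s \<otimes> t\<close>.\<close>

lemma bilinear_represented:
  assumes fV: "fin_dim_space V" and fW: "fin_dim_space W"
    and \<beta>: "bilinear_map (dual V) (dual W) scalars \<beta>"
  obtains t where "t \<in> points (tensor V W)"
    "\<And>f g. f \<in> points (dual V) \<Longrightarrow> g \<in> points (dual W) \<Longrightarrow> t (f, g) = \<beta> f g"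
proof -
  have V: "vspace V" and W: "vspace W" using fV fW by (auto intro: fin_dim_vspace)
  obtain S \<epsilon> where S: "coordinates V S \<epsilon>" by (rule obtain_coordinates[OF fV])
  obtain T \<eta> where T: "coordinates W T \<eta>" by (rule obtain_coordinates[OF fW])
  have pts: "s \<in> points V" "\<epsilon> s \<in> points (dual V)" if "s \<in> S" for s
    using coordinates_points[OF S] coordinates_dual[OF S] that by blast+
  note ptt = coordinates_points[OF T]
  let ?t = "\<Sum>s\<in>S. \<Sum>t\<in>T. pointwise_smult (\<beta> (\<epsilon> s) (\<eta> t)) (ten V W s t)"
  have mem: "?t \<in> points (tensor V W)"
    using vspace_smult[OF vspace_tensor[OF V W] ten_in] pts ptt
    by (intro vspace_sum vspace_tensor V W) simp
  have "?t (f, g) = \<beta> f g" if f: "f \<in> points (dual V)" and g: "g \<in> points (dual W)" for f g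
  proof -
    have "\<beta> f g = (\<Sum>s\<in>S. f s * \<beta> (\<epsilon> s) g)"
      using linear_map_dual_expand[OF V S bilinear_left[OF \<beta> g] f] by simp
    also have "\<dots> = (\<Sum>s\<in>S. f s * (\<Sum>t\<in>T. g t * \<beta> (\<epsilon> s) (\<eta> t)))"
      using linear_map_dual_expand[OF W T bilinear_right[OF \<beta> pts(2)] g]
      by (intro sum.cong refl) simp
    also have "\<dots> = ?t (f, g)"
      by (simp add: sum_fun_apply f g sum_distrib_left algebra_simps)
    finally show ?thesis by simp
  qed
  then show thesis using that mem by blast
qed

lemma fin_dim_tensor:
  assumes fV: "fin_dim_space V" and fW: "fin_dim_space W"
  shows "fin_dim_space (tensor V W)"
proof -
  have V: "vspace V" and W: "vspace W" using fV fW by (auto intro: fin_dim_vspace)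
  note VW = vspace_tensor[OF V W]
  obtain S \<epsilon> where S: "coordinates V S \<epsilon>" by (rule obtain_coordinates[OF fV])
  obtain T \<eta> where T: "coordinates W T \<eta>" by (rule obtain_coordinates[OF fW])
  have fin: "finite S" "finite T" and ST: "S \<subseteq> points V" "T \<subseteq> points W"
    using coordinates_finite[OF S] coordinates_finite[OF T] coordinates_points[OF S]
      coordinates_points[OF T] by blast+
  interpret vector_space "smult (tensor V W)" using VW by (simp add: vspace_def)
  let ?G = "(\<lambda>(s, t). ten V W s t) ` (S \<times> T)"
  have "points (tensor V W) = span ?G"
  proof
    show "span ?G \<subseteq> points (tensor V W)"
    proof (rule span_minimal)
      show "?G \<subseteq> points (tensor V W)" using ST by (auto intro!: ten_in)
      show "subspace (points (tensor V W))" using VW by (simp add: vspace_def)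
    qed
    have pure: "ten V W v w \<in> span ?G" if "v \<in> points V" "w \<in> points W" for v w
    proof (subst coordinates_bilinear[OF V W VW S T bilinear_ten[OF V W] that],
        rule span_sum, rule span_scale, rule span_sum, rule span_scale)
      show "ten V W s t \<in> span ?G" if "s \<in> S" "t \<in> T" for s t
        using that by (intro span_base) blast
    qed
    show "points (tensor V W) \<subseteq> span ?G"
    proof
      fix t assume "t \<in> points (tensor V W)"
      then show "t \<in> span ?G"
      proof (rule tensor_induct)
        show "0 \<in> span ?G" by (rule span_zero)
        show "ten V W v w + t \<in> span ?G"
          if "v \<in> points V" "w \<in> points W" "t \<in> span ?G" for v w t
          using pure[OF that(1,2)] that(3) by (rule span_add)
      qed
    qed
  qed
  moreover have "finite ?G" using fin by simp
  ultimately show ?thesis using VW unfolding fin_dim_space_def by blast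
qed

text \<open>On pure tensors the identification of \<open>A* \<otimes> B*\<close> with \<open>(A \<otimes> B)*\<close> is \<open>prod_functional\<close>. It is
  onto because a functional on \<open>A \<otimes> B\<close> is recovered from its values on products of basis vectors,
  and injective because every functional on \<open>A*\<close> is evaluation at a vector.\<close>

lemma
  assumes V: "vspace V" and W: "vspace W"
  shows dual_tensor_iso_linear:
      "linear_map (tensor (dual V) (dual W)) (dual (tensor V W)) (dual_tensor_iso V W)"
    and dual_tensor_iso_ten: "f \<in> points (dual V) \<Longrightarrow> g \<in> points (dual W)
      \<Longrightarrow> dual_tensor_iso V W (ten (dual V) (dual W) f g) = prod_functional V W f g"
proof -
  note V' = vspace_dual[OF V] and W' = vspace_dual[OF W]
  let ?\<kappa> = "tlift (dual V) (dual W) (prod_functional V W)"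
  note b = prod_functional_bilinear[OF V W]
  have lin: "linear_map (tensor (dual V) (dual W)) (dual (tensor V W)) ?\<kappa>"
    by (rule tlift_linear[OF V' W' vspace_dual[OF vspace_tensor[OF V W]] b])
  have eq: "dual_tensor_iso V W s = ?\<kappa> s" if s: "s \<in> points (tensor (dual V) (dual W))" for s
  proof
    fix x
    show "dual_tensor_iso V W s x = ?\<kappa> s x"
    proof (cases "x \<in> points (tensor V W)")
      case True
      have b': "bilinear_map (dual V) (dual W) scalars (\<lambda>f g. tpair V W f g x)"
        using tensor_eval_bilinear[OF True V W]
        by (subst bilinear_map_cong[OF V' W']) (auto simp: tpair_eq[OF V W _ _ True])
      have "tlift (dual V) (dual W) (\<lambda>f g. tpair V W f g x) s = ?\<kappa> s x"
        by (rule linear_eq_on_tensor[OF V' W' tlift_linear[OF V' W' vspace_scalars b']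
              linear_map_comp[OF lin dual_eval] _ s])
          (simp add: tlift_ten[OF V' W' b'] tlift_ten[OF V' W' b] tpair_eq[OF V W _ _ True] True)
      then show ?thesis by (simp add: dual_tensor_iso_def True)
    next
      case False
      then show ?thesis
        using dual_outside[OF linear_map_in[OF lin s]] by (simp add: dual_tensor_iso_def)
    qed
  qed
  show "linear_map (tensor (dual V) (dual W)) (dual (tensor V W)) (dual_tensor_iso V W)"
    using lin by (subst linear_map_cong[OF vspace_tensor[OF V' W'] eq])
  show "dual_tensor_iso V W (ten (dual V) (dual W) f g) = prod_functional V W f g"
    if "f \<in> points (dual V)" "g \<in> points (dual W)"
    using that eq[OF ten_in[OF that]] by (simp add: tlift_ten[OF V' W' b])
qed

lemma dual_tensor_iso_bij:
  assumes fV: "fin_dim_space V" and fW: "fin_dim_space W"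
  shows "bij_betw (dual_tensor_iso V W) (points (tensor (dual V) (dual W))) (points (dual (tensor V W)))"
proof (rule bij_betw_imageI)
  have V: "vspace V" and W: "vspace W" using fV fW by (auto intro: fin_dim_vspace)
  note V' = vspace_dual[OF V] and W' = vspace_dual[OF W]
  note lin = dual_tensor_iso_linear[OF V W] and pure = dual_tensor_iso_ten[OF V W]
  show "inj_on (dual_tensor_iso V W) (points (tensor (dual V) (dual W)))"
  proof
    fix s s' assume s: "s \<in> points (tensor (dual V) (dual W))" and s': "s' \<in> points (tensor (dual V) (dual W))"
      and eq: "dual_tensor_iso V W s = dual_tensor_iso V W s'"
    show "s = s'"
    proof (rule tensor_eqI[OF s s'])
      fix \<Phi> \<Psi> assume \<Phi>: "\<Phi> \<in> points (dual (dual V))" and \<Psi>: "\<Psi> \<in> points (dual (dual W))"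
      obtain v where v: "v \<in> points V" "\<And>f. f \<in> points (dual V) \<Longrightarrow> f v = \<Phi> f"
        using reflexive[OF fV dual_linear[OF \<Phi>]] by blast
      obtain w where w: "w \<in> points W" "\<And>f. f \<in> points (dual W) \<Longrightarrow> f w = \<Psi> f"
        using reflexive[OF fW dual_linear[OF \<Psi>]] by blast
      have eval: "r (\<Phi>, \<Psi>) = dual_tensor_iso V W r (ten V W v w)" if "r \<in> points (tensor (dual V) (dual W))" for r
        by (rule linear_eq_on_tensor[OF V' W' tensor_eval_linear linear_map_comp[OF lin dual_eval] _ that])
          (simp add: pure \<Phi> \<Psi> v w ten_in)
      then show "s (\<Phi>, \<Psi>) = s' (\<Phi>, \<Psi>)" by (simp only: eval[OF s] eval[OF s'] eq)
    qed
  qed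
  show "dual_tensor_iso V W ` points (tensor (dual V) (dual W)) = points (dual (tensor V W))"
  proof
    show "dual_tensor_iso V W ` points (tensor (dual V) (dual W)) \<subseteq> points (dual (tensor V W))"
      using linear_map_in[OF lin] by blast
    show "points (dual (tensor V W)) \<subseteq> dual_tensor_iso V W ` points (tensor (dual V) (dual W))"
    proof
      fix \<zeta> assume \<zeta>: "\<zeta> \<in> points (dual (tensor V W))"
      obtain S \<epsilon> where S: "coordinates V S \<epsilon>" by (rule obtain_coordinates[OF fV])
      obtain T \<eta> where T: "coordinates W T \<eta>" by (rule obtain_coordinates[OF fW])
      have fin: "finite S" "finite T" and pts: "\<And>s. s \<in> S \<Longrightarrow> \<epsilon> s \<in> points (dual V)"
        and ptt: "\<And>t. t \<in> T \<Longrightarrow> \<eta> t \<in> points (dual W)"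
        using coordinates_finite[OF S] coordinates_finite[OF T] coordinates_dual[OF S]
          coordinates_dual[OF T] by blast+
      let ?c = "\<lambda>s t. \<zeta> (ten V W s t)" and ?e = "\<lambda>s t. ten (dual V) (dual W) (\<epsilon> s) (\<eta> t)"
      let ?z = "\<Sum>p\<in>S \<times> T. smult (tensor (dual V) (dual W)) (?c (fst p) (snd p)) (?e (fst p) (snd p))"
      have mem: "smult (tensor (dual V) (dual W)) (?c (fst p) (snd p)) (?e (fst p) (snd p))
          \<in> points (tensor (dual V) (dual W))" if "p \<in> S \<times> T" for p
        using that pts ptt by (intro vspace_smult vspace_tensor V' W' ten_in) auto
      have "dual_tensor_iso V W ?z
          = (\<Sum>p\<in>S \<times> T. dual_tensor_iso V W (smult (tensor (dual V) (dual W)) (?c (fst p) (snd p)) (?e (fst p) (snd p))))"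
        by (rule conjunct2[OF linear_map_sum[OF lin vspace_tensor[OF V' W'] finite_cartesian_product[OF fin]]])
          (rule mem)
      also have "\<dots> = (\<Sum>p\<in>S \<times> T. pointwise_smult (?c (fst p) (snd p)) (prod_functional V W (\<epsilon> (fst p)) (\<eta> (snd p))))"
        by (intro sum.cong refl) (auto simp: linear_map_smult[OF lin, simplified] pure pts ptt ten_in)
      finally have iso: "dual_tensor_iso V W ?z = \<dots>" .
      have "\<zeta> = dual_tensor_iso V W ?z"
      proof (rule dual_eqI[OF \<zeta>])
        show z: "dual_tensor_iso V W ?z \<in> points (dual (tensor V W))"
          by (intro linear_map_in[OF lin] vspace_sum vspace_tensor V' W' mem)
        fix x assume x: "x \<in> points (tensor V W)"
        show "\<zeta> x = dual_tensor_iso V W ?z x"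
        proof (rule linear_eq_on_tensor[OF V W dual_linear[OF \<zeta>] dual_linear[OF z] _ x])
          fix v w assume vw: "v \<in> points V" "w \<in> points W"
          have "\<zeta> (ten V W v w) = (\<Sum>s\<in>S. \<epsilon> s v * (\<Sum>t\<in>T. \<eta> t w * ?c s t))"
            using coordinates_bilinear[OF V W vspace_scalars S T
                bilinear_map_comp[OF bilinear_ten[OF V W] dual_linear[OF \<zeta>]] vw] by simp
          also have "\<dots> = (\<Sum>p\<in>S \<times> T. ?c (fst p) (snd p) * (\<epsilon> (fst p) v * \<eta> (snd p) w))"
            unfolding sum_distrib_left sum.cartesian_product by (intro sum.cong refl) auto
          also have "\<dots> = dual_tensor_iso V W ?z (ten V W v w)"
            unfolding iso using vw pts ptt by (simp add: sum_fun_apply ten_in mem_Times_iff)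
          finally show "\<zeta> (ten V W v w) = dual_tensor_iso V W ?z (ten V W v w)" .
        qed
      qed
      moreover have "?z \<in> points (tensor (dual V) (dual W))"
        by (intro vspace_sum vspace_tensor V' W' mem)
      ultimately show "\<zeta> \<in> dual_tensor_iso V W ` points (tensor (dual V) (dual W))" by (rule image_eqI)
    qed
  qed
qed


section \<open>Nondegenerate symmetric forms\<close>

context
  fixes B :: "('k::field, 'b::ab_group_add) space" and form :: "'b \<Rightarrow> 'b \<Rightarrow> 'k"
  assumes fin: "fin_dim_space B" and form: "bilinear_map B B scalars form"
    and sym: "\<And>a b. a \<in> points B \<Longrightarrow> b \<in> points B \<Longrightarrow> form a b = form b a"
    and nondeg: "\<And>a. a \<in> points B \<Longrightarrow> (\<And>b. b \<in> points B \<Longrightarrow> form a b = 0) \<Longrightarrow> a = 0"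
begin

lemma form_map_apply: "b \<in> points B \<Longrightarrow> form_map B form a b = form a b"
  by (simp add: form_map_def)

lemma form_map_linear: "linear_map B (dual B) (form_map B form)"
proof (rule linear_mapI)
  show "form_map B form a \<in> points (dual B)" if "a \<in> points B" for a
    using linear_map_cong[OF fin_dim_vspace[OF fin], of "form_map B form a" "form a" scalars]
      bilinear_right[OF form that]
    by (auto simp: dual_iff form_map_def)
qed (use linear_map_add[OF bilinear_left[OF form]] linear_map_smult[OF bilinear_left[OF form]]
    in \<open>auto simp: form_map_def fun_eq_iff\<close>)

text \<open>If the image of the form map were a proper subspace of the dual, some nonzero functional on
  the dual would vanish on it; by reflexivity that functional is evaluation at a vector orthogonal
  to everything.\<close>

lemma form_map_bij: "bij_betw (form_map B form) (points B) (points (dual B))"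
proof (rule bij_betw_imageI)
  note B = fin_dim_vspace[OF fin]
  note B' = vspace_dual[OF B]
  let ?\<phi> = "form_map B form"
  show "inj_on ?\<phi> (points B)"
  proof
    fix a b assume ab: "a \<in> points B" "b \<in> points B" and eq: "?\<phi> a = ?\<phi> b"
    have "form (a - b) c = 0" if c: "c \<in> points B" for c
      using linear_map_diff[OF bilinear_left[OF form c] B ab] fun_cong[OF eq, of c] c
      by (simp add: form_map_def)
    then show "a = b" using nondeg[OF vspace_diff[OF B ab]] by simp
  qed
  interpret vector_space "smult (dual B)" using B' by (simp add: vspace_def)
  let ?W = "?\<phi> ` points B"
  have sub: "subspace ?W"
  proof (rule subspaceI)
    show "0 \<in> ?W" using linear_map_0[OF form_map_linear B] vspace_0[OF B] by (metis image_eqI)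
    show "x + y \<in> ?W" if "x \<in> ?W" "y \<in> ?W" for x y
      using that linear_map_add[OF form_map_linear, symmetric] vspace_add[OF B] by auto
    show "smult (dual B) c x \<in> ?W" if "x \<in> ?W" for c x
      using that linear_map_smult[OF form_map_linear, symmetric] vspace_smult[OF B] by auto
  qed
  show "?W = points (dual B)"
  proof
    show "?W \<subseteq> points (dual B)" using linear_map_in[OF form_map_linear] by blast
    show "points (dual B) \<subseteq> ?W"
    proof
      fix f assume f: "f \<in> points (dual B)"
      show "f \<in> ?W"
      proof (rule ccontr)
        assume "f \<notin> ?W"
        obtain S where S: "S \<subseteq> ?W" "independent S" "?W \<subseteq> span S"
          using maximal_independent_subset by blast
        have "span S \<subseteq> ?W" by (rule span_minimal[OF S(1) sub])
        then have fS: "f \<notin> span S" using \<open>f \<notin> ?W\<close> by blast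
        then have fS': "f \<notin> S" using span_base by blast
        have ind: "independent (insert f S)" by (rule independent_insertI[OF fS S(2)])
        obtain \<xi> where \<xi>: "\<xi> \<in> points (dual (dual B))"
          "\<And>g. g \<in> points (dual B) \<Longrightarrow> g \<in> span (insert f S) \<Longrightarrow> \<xi> g = representation (insert f S) g f"
          using exists_dual[OF B' ind, of f] by blast
        obtain u where u: "u \<in> points B" "\<And>g. g \<in> points (dual B) \<Longrightarrow> g u = \<xi> g"
          using reflexive[OF fin dual_linear[OF \<xi>(1)]] by blast
        have "form u b = 0" if b: "b \<in> points B" for b
        proof -
          have mem: "?\<phi> b \<in> span S" using S(3) b by blast
          have "form u b = ?\<phi> b u" using sym[OF u(1) b] u(1) by (simp add: form_map_def)
          also have "\<dots> = \<xi> (?\<phi> b)" by (rule u(2)[OF linear_map_in[OF form_map_linear b]])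
          also have "\<dots> = representation (insert f S) (?\<phi> b) f"
            using \<xi>(2)[OF linear_map_in[OF form_map_linear b]] mem span_mono[of S "insert f S"] by blast
          also have "\<dots> = representation S (?\<phi> b) f"
            using representation_extend[OF ind mem subset_insertI] by simp
          also have "\<dots> = 0" using representation_ne_zero[of S] fS' by blast
          finally show ?thesis .
        qed
        then have "u = 0" by (rule nondeg[OF u(1)])
        moreover have "f u = 1"
          using u(2)[OF f] \<xi>(2)[OF f span_base] representation_basis[OF ind, of f] by simp
        ultimately show False using dual_0[OF f B] by simp
      qed
    qed
  qed
qed

lemma
  shows form_map_inv_linear: "linear_map (dual B) B (inv_into (points B) (form_map B form))"
    and form_map_inv_left: "b \<in> points B \<Longrightarrow> inv_into (points B) (form_map B form) (form_map B form b) = b"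
    and form_map_inv_right: "f \<in> points (dual B) \<Longrightarrow> form_map B form (inv_into (points B) (form_map B form) f) = f"
  using inv_into_linear[OF fin_dim_vspace[OF fin] form_map_linear form_map_bij]
    bij_betw_inv_into_left[OF form_map_bij] bij_betw_inv_into_right[OF form_map_bij] by auto

lemma obtain_form_map:
  assumes "f \<in> points (dual B)"
  obtains b where "b \<in> points B" "f = form_map B form b"
  using assms form_map_bij by (auto simp: bij_betw_def)

lemma
  assumes d: "bilinear_map B B B d"
  shows form_coproduct_linear: "linear_map B (tensor B B) (form_coproduct B d form)"
    and form_coproduct_eval: "a \<in> points B \<Longrightarrow> b \<in> points B \<Longrightarrow> c \<in> points B
      \<Longrightarrow> form_coproduct B d form a (form_map B form b, form_map B form c) = form a (d b c)"
proof -
  note B = fin_dim_vspace[OF fin]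
  let ?\<phi> = "form_map B form" and ?\<psi> = "inv_into (points B) (form_map B form)"
  let ?\<Delta> = "form_coproduct B d form"
  have pair: "tpair B B (\<lambda>x. form x b) (\<lambda>y. form y c) t = t (?\<phi> b, ?\<phi> c)"
    if "b \<in> points B" "c \<in> points B" "t \<in> points (tensor B B)" for b c t
  proof -
    have "tpair B B (\<lambda>x. form x b) (\<lambda>y. form y c) t = tpair B B (?\<phi> b) (?\<phi> c) t"
      unfolding tpair_def by (rule tlift_cong) (simp add: form_map_def sym that)
    then show ?thesis
      using tpair_eq[OF B B _ _ that(3)] linear_map_in[OF form_map_linear] that by simp
  qed
  have spec: "?\<Delta> a \<in> points (tensor B B) \<and> (\<forall>b\<in>points B. \<forall>c\<in>points B.
      tpair B B (\<lambda>x. form x b) (\<lambda>y. form y c) (?\<Delta> a) = form a (d b c))" if a: "a \<in> points B" for a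
  proof -
    have "bilinear_map (dual B) (dual B) scalars (\<lambda>f g. form a (d (?\<psi> f) (?\<psi> g)))"
      by (rule bilinear_map_comp[OF bilinear_map_comp2[OF d form_map_inv_linear form_map_inv_linear]
            bilinear_right[OF form a]])
    then obtain t where t: "t \<in> points (tensor B B)"
      "\<And>f g. f \<in> points (dual B) \<Longrightarrow> g \<in> points (dual B) \<Longrightarrow> t (f, g) = form a (d (?\<psi> f) (?\<psi> g))"
      using bilinear_represented[OF fin fin] by blast
    have t': "t (?\<phi> b, ?\<phi> c) = form a (d b c)" if "b \<in> points B" "c \<in> points B" for b c
      using t(2) that linear_map_in[OF form_map_linear] by (simp add: form_map_inv_left)
    show ?thesis unfolding form_coproduct_def
    proof (rule theI[where a = t], intro conjI ballI)
      show "tpair B B (\<lambda>x. form x b) (\<lambda>y. form y c) t = form a (d b c)"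
        if "b \<in> points B" "c \<in> points B" for b c
        using that pair t(1) t' by simp
      fix s assume s: "s \<in> points (tensor B B) \<and> (\<forall>b\<in>points B. \<forall>c\<in>points B.
          tpair B B (\<lambda>x. form x b) (\<lambda>y. form y c) s = form a (d b c))"
      show "s = t"
      proof (rule tensor_eqI)
        fix f g assume "f \<in> points (dual B)" "g \<in> points (dual B)"
        then show "s (f, g) = t (f, g)"
          using s pair t' by (metis obtain_form_map)
      qed (use s t in auto)
    qed (fact t)
  qed
  show eval: "?\<Delta> a (?\<phi> b, ?\<phi> c) = form a (d b c)"
    if "a \<in> points B" "b \<in> points B" "c \<in> points B" for a b c
    using spec that pair by metis
  show "linear_map B (tensor B B) ?\<Delta>"
  proof (rule linear_mapI)
    show mem: "?\<Delta> a \<in> points (tensor B B)" if "a \<in> points B" for a using spec[OF that] by blast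
    note BB = vspace_tensor[OF B B]
    show "?\<Delta> (a + a') = ?\<Delta> a + ?\<Delta> a'" if aa: "a \<in> points B" "a' \<in> points B" for a a'
    proof (rule tensor_eqI)
      fix f g assume "f \<in> points (dual B)" "g \<in> points (dual B)"
      then obtain b c where "b \<in> points B" "c \<in> points B" "f = ?\<phi> b" "g = ?\<phi> c"
        by (metis obtain_form_map)
      then show "?\<Delta> (a + a') (f, g) = (?\<Delta> a + ?\<Delta> a') (f, g)"
        using linear_map_add[OF bilinear_left[OF form bilinear_in[OF d]] aa]
        by (simp add: eval aa vspace_add[OF B])
    qed (simp_all add: mem aa vspace_add[OF B] vspace_add[OF BB])
    show "?\<Delta> (smult B k a) = smult (tensor B B) k (?\<Delta> a)" if a: "a \<in> points B" for k a
    proof (rule tensor_eqI)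
      fix f g assume "f \<in> points (dual B)" "g \<in> points (dual B)"
      then obtain b c where "b \<in> points B" "c \<in> points B" "f = ?\<phi> b" "g = ?\<phi> c"
        by (metis obtain_form_map)
      then show "?\<Delta> (smult B k a) (f, g) = smult (tensor B B) k (?\<Delta> a) (f, g)"
        using linear_map_smult[OF bilinear_left[OF form bilinear_in[OF d]] a]
        by (simp add: eval a vspace_smult[OF B])
    qed (use mem a vspace_smult[OF B] vspace_smult[OF BB] in auto)
  qed
qed

end


section \<open>The canonical form on a space plus its dual\<close>

lemma std_form_sym: "std_form u v = std_form v u"
  by (simp add: std_form_def)

lemma std_form_linear:
  assumes V: "vspace V" and v: "v \<in> points (dsum V (dual V))"
  shows "linear_map (dsum V (dual V)) scalars (\<lambda>u. std_form u v)"
  unfolding std_form_def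
  using v linear_map_comp[OF linear_map_fst dual_linear, of "snd v" V "dual V"]
  by (intro linear_map_plus vspace_scalars linear_map_comp[OF linear_map_snd dual_eval]) auto

lemma std_form_bilinear:
  assumes "vspace V"
  shows "bilinear_map (dsum V (dual V)) (dsum V (dual V)) scalars std_form"
  using std_form_linear[OF assms] by (intro bilinear_mapI) (auto simp: std_form_sym[of _ "_ :: 'b \<times> _"])

lemma std_form_eqI:
  assumes V: "vspace V" and u: "u \<in> points (dsum V (dual V))" and v: "v \<in> points (dsum V (dual V))"
    and eq: "\<And>a f. a \<in> points V \<Longrightarrow> f \<in> points (dual V) \<Longrightarrow> std_form u (a, f) = std_form v (a, f)"
  shows "u = v"
proof (rule prod_eqI)
  show "fst u = fst v"
  proof (rule eq_if_dual_eq[OF V])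
    show "g (fst u) = g (fst v)" if "g \<in> points (dual V)" for g
      using eq[OF vspace_0[OF V] that] u v by (auto simp: std_form_def dual_0[OF _ V])
  qed (use u v in auto)
  show "snd u = snd v"
    using u v eq[OF _ vspace_0[OF vspace_dual[OF V]]] by (intro dual_eqI[of _ V]) (auto simp: std_form_def)
qed

lemma linear_eq_on_dsum:
  assumes V: "vspace V" and W: "vspace W" and f: "linear_map (dsum V W) U f" and g: "linear_map (dsum V W) U g"
    and 1: "\<And>v. v \<in> points V \<Longrightarrow> f (v, 0) = g (v, 0)" and 2: "\<And>w. w \<in> points W \<Longrightarrow> f (0, w) = g (0, w)"
    and x: "x \<in> points (dsum V W)"
  shows "f x = g x"
proof -
  obtain v w where vw: "x = (v, 0) + (0, w)" "v \<in> points V" "w \<in> points W" using x by auto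
  have "(v, 0) \<in> points (dsum V W)" "(0, w) \<in> points (dsum V W)" using vw V W by (auto simp: vspace_0)
  then show ?thesis using 1 2 vw by (simp only: linear_map_add[OF f] linear_map_add[OF g])
qed


section \<open>The Manin triple of a Novikov bialgebra\<close>

lemma Lstar_linear: "bilinear_map V V V m \<Longrightarrow> vspace V \<Longrightarrow> a \<in> points V \<Longrightarrow> linear_map V V (Lstar m a)"
  unfolding Lstar_def using linear_map_plus[OF _ bilinear_right bilinear_left] by blast

lemma Rmul_linear: "bilinear_map V V V m \<Longrightarrow> a \<in> points V \<Longrightarrow> linear_map V V (Rmul m a)"
  unfolding Rmul_def using bilinear_left by blast

text \<open>Pairing the two coalgebra axioms with \<open>f \<otimes> g \<otimes> h\<close> gives the two Novikov identities of the dual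
  product.\<close>

lemma dual_novikov_algebra:
  assumes "novikov_coalgebra V \<Delta>"
  shows "novikov_algebra (dual V) (dual_product V \<Delta>)"
proof -
  let ?n = "dual_product V \<Delta>"
  have V: "vspace V" and \<Delta>: "linear_map V (tensor V V) \<Delta>"
    and ax1: "\<And>a. a \<in> points V \<Longrightarrow> id_cop V \<Delta> (\<Delta> a) - flip_id V (id_cop V \<Delta> (\<Delta> a))
            = cop_id V \<Delta> (\<Delta> a) - flip_id V (cop_id V \<Delta> (\<Delta> a))"
    and ax2: "\<And>a. a \<in> points V \<Longrightarrow> flip_id V (id_cop V \<Delta> (tflip V V (\<Delta> a))) = cop_id V \<Delta> (\<Delta> a)"
    using assms by (auto simp: novikov_coalgebra_def)
  note bil = dual_product_bilinear[OF V \<Delta>]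
  have n: "?n f g \<in> points (dual V)" if "f \<in> points (dual V)" "g \<in> points (dual V)" for f g
    by (rule bilinear_in[OF bil that])
  note V' = vspace_dual[OF V]
  have nov: "?n (?n f g) h - ?n f (?n g h) = ?n (?n g f) h - ?n g (?n f h) \<and> ?n (?n f g) h = ?n (?n f h) g"
    if fgh: "f \<in> points (dual V)" "g \<in> points (dual V)" "h \<in> points (dual V)" for f g h
  proof -
    have eval: "?n (?n f g) h a - ?n f (?n g h) a = ?n (?n g f) h a - ?n g (?n f h) a
        \<and> ?n (?n f g) h a = ?n (?n f h) g a" if a: "a \<in> points V" for a
    proof -
      have mem: "\<Delta> a \<in> points (tensor V V)" "tflip V V (\<Delta> a) \<in> points (tensor V V)"
        using linear_map_in[OF \<Delta> a] linear_map_in[OF tflip_linear[OF V V]] by auto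
      note ev = dual_product_eval[OF V \<Delta>] id_cop_eval[OF V \<Delta>] cop_id_eval[OF V \<Delta>]
        flip_id_eval[OF V] tflip_eval[OF V V] linear_map_in[OF id_cop_linear[OF V \<Delta>]]
        linear_map_in[OF cop_id_linear[OF V \<Delta>]]
      show ?thesis
        using fun_cong[OF ax1[OF a], of "(prod_functional V V f g, h)"]
          fun_cong[OF ax2[OF a], of "(prod_functional V V f g, h)"]
        by (simp add: ev fgh n a mem algebra_simps)
    qed
    show ?thesis
    proof (intro conjI; rule dual_eqI[of _ V])
      fix a assume a: "a \<in> points V"
      show "(?n (?n f g) h - ?n f (?n g h)) a = (?n (?n g f) h - ?n g (?n f h)) a"
        using conjunct1[OF eval[OF a]] by simp
      show "?n (?n f g) h a = ?n (?n f h) g a" by (rule conjunct2[OF eval[OF a]])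
    qed (intro vspace_diff[OF V'] n fgh)+
  qed
  show ?thesis unfolding novikov_algebra_def using V' bil nov by blast
qed

context
  fixes V :: "('k::field, 'v::ab_group_add) space" and m :: "'v \<Rightarrow> 'v \<Rightarrow> 'v"
    and \<Delta> :: "'v \<Rightarrow> ('k, 'v, 'v) tensor"
  assumes fin: "fin_dim_space V" and bialg: "novikov_bialgebra V m \<Delta>"
begin

private abbreviation (input) "n \<equiv> dual_product V \<Delta>"
private abbreviation (input) "M \<equiv> novikov_double V m \<Delta>"
private abbreviation (input) "E \<equiv> dsum V (dual V)"

private lemma V: "vspace V"
  by (rule fin_dim_vspace[OF fin])

private lemmas V' = vspace_dual[OF V]

private lemma m: "bilinear_map V V V m" and \<Delta>: "linear_map V (tensor V V) \<Delta>"
  and novikov: "novikov_algebra V m" and conovikov: "novikov_coalgebra V \<Delta>"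
  using bialg by (auto simp: novikov_bialgebra_def novikov_algebra_def novikov_coalgebra_def)

private lemma n: "bilinear_map (dual V) (dual V) (dual V) n"
  by (rule dual_product_bilinear[OF V \<Delta>])

private lemmas m_in = bilinear_in[OF m] and n_in = bilinear_in[OF n]

private lemma n_add: "f \<in> points (dual V) \<Longrightarrow> g \<in> points (dual V) \<Longrightarrow> h \<in> points (dual V)
    \<Longrightarrow> n (f + g) h = n f h + n g h"
  "f \<in> points (dual V) \<Longrightarrow> g \<in> points (dual V) \<Longrightarrow> h \<in> points (dual V)
    \<Longrightarrow> n h (f + g) = n h f + n h g"
  "f \<in> points (dual V) \<Longrightarrow> h \<in> points (dual V) \<Longrightarrow> n (pointwise_smult c f) h = pointwise_smult c (n f h)"
  "f \<in> points (dual V) \<Longrightarrow> h \<in> points (dual V) \<Longrightarrow> n h (pointwise_smult c f) = pointwise_smult c (n h f)"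
  using linear_map_add[OF bilinear_left[OF n]] linear_map_add[OF bilinear_right[OF n]]
    linear_map_smult[OF bilinear_left[OF n]] linear_map_smult[OF bilinear_right[OF n]] by auto

private lemma m_add: "a \<in> points V \<Longrightarrow> b \<in> points V \<Longrightarrow> c \<in> points V \<Longrightarrow> m (a + b) c = m a c + m b c"
  "a \<in> points V \<Longrightarrow> b \<in> points V \<Longrightarrow> c \<in> points V \<Longrightarrow> m c (a + b) = m c a + m c b"
  "a \<in> points V \<Longrightarrow> c \<in> points V \<Longrightarrow> m (smult V k a) c = smult V k (m a c)"
  "a \<in> points V \<Longrightarrow> c \<in> points V \<Longrightarrow> m c (smult V k a) = smult V k (m c a)"
  using linear_map_add[OF bilinear_left[OF m]] linear_map_add[OF bilinear_right[OF m]]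
    linear_map_smult[OF bilinear_left[OF m]] linear_map_smult[OF bilinear_right[OF m]] by auto

private lemma neg_transpose_dual:
  "linear_map V V F \<Longrightarrow> f \<in> points (dual V) \<Longrightarrow> neg_transpose V F f \<in> points (dual V)"
  unfolding neg_transpose_eq by (intro vspace_neg V' pullback_dual V)

private lemma neg_transpose_apply: "v \<in> points V \<Longrightarrow> neg_transpose V F f v = - f (F v)"
  by (simp add: neg_transpose_def)

private lemma bidual_transpose:
  assumes "f \<in> points (dual V)" "a \<in> points V"
  shows "neg_transpose_bidual V (Rmul n f) a \<in> points V"
    and "neg_transpose_bidual V (Lstar n f) a \<in> points V"
    and "h \<in> points (dual V) \<Longrightarrow> h (neg_transpose_bidual V (Rmul n f) a) = - n h f a"
    and "h \<in> points (dual V) \<Longrightarrow> h (neg_transpose_bidual V (Lstar n f) a) = - (n f h a + n h f a)"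
  using neg_transpose_bidual_spec[OF fin Rmul_linear[OF n assms(1)] assms(2)]
    neg_transpose_bidual_spec[OF fin Lstar_linear[OF n V' assms(1)] assms(2)]
  by (auto simp: Rmul_def Lstar_def)

lemma novikov_double_in: "x \<in> points E \<Longrightarrow> y \<in> points E \<Longrightarrow> M x y \<in> points E"
  by (auto simp: novikov_double_def Let_def
      intro!: vspace_add[OF V] vspace_diff[OF V] vspace_add[OF V'] vspace_diff[OF V'] m_in n_in
        bidual_transpose neg_transpose_dual Lstar_linear[OF m V] Rmul_linear[OF m])

text \<open>The trilinear form \<open>\<langle>xy, z\<rangle>\<close> on the double; all mixed products are visible in it as products
  of \<open>V\<close> or of its dual.\<close>

lemma novikov_double_form:
  assumes "a \<in> points V" "b \<in> points V" "c \<in> points V"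
    "f \<in> points (dual V)" "g \<in> points (dual V)" "h \<in> points (dual V)"
  shows "std_form (M (a, f) (b, g)) (c, h) = h (m a b) + n h g a - (n f h b + n h f b)
    + n f g c - (g (m a c) + g (m c a)) + f (m c b)"
  using assms
  by (simp add: std_form_def novikov_double_def Let_def dual_add dual_diff V m_in n_in bidual_transpose
      neg_transpose_apply vspace_diff[OF V] Lstar_def Rmul_def)

text \<open>The vector components of mixed products are only known through their pairings with covectors, so
  additivity and homogeneity are also checked by pairing.\<close>

lemma novikov_double_bilinear: "bilinear_map E E E M"
proof (intro bilinear_mapI linear_mapI novikov_double_in)
  note EE = vspace_dsum[OF V V']
  note expand = novikov_double_form n_add m_add dual_add[of _ V] dual_smult[of _ V] V m_in n_in vspace_add[OF V]
    vspace_add[OF V'] vspace_smult[OF V] vspace_smult[OF V', simplified] algebra_simps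
  note form = linear_map_add[OF std_form_linear[OF V]] linear_map_smult[OF std_form_linear[OF V]]
  show "M x (y + z) = M x y + M x z" if "x \<in> points E" "y \<in> points E" "z \<in> points E" for x y z
  proof (rule std_form_eqI[OF V])
    show "std_form (M x (y + z)) (c, h) = std_form (M x y + M x z) (c, h)"
      if "c \<in> points V" "h \<in> points (dual V)" for c h
      using \<open>x \<in> points E\<close> \<open>y \<in> points E\<close> \<open>z \<in> points E\<close> that
      by (cases x; cases y; cases z) (simp add: form novikov_double_in[simplified] expand)
  qed (use that in \<open>auto intro!: novikov_double_in vspace_add[OF EE] simp del: points_dsum\<close>)
  show "M (x + y) z = M x z + M y z" if "z \<in> points E" "x \<in> points E" "y \<in> points E" for x y z
  proof (rule std_form_eqI[OF V])
    show "std_form (M (x + y) z) (c, h) = std_form (M x z + M y z) (c, h)"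
      if "c \<in> points V" "h \<in> points (dual V)" for c h
      using \<open>x \<in> points E\<close> \<open>y \<in> points E\<close> \<open>z \<in> points E\<close> that
      by (cases x; cases y; cases z) (simp add: form novikov_double_in[simplified] expand)
  qed (use that in \<open>auto intro!: novikov_double_in vspace_add[OF EE] simp del: points_dsum\<close>)
  show "M x (smult E k y) = smult E k (M x y)" if "x \<in> points E" "y \<in> points E" for x y k
  proof (rule std_form_eqI[OF V])
    show "std_form (M x (smult E k y)) (c, h) = std_form (smult E k (M x y)) (c, h)"
      if "c \<in> points V" "h \<in> points (dual V)" for c h
      using \<open>x \<in> points E\<close> \<open>y \<in> points E\<close> that
      by (cases x; cases y) (simp add: form novikov_double_in[simplified] expand)
  qed (use that in \<open>auto intro!: novikov_double_in vspace_smult[OF EE] simp del: points_dsum\<close>)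
  show "M (smult E k x) y = smult E k (M x y)" if "y \<in> points E" "x \<in> points E" for x y k
  proof (rule std_form_eqI[OF V])
    show "std_form (M (smult E k x) y) (c, h) = std_form (smult E k (M x y)) (c, h)"
      if "c \<in> points V" "h \<in> points (dual V)" for c h
      using \<open>x \<in> points E\<close> \<open>y \<in> points E\<close> that
      by (cases x; cases y) (simp add: form novikov_double_in[simplified] expand)
  qed (use that in \<open>auto intro!: novikov_double_in vspace_smult[OF EE] simp del: points_dsum\<close>)
qed

private lemmas E_space = vspace_dsum[OF V V']

private lemma n_0: "f \<in> points (dual V) \<Longrightarrow> n f 0 = 0" "f \<in> points (dual V) \<Longrightarrow> n 0 f = 0"
  using linear_map_0[OF bilinear_left[OF n] V'] linear_map_0[OF bilinear_right[OF n] V'] by auto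

private lemma m_0: "a \<in> points V \<Longrightarrow> m a 0 = 0" "a \<in> points V \<Longrightarrow> m 0 a = 0"
  using linear_map_0[OF bilinear_left[OF m] V] linear_map_0[OF bilinear_right[OF m] V] by auto

private lemma n_neg: "f \<in> points (dual V) \<Longrightarrow> g \<in> points (dual V) \<Longrightarrow> n (- f) g = - n f g"
  using linear_map_neg[OF bilinear_left[OF n] V'] by blast

private lemmas zeros = n_0 m_0 dual_0[of _ V] V V' vspace_0[OF V] vspace_0[OF V']

lemma novikov_double_vectors:
  assumes "a \<in> points V" "b \<in> points V"
  shows "M (a, 0) (b, 0) = (m a b, 0)"
  using assms novikov_double_form[of a b _ 0 0]
  by (intro std_form_eqI[OF V novikov_double_in])
    (auto simp: zeros m_in, simp add: std_form_def zeros m_in)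

lemma novikov_double_covectors:
  assumes "f \<in> points (dual V)" "g \<in> points (dual V)"
  shows "M (0, f) (0, g) = (0, n f g)"
  using assms novikov_double_form[of 0 0 _ f g]
  by (intro std_form_eqI[OF V novikov_double_in])
    (auto simp: zeros n_in, simp add: std_form_def zeros n_in)

private lemma mixed_in:
  assumes "a \<in> points V" "f \<in> points (dual V)"
  shows "fst (M (a, 0) (0, f)) \<in> points V" "snd (M (a, 0) (0, f)) \<in> points (dual V)"
    "fst (M (0, f) (a, 0)) \<in> points V" "snd (M (0, f) (a, 0)) \<in> points (dual V)"
  using novikov_double_in[of "(a, 0)" "(0, f)"] novikov_double_in[of "(0, f)" "(a, 0)"] assms
  by (auto simp: zeros)

private lemma mixed:
  assumes a: "a \<in> points V" and f: "f \<in> points (dual V)"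
  shows "h \<in> points (dual V) \<Longrightarrow> h (fst (M (a, 0) (0, f))) = n h f a"
    and "h \<in> points (dual V) \<Longrightarrow> h (fst (M (0, f) (a, 0))) = - (n f h a + n h f a)"
    and "snd (M (a, 0) (0, f)) = - pullback V (Lstar m a) f"
    and "snd (M (0, f) (a, 0)) = pullback V (Rmul m a) f"
proof -
  note form = novikov_double_form[of a 0 _ 0 f] novikov_double_form[of 0 a _ f 0]
  note in' = mixed_in[OF a f]
  show "h (fst (M (a, 0) (0, f))) = n h f a" "h (fst (M (0, f) (a, 0))) = - (n f h a + n h f a)"
    if "h \<in> points (dual V)"
    using form[of 0 h] a f that in' by (simp_all add: std_form_def zeros n_in)
  show "snd (M (a, 0) (0, f)) = - pullback V (Lstar m a) f"
  proof (rule dual_eqI[OF in'(2)])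
    show "- pullback V (Lstar m a) f \<in> points (dual V)"
      by (rule vspace_neg[OF V' pullback_dual[OF V Lstar_linear[OF m V a] f]])
    show "snd (M (a, 0) (0, f)) c = (- pullback V (Lstar m a) f) c" if "c \<in> points V" for c
      using form(1)[of c 0] a f that in' by (simp add: std_form_def zeros Lstar_def dual_add m_in)
  qed
  show "snd (M (0, f) (a, 0)) = pullback V (Rmul m a) f"
  proof (rule dual_eqI[OF in'(4) pullback_dual[OF V Rmul_linear[OF m a] f]])
    show "snd (M (0, f) (a, 0)) c = pullback V (Rmul m a) f c" if "c \<in> points V" for c
      using form(2)[of c 0] a f that in' by (simp add: std_form_def zeros Rmul_def)
  qed
qed

text \<open>The three compatibility axioms of a Novikov bialgebra, paired with two functionals.\<close>

private lemma compatibility: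
  assumes a: "a \<in> points V" and b: "b \<in> points V"
    and f: "f \<in> points (dual V)" and g: "g \<in> points (dual V)"
  defines "L \<equiv> \<lambda>a. pullback V (Lstar m a)" and "R \<equiv> \<lambda>a. pullback V (Rmul m a)"
  shows "n f g (m a b) = n (R b f) g a + n f (L a g) b + n (L a g) f b"
    and "n (L a f) g b - n (L a g) f b = n (L b f) g a - n (L b g) f a"
    and "n f (R a g) b + n (R a g) f b - n (R a f) g b - n g (R a f) b
      = n f (R b g) a + n (R b g) f a - n (R b f) g a - n g (R b f) a"
proof -
  have L: "L a h \<in> points (dual V)" and R: "R a h \<in> points (dual V)"
    if "a \<in> points V" "h \<in> points (dual V)" for a h
    unfolding L_def R_def
    by (rule pullback_dual[OF V Lstar_linear[OF m V that(1)] that(2)],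
        rule pullback_dual[OF V Rmul_linear[OF m that(1)] that(2)])
  have tl: "tleft V F t (h, k) = t (pullback V F h, k)" and tr: "tright V F t (h, k) = t (h, pullback V F k)"
    if "linear_map V V F" "t \<in> points (tensor V V)" "h \<in> points (dual V)" "k \<in> points (dual V)" for F t h k
    unfolding tleft_def tright_def
    using tmap_eval[OF V V V V that(1) linear_map_id that(3,4,2)]
      tmap_eval[OF V V V V linear_map_id that(1,3,4,2)] that by (simp_all add: pullback_id)
  have \<Delta>_in: "\<Delta> c \<in> points (tensor V V)" "tflip V V (\<Delta> c) \<in> points (tensor V V)" if "c \<in> points V" for c
    using linear_map_in[OF \<Delta> that] linear_map_in[OF tflip_linear[OF V V]] by auto
  note ev = tl tr Lstar_linear[OF m V] Rmul_linear[OF m] L[unfolded L_def] R[unfolded R_def] \<Delta>_in vspace_add[OF vspace_tensor[OF V V]] tflip_eval[OF V V]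
    dual_product_eval[OF V \<Delta>] m_in
  have ax: "\<Delta> (m a b) = tleft V (Rmul m b) (\<Delta> a) + tright V (Lstar m a) (\<Delta> b + tflip V V (\<Delta> b))"
    "tleft V (Lstar m a) (\<Delta> b) - tright V (Lstar m a) (tflip V V (\<Delta> b))
      = tleft V (Lstar m b) (\<Delta> a) - tright V (Lstar m b) (tflip V V (\<Delta> a))"
    "tright V (Rmul m a) (\<Delta> b + tflip V V (\<Delta> b)) - tleft V (Rmul m a) (\<Delta> b + tflip V V (\<Delta> b))
      = tright V (Rmul m b) (\<Delta> a + tflip V V (\<Delta> a)) - tleft V (Rmul m b) (\<Delta> a + tflip V V (\<Delta> a))"
    using bialg a b unfolding novikov_bialgebra_def by blast+
  show "n f g (m a b) = n (R b f) g a + n f (L a g) b + n (L a g) f b"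
    using fun_cong[OF ax(1), of "(f, g)"] a b f g unfolding L_def R_def by (simp add: ev)
  show "n (L a f) g b - n (L a g) f b = n (L b f) g a - n (L b g) f a"
    using fun_cong[OF ax(2), of "(f, g)"] a b f g unfolding L_def R_def by (simp add: ev)
  show "n f (R a g) b + n (R a g) f b - n (R a f) g b - n g (R a f) b
      = n f (R b g) a + n (R b g) f a - n (R b f) g a - n g (R b f) a"
    using fun_cong[OF ax(3), of "(f, g)"] a b f g unfolding L_def R_def
    by (simp add: ev algebra_simps)
qed

lemma novikov_double_invariant:
  assumes "x \<in> points E" "y \<in> points E" "z \<in> points E"
  shows "std_form (M x y) z = - std_form y (M x z + M z x)"
proof -
  have "std_form (M x z + M z x) y = std_form (M x z) y + std_form (M z x) y"
    by (rule linear_map_add[OF std_form_linear[OF V assms(2)] novikov_double_in novikov_double_in]) fact+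
  moreover have "std_form (M x y) z = - (std_form (M x z) y + std_form (M z x) y)"
    using assms by (cases x; cases y; cases z) (simp add: novikov_double_form algebra_simps)
  ultimately show ?thesis by (simp add: std_form_sym)
qed

text \<open>The explicit formula for \<open>\<langle>xy, z\<rangle>\<close> is symmetric in \<open>x\<close> and \<open>z\<close>.\<close>

private lemma right_selfadjoint:
  assumes "x \<in> points E" "y \<in> points E" "z \<in> points E"
  shows "std_form (M x y) z = std_form x (M z y)"
proof -
  have "std_form (M x y) z = std_form (M z y) x"
    using assms by (cases x; cases y; cases z) (simp add: novikov_double_form algebra_simps)
  then show ?thesis by (simp add: std_form_sym)
qed

private definition "S x y z w = std_form (M x y) (M z w)"

private lemma S_linear:
  assumes "x \<in> points E" "y \<in> points E" "z \<in> points E"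
  shows "linear_map E scalars (\<lambda>w. S w x y z)" "linear_map E scalars (\<lambda>w. S x w y z)"
    "linear_map E scalars (\<lambda>w. S x y w z)" "linear_map E scalars (\<lambda>w. S x y z w)"
proof -
  note [simp del] = points_dsum
  note b = std_form_bilinear[OF V] and B = novikov_double_bilinear
  show "linear_map E scalars (\<lambda>w. S w x y z)" "linear_map E scalars (\<lambda>w. S x w y z)"
    "linear_map E scalars (\<lambda>w. S x y w z)" "linear_map E scalars (\<lambda>w. S x y z w)"
    unfolding S_def
    using assms linear_map_comp[OF bilinear_left[OF B] bilinear_left[OF b]]
      linear_map_comp[OF bilinear_left[OF B] bilinear_right[OF b]]
      linear_map_comp[OF bilinear_right[OF B] bilinear_left[OF b]]
      linear_map_comp[OF bilinear_right[OF B] bilinear_right[OF b]]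
    by (simp_all add: novikov_double_in)
qed

text \<open>The law \<open>\<langle>xy, zw\<rangle> = \<langle>xw, zy\<rangle>\<close>. On vectors and covectors it is trivial, or one of
  the Novikov identities of \<open>V\<close> and its dual, or one of the three compatibility axioms, according to
  the number of covectors among \<open>x, z\<close> and among \<open>y, w\<close>.\<close>

private definition "exchange x y z w \<longleftrightarrow> S x y z w = S x w z y"

private lemma exchange_sym:
  "exchange x y z w \<Longrightarrow> exchange x w z y" "exchange x y z w \<Longrightarrow> exchange z y x w"
  by (simp_all add: exchange_def S_def std_form_sym)

private lemma novikovD:
  assumes "a \<in> points V" "b \<in> points V" "c \<in> points V"
  shows "m (m a b) c = m (m a c) b" "m (m a b) c - m a (m b c) = m (m b a) c - m b (m a c)"
  using novikov assms by (auto simp: novikov_algebra_def)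

private lemma dual_novikovD:
  assumes "f \<in> points (dual V)" "g \<in> points (dual V)" "h \<in> points (dual V)"
  shows "n (n f g) h = n (n f h) g" "n (n f g) h - n f (n g h) = n (n g f) h - n g (n f h)"
  using dual_novikov_algebra[OF conovikov] assms by (auto simp: novikov_algebra_def)

private lemma exchange_pure:
  assumes abcd: "a \<in> points V" "b \<in> points V" "c \<in> points V" "d \<in> points V"
    and fghk: "f \<in> points (dual V)" "g \<in> points (dual V)" "h \<in> points (dual V)" "k \<in> points (dual V)"
  shows "exchange (a, 0) (b, 0) (c, 0) (d, 0)" and "exchange (0, f) (0, g) (0, h) (0, k)"
    and "exchange (a, 0) (b, 0) (c, 0) (0, g)" and "exchange (0, f) (0, g) (0, h) (d, 0)"
    and "exchange (a, 0) (b, 0) (0, f) (d, 0)" and "exchange (a, 0) (0, g) (0, h) (0, k)"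
    and "exchange (a, 0) (0, g) (c, 0) (0, k)" and "exchange (0, f) (b, 0) (0, h) (d, 0)"
    and "exchange (0, f) (b, 0) (c, 0) (0, g)"
proof -
  note [simp] = abcd fghk m_in n_in mixed mixed_in novikov_double_vectors novikov_double_covectors
    zeros n_neg pullback_dual[OF V Lstar_linear[OF m V]] pullback_dual[OF V Rmul_linear[OF m]]
  note unf = exchange_def S_def std_form_def
  show "exchange (a, 0) (b, 0) (c, 0) (d, 0)" "exchange (0, f) (0, g) (0, h) (0, k)"
    unfolding unf by simp_all
  show "exchange (a, 0) (b, 0) (c, 0) (0, g)"
  proof -
    have "m c (m a b) + m (m a b) c = m a (m c b) + m (m c b) a"
      using novikovD(1)[of a b c] novikovD(1)[of c b a] novikovD(2)[of a c b]
      by (simp add: algebra_simps)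
    then show ?thesis unfolding unf by (simp add: Lstar_def)
  qed
  show "exchange (0, f) (0, g) (0, h) (d, 0)"
  proof -
    have "n h (n f g) + n (n f g) h = n f (n h g) + n (n h g) f"
      using dual_novikovD(1)[of f g h] dual_novikovD(1)[of h g f] dual_novikovD(2)[of f h g]
      by (simp add: algebra_simps)
    from fun_cong[OF this, of d] show ?thesis unfolding unf by simp
  qed
  show "exchange (a, 0) (b, 0) (0, f) (d, 0)"
    unfolding unf using novikovD(1)[of a b d] by (simp add: Rmul_def)
  show "exchange (a, 0) (0, g) (0, h) (0, k)"
    unfolding unf using dual_novikovD(1)[of h k g] by simp
  show "exchange (a, 0) (0, g) (c, 0) (0, k)"
    unfolding unf using compatibility(2)[of a c g k] by (simp add: algebra_simps)
  show "exchange (0, f) (b, 0) (0, h) (d, 0)"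
    unfolding unf using compatibility(3)[of b d f h] by (simp add: algebra_simps)
  show "exchange (0, f) (b, 0) (c, 0) (0, g)"
    unfolding unf using compatibility(1)[of c b f g] by (simp add: algebra_simps)
qed

private lemma exchange_all:
  assumes "x \<in> points E" "y \<in> points E" "z \<in> points E" "w \<in> points E"
  shows "S x y z w = S x w z y"
proof -
  define P where "P = (\<lambda>a. (a, 0)) ` points V \<union> (\<lambda>f. (0, f)) ` points (dual V)"
  have sub: "x \<in> P \<Longrightarrow> x \<in> points E" for x by (auto simp: P_def zeros)
  have PI: "\<And>a. a \<in> points V \<Longrightarrow> (a, 0) \<in> P" "\<And>f. f \<in> points (dual V) \<Longrightarrow> (0, f) \<in> P"
    by (auto simp: P_def)
  note [simp del] = points_dsum
  note ext = linear_eq_on_dsum[OF V V']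
  note Y = vspace_0[OF V] and Z = vspace_0[OF V']
  note e = exchange_pure(1)[OF _ _ _ _ Z Z Z Z] exchange_pure(2)[OF Y Y Y Y]
    exchange_pure(3)[OF _ _ _ Y Z _ Z Z] exchange_pure(4)[OF Y Y Y _ _ _ _ Z]
    exchange_pure(5)[OF _ _ Y _ _ Z Z Z] exchange_pure(6)[OF _ Y Y Y Z]
    exchange_pure(7)[OF _ Y _ Y Z _ Z _] exchange_pure(8)[OF Y _ Y _ _ Z _ Z]
    exchange_pure(9)[OF Y _ _ Y _ _ Z Z]
  \<comment> \<open>The exchange law is closed under two symmetries, which reduce the sixteen patterns to nine.\<close>
  have 0: "S x y z w = S x w z y" if "x \<in> P" "y \<in> P" "z \<in> P" "w \<in> P" for x y z w
    using that unfolding P_def exchange_def[symmetric]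
    by (auto simp: e e[THEN exchange_sym(1)] e[THEN exchange_sym(2)]
        e[THEN exchange_sym(1), THEN exchange_sym(2)])
  \<comment> \<open>Multilinear extension, one argument at a time.\<close>
  have 1: "S x y z w = S x w z y" if p: "x \<in> points E" "y \<in> P" "z \<in> P" "w \<in> P" for x y z w
  proof (rule ext[of scalars "\<lambda>u. S u y z w" "\<lambda>u. S u w z y"])
    show "linear_map E scalars (\<lambda>u. S u y z w)" "linear_map E scalars (\<lambda>u. S u w z y)"
      by (rule S_linear; fact p sub[OF p(2)] sub[OF p(3)] sub[OF p(4)])+
    show "S (a, 0) y z w = S (a, 0) w z y" if "a \<in> points V" for a
      by (rule 0; fact p PI(1)[OF that])
    show "S (0, f) y z w = S (0, f) w z y" if "f \<in> points (dual V)" for f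
      by (rule 0; fact p PI(2)[OF that])
  qed (fact p)
  have 2: "S x y z w = S x w z y" if p: "x \<in> points E" "y \<in> points E" "z \<in> P" "w \<in> P" for x y z w
  proof (rule ext[of scalars "\<lambda>u. S x u z w" "\<lambda>u. S x w z u"])
    show "linear_map E scalars (\<lambda>u. S x u z w)" "linear_map E scalars (\<lambda>u. S x w z u)"
      by (rule S_linear; fact p sub[OF p(3)] sub[OF p(4)])+
    show "S x (a, 0) z w = S x w z (a, 0)" if "a \<in> points V" for a
      by (rule 1; fact p PI(1)[OF that])
    show "S x (0, f) z w = S x w z (0, f)" if "f \<in> points (dual V)" for f
      by (rule 1; fact p PI(2)[OF that])
  qed (fact p)
  have 3: "S x y z w = S x w z y" if p: "x \<in> points E" "y \<in> points E" "z \<in> points E" "w \<in> P" for x y z w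
  proof (rule ext[of scalars "\<lambda>u. S x y u w" "\<lambda>u. S x w u y"])
    show "linear_map E scalars (\<lambda>u. S x y u w)" "linear_map E scalars (\<lambda>u. S x w u y)"
      by (rule S_linear; fact p sub[OF p(4)])+
    show "S x y (a, 0) w = S x w (a, 0) y" if "a \<in> points V" for a
      by (rule 2; fact p PI(1)[OF that])
    show "S x y (0, f) w = S x w (0, f) y" if "f \<in> points (dual V)" for f
      by (rule 2; fact p PI(2)[OF that])
  qed (fact p)
  show ?thesis
  proof (rule ext[of scalars "\<lambda>u. S x y z u" "\<lambda>u. S x u z y"])
    show "linear_map E scalars (\<lambda>u. S x y z u)" "linear_map E scalars (\<lambda>u. S x u z y)"
      by (rule S_linear; fact assms )+
    show "S x y z (a, 0) = S x (a, 0) z y" if "a \<in> points V" for a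
      by (rule 3; fact assms PI(1)[OF that])
    show "S x y z (0, f) = S x (0, f) z y" if "f \<in> points (dual V)" for f
      by (rule 3; fact assms PI(2)[OF that])
  qed (fact assms)
qed

text \<open>By invariance and nondegeneracy the exchange law is the commutation of right multiplications,
  and it also makes the terms of the other Novikov identity cancel in pairs.\<close>

lemma novikov_double_novikov: "novikov_algebra E M"
proof -
  note [simp del] = points_dsum
  note in' [simp] = novikov_double_in
  note lin = std_form_linear[OF V]
  have pairI: "u = v" if "u \<in> points E" "v \<in> points E" "\<And>w. w \<in> points E \<Longrightarrow> std_form u w = std_form v w" for u v
    by (rule std_form_eqI[OF V that(1,2)]) (simp add: that points_dsum)
  have "M (M x y) z - M x (M y z) = M (M y x) z - M y (M x z) \<and> M (M x y) z = M (M x z) y"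
    if xyz [simp]: "x \<in> points E" "y \<in> points E" "z \<in> points E" for x y z
  proof
    show "M (M x y) z = M (M x z) y"
    proof (rule pairI)
      fix w assume [simp]: "w \<in> points E"
      show "std_form (M (M x y) z) w = std_form (M (M x z) y) w"
        using exchange_all[of x y w z] right_selfadjoint[of "M x y" z w] right_selfadjoint[of "M x z" y w]
        by (simp add: S_def)
    qed simp_all
    show "M (M x y) z - M x (M y z) = M (M y x) z - M y (M x z)"
    proof (rule pairI)
      fix w assume w [simp]: "w \<in> points E"
      have left: "std_form (M u (M v z)) w = - S v z u w - S v z w u"
        if [simp]: "u \<in> points E" "v \<in> points E" for u v
        using novikov_double_invariant[of u "M v z" w]
          linear_map_add[OF bilinear_right[OF std_form_bilinear[OF V]], of "M v z" "M u w" "M w u"]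
        by (simp add: S_def)
      have right: "std_form (M (M u v) z) w = S u v w z" if "u \<in> points E" "v \<in> points E" for u v
        using that right_selfadjoint[of "M u v" z w] by (simp add: S_def)
      have S_flip: "S u v p q = S p q u v" for u v p q by (simp add: S_def std_form_sym)
      have "S x y w z + S y z x w + S y z w x = S y x w z + S x z y w + S x z w y"
        using exchange_all[of x y w z] exchange_all[of y x w z] exchange_all[of y z x w]
          S_flip[of x z y w] by simp
      then show "std_form (M (M x y) z - M x (M y z)) w = std_form (M (M y x) z - M y (M x z)) w"
        by (simp add: linear_map_diff[OF lin[OF w] E_space] left right algebra_simps)
    qed (simp_all add: vspace_diff[OF E_space])
  qed
  then show ?thesis unfolding novikov_algebra_def using E_space novikov_double_bilinear by blast
qed

lemma novikov_bialgebra_manin_triple: "novikov_manin_triple V m n M"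
  unfolding novikov_manin_triple_def
  by (intro conjI ballI novikov dual_novikov_algebra conovikov novikov_double_novikov
      novikov_double_vectors novikov_double_covectors novikov_double_invariant)

end


section \<open>Lie bialgebras from Manin triples of Lie algebras\<close>

lemma lie_algebra_antisym:
  assumes "lie_algebra V br" and x: "x \<in> points V" and y: "y \<in> points V"
  shows "br x y = - br y x"
proof -
  have V: "vspace V" and b: "bilinear_map V V V br" and alt: "\<And>x. x \<in> points V \<Longrightarrow> br x x = 0"
    using assms(1) by (auto simp: lie_algebra_def)
  have "br x y + br y x = br (x + y) (x + y)"
    using x y V
    by (simp add: linear_map_add[OF bilinear_left[OF b]] linear_map_add[OF bilinear_right[OF b]]
        vspace_add alt[OF x] alt[OF y])
  also have "\<dots> = 0" by (rule alt[OF vspace_add[OF V x y]])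
  finally show ?thesis by (simp add: eq_neg_iff_add_eq_0)
qed

text \<open>Used for brackets transported along an isomorphism as well as for subalgebras.\<close>

lemma lie_algebra_embedding:
  assumes V: "vspace V" and W: "lie_algebra W D" and \<iota>: "linear_map V W \<iota>" "inj_on \<iota> (points V)"
    and closed: "\<And>x y. x \<in> points V \<Longrightarrow> y \<in> points V \<Longrightarrow> br x y \<in> points V"
    and hom: "\<And>x y. x \<in> points V \<Longrightarrow> y \<in> points V \<Longrightarrow> \<iota> (br x y) = D (\<iota> x) (\<iota> y)"
  shows "lie_algebra V br"
proof -
  have vW: "vspace W" and b: "bilinear_map W W W D"
    and alt: "\<And>x. x \<in> points W \<Longrightarrow> D x x = 0"
    and jac: "\<And>x y z. x \<in> points W \<Longrightarrow> y \<in> points W \<Longrightarrow> z \<in> points W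
      \<Longrightarrow> D x (D y z) + D y (D z x) + D z (D x y) = 0"
    using W by (auto simp: lie_algebra_def)
  note add = linear_map_add[OF \<iota>(1)] and scale = linear_map_smult[OF \<iota>(1)]
    and in' = linear_map_in[OF \<iota>(1)]
  have eqI: "x = y" if "\<iota> x = \<iota> y" "x \<in> points V" "y \<in> points V" for x y
    using inj_onD[OF \<iota>(2) that] .
  note D = linear_map_add[OF bilinear_left[OF b]] linear_map_add[OF bilinear_right[OF b]]
    linear_map_smult[OF bilinear_left[OF b]] linear_map_smult[OF bilinear_right[OF b]]
  note simps = hom add scale in' D closed vspace_add[OF V] vspace_smult[OF V] vspace_0[OF V]
    linear_map_0[OF \<iota>(1) V]
  have "bilinear_map V V V br"
    by (intro bilinear_mapI linear_mapI closed; (assumption | rule eqI)+) (simp_all add: simps)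
  moreover have "br x x = 0" if "x \<in> points V" for x
    using that by (intro eqI) (simp_all add: simps alt)
  moreover have "br x (br y z) + br y (br z x) + br z (br x y) = 0"
    if "x \<in> points V" "y \<in> points V" "z \<in> points V" for x y z
    using that by (intro eqI) (simp_all add: simps jac)
  ultimately show ?thesis unfolding lie_algebra_def using V by blast
qed

context
  fixes L :: "('k::field, 'v::ab_group_add) space" and br :: "'v \<Rightarrow> 'v \<Rightarrow> 'v"
    and br' :: "('v \<Rightarrow> 'k) \<Rightarrow> ('v \<Rightarrow> 'k) \<Rightarrow> 'v \<Rightarrow> 'k"
    and D :: "'v \<times> ('v \<Rightarrow> 'k) \<Rightarrow> 'v \<times> ('v \<Rightarrow> 'k) \<Rightarrow> 'v \<times> ('v \<Rightarrow> 'k)"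
    and \<delta> :: "'v \<Rightarrow> ('k, 'v, 'v) tensor"
  assumes triple: "lie_manin_triple L br br' D"
    and \<delta>: "linear_map L (tensor L L) \<delta>"
    and dual: "\<And>x \<xi> \<eta>. x \<in> points L \<Longrightarrow> \<xi> \<in> points (dual L) \<Longrightarrow> \<eta> \<in> points (dual L)
      \<Longrightarrow> \<delta> x (\<xi>, \<eta>) = br' \<xi> \<eta> x"
begin

private abbreviation (input) "LL \<equiv> dsum L (dual L)"

private lemma lie: "lie_algebra L br" "lie_algebra (dual L) br'" "lie_algebra LL D"
  and sub: "x \<in> points L \<Longrightarrow> y \<in> points L \<Longrightarrow> D (x, 0) (y, 0) = (br x y, 0)"
  and sub': "\<xi> \<in> points (dual L) \<Longrightarrow> \<eta> \<in> points (dual L) \<Longrightarrow> D (0, \<xi>) (0, \<eta>) = (0, br' \<xi> \<eta>)"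
  and inv: "u \<in> points LL \<Longrightarrow> v \<in> points LL \<Longrightarrow> w \<in> points LL \<Longrightarrow> std_form (D u v) w = std_form u (D v w)"
  using triple unfolding lie_manin_triple_def by blast+

private lemma L_space: "vspace L" and bil: "bilinear_map L L L br"
  and L'_space: "vspace (dual L)" and bil': "bilinear_map (dual L) (dual L) (dual L) br'"
  and LL_space: "vspace LL" and bilD: "bilinear_map LL LL LL D"
  using lie by (auto simp: lie_algebra_def)

private lemmas br_in = bilinear_in[OF bil] and br'_closed = bilinear_in[OF bil']

private lemma in_E: "x \<in> points L \<Longrightarrow> (x, 0) \<in> points LL" "\<xi> \<in> points (dual L) \<Longrightarrow> (0, \<xi>) \<in> points LL"
  by (auto simp: vspace_0[OF L_space] vspace_0[OF L'_space])

private lemma D_in: "u \<in> points LL \<Longrightarrow> v \<in> points LL \<Longrightarrow> D u v \<in> points LL"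
  by (rule bilinear_in[OF bilD])

private lemma lie_mixed_in:
  assumes "x \<in> points L" "\<xi> \<in> points (dual L)"
  shows "fst (D (x, 0) (0, \<xi>)) \<in> points L" "snd (D (x, 0) (0, \<xi>)) \<in> points (dual L)"
  using D_in[OF in_E(1)[OF assms(1)] in_E(2)[OF assms(2)]] by auto

text \<open>Invariance of the form determines the bracket of a vector and a covector.\<close>

private lemma lie_mixed:
  assumes x: "x \<in> points L" and \<xi>: "\<xi> \<in> points (dual L)"
  shows "\<eta> \<in> points (dual L) \<Longrightarrow> \<eta> (fst (D (x, 0) (0, \<xi>))) = br' \<xi> \<eta> x"
    and "snd (D (x, 0) (0, \<xi>)) = - pullback L (br x) \<xi>"
proof -
  note x0 = in_E(1)[OF x] and \<xi>0 = in_E(2)[OF \<xi>]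
  show "\<eta> (fst (D (x, 0) (0, \<xi>))) = br' \<xi> \<eta> x" if \<eta>: "\<eta> \<in> points (dual L)"
    using inv[OF x0 \<xi>0 in_E(2)[OF \<eta>]] sub'[OF \<xi> \<eta>] dual_0[OF lie_mixed_in(2)[OF x \<xi>] L_space]
    by (simp add: std_form_def)
  have pb: "pullback L (br x) \<xi> \<in> points (dual L)"
    by (rule pullback_dual[OF L_space bilinear_right[OF bil x] \<xi>])
  show "snd (D (x, 0) (0, \<xi>)) = - pullback L (br x) \<xi>"
  proof (rule dual_eqI[OF lie_mixed_in(2)[OF x \<xi>] vspace_neg[OF L'_space pb]])
    fix y assume y: "y \<in> points L"
    have "snd (D (x, 0) (0, \<xi>)) y = std_form (D (x, 0) (0, \<xi>)) (y, 0)"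
      by (simp add: std_form_def)
    also have "\<dots> = std_form (- D (0, \<xi>) (x, 0)) (y, 0)"
      unfolding lie_algebra_antisym[OF lie(3) x0 \<xi>0] ..
    also have "std_form (- D (0, \<xi>) (x, 0)) (y, 0) = - std_form (0, \<xi>) (D (x, 0) (y, 0))"
      using inv[OF \<xi>0 x0 in_E(1)[OF y]] by (simp add: std_form_def)
    also have "\<dots> = (- pullback L (br x) \<xi>) y"
      using y sub[OF x y] by (simp add: std_form_def)
    finally show "snd (D (x, 0) (0, \<xi>)) y = (- pullback L (br x) \<xi>) y" .
  qed
qed

private lemma dual_product_eq:
  assumes "\<xi> \<in> points (dual L)" "\<eta> \<in> points (dual L)"
  shows "dual_product L \<delta> \<xi> \<eta> = br' \<xi> \<eta>"
  using assms
  by (intro dual_eqI[OF bilinear_in[OF dual_product_bilinear[OF L_space \<delta>]] br'_closed])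
    (simp_all add: dual_product_eval[OF L_space \<delta>] dual)

text \<open>Pairing with \<open>f \<otimes> g \<otimes> h\<close> turns the three cyclic terms into the three terms of the Jacobi identity of
  the bracket on the dual.\<close>

lemma lie_coalgebra_of_manin_triple: "lie_coalgebra L \<delta>"
proof -
  note flip = tflip_linear[OF L_space L_space] and cyc = tcyc_linear[OF L_space] and cop = id_cop_linear[OF L_space \<delta>]
  note LLL = vspace_tensor[OF vspace_tensor[OF L_space L_space] L_space]
  have anti: "\<delta> x = - tflip L L (\<delta> x)" if x: "x \<in> points L" for x
  proof (rule tensor_eqI)
    fix \<xi> \<eta> assume \<xi>: "\<xi> \<in> points (dual L)" and \<eta>: "\<eta> \<in> points (dual L)"
    show "\<delta> x (\<xi>, \<eta>) = (- tflip L L (\<delta> x)) (\<xi>, \<eta>)"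
      using fun_cong[OF lie_algebra_antisym[OF lie(2) \<xi> \<eta>], of x] x \<xi> \<eta>
      by (simp add: tflip_eval[OF L_space L_space] linear_map_in[OF \<delta>] dual)
  qed (intro vspace_neg vspace_tensor L_space linear_map_in[OF \<delta>] linear_map_in[OF flip] x)+
  have jacobi: "t + tcyc L t + tcyc L (tcyc L t) = 0" if x: "x \<in> points L" and t: "t = id_cop L \<delta> (\<delta> x)" for x t
  proof (rule tensor3_eqI[OF L_space L_space L_space])
    have mem: "t \<in> points (tensor (tensor L L) L)"
      unfolding t by (intro linear_map_in[OF cop] linear_map_in[OF \<delta>] x)
    note mem' = linear_map_in[OF cyc]
    show "t + tcyc L t + tcyc L (tcyc L t) \<in> points (tensor (tensor L L) L)"
      by (intro vspace_add[OF LLL] mem mem')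
    show "0 \<in> points (tensor (tensor L L) L)" by (rule tensor_0)
    fix f g h assume fgh: "f \<in> points (dual L)" "g \<in> points (dual L)" "h \<in> points (dual L)"
    have ev: "t (prod_functional L L f g, h) = br' f (br' g h) x"
      if "f \<in> points (dual L)" "g \<in> points (dual L)" "h \<in> points (dual L)" for f g h
      unfolding t using that x
      by (simp add: id_cop_eval[OF L_space \<delta>] linear_map_in[OF \<delta>] dual dual_product_eq br'_closed)
    have "br' f (br' g h) + br' g (br' h f) + br' h (br' f g) = 0"
      using lie(2) fgh by (auto simp: lie_algebra_def)
    from fun_cong[OF this, of x]
    show "(t + tcyc L t + tcyc L (tcyc L t)) (prod_functional L L f g, h) = 0 (prod_functional L L f g, h)"
      using fgh by (simp add: tcyc_eval[OF L_space] mem mem' ev algebra_simps)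
  qed
  show ?thesis unfolding lie_coalgebra_def Let_def using L_space \<delta> anti jacobi by blast
qed

text \<open>Both sides of the cocycle condition, paired with \<open>\<xi>\<close> and \<open>\<eta>\<close>, are values of the form on the
  double: the left one is \<open>\<langle>[x, y], [\<xi>, \<eta>]\<rangle>\<close> and the right one is
  \<open>\<langle>[x, \<xi>], [y, \<eta>]\<rangle> - \<langle>[x, \<eta>], [y, \<xi>]\<rangle>\<close>. They agree by the Jacobi identity of the double.\<close>

lemma lie_bialgebra_of_manin_triple: "lie_bialgebra L br \<delta>"
proof -
  have cocycle: "\<delta> (br x y) = (tleft L (br x) (\<delta> y) + tright L (br x) (\<delta> y))
      - (tleft L (br y) (\<delta> x) + tright L (br y) (\<delta> x))"
    if x: "x \<in> points L" and y: "y \<in> points L" for x y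
  proof (rule tensor_eqI)
    have tl: "tleft L (br z) t \<in> points (tensor L L)" and tr: "tright L (br z) t \<in> points (tensor L L)"
      if "z \<in> points L" "t \<in> points (tensor L L)" for z t
      unfolding tleft_def tright_def
      using that by (auto intro!: linear_map_in[OF tmap_linear_in] L_space linear_map_id bilinear_right[OF bil])
    note mem = linear_map_in[OF \<delta> x] linear_map_in[OF \<delta> y]
    show "\<delta> (br x y) \<in> points (tensor L L)" by (intro linear_map_in[OF \<delta>] br_in x y)
    show "(tleft L (br x) (\<delta> y) + tright L (br x) (\<delta> y)) - (tleft L (br y) (\<delta> x) + tright L (br y) (\<delta> x))
        \<in> points (tensor L L)"
      by (intro vspace_diff vspace_add vspace_tensor L_space tl tr mem x y)
    fix \<xi> \<eta> assume \<xi>: "\<xi> \<in> points (dual L)" and \<eta>: "\<eta> \<in> points (dual L)"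
    define ad :: "'v \<Rightarrow> ('v \<Rightarrow> 'k) \<Rightarrow> 'v \<Rightarrow> 'k" where "ad z = pullback L (br z)" for z
    have ad: "ad z \<zeta> \<in> points (dual L)" if "z \<in> points L" "\<zeta> \<in> points (dual L)" for z \<zeta>
      unfolding ad_def by (rule pullback_dual[OF L_space bilinear_right[OF bil that(1)] that(2)])
    have ev: "tleft L (br z) (\<delta> w) (\<xi>, \<eta>) = br' (ad z \<xi>) \<eta> w"
        "tright L (br z) (\<delta> w) (\<xi>, \<eta>) = br' \<xi> (ad z \<eta>) w"
      if z: "z \<in> points L" and w: "w \<in> points L" for z w
      unfolding tleft_def tright_def
      using tmap_eval[OF L_space L_space L_space L_space bilinear_right[OF bil z] linear_map_id \<xi> \<eta> linear_map_in[OF \<delta> w]]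
        tmap_eval[OF L_space L_space L_space L_space linear_map_id bilinear_right[OF bil z] \<xi> \<eta> linear_map_in[OF \<delta> w]]
        dual[OF w] ad[OF z] \<xi> \<eta>
      by (simp_all add: pullback_id ad_def)
    let ?d = "\<lambda>z \<zeta>. D (z, 0) (0, \<zeta>)"
    have pair: "br' (ad z \<xi>) \<eta> w = snd (?d z \<xi>) (fst (?d w \<eta>))"
        "br' \<xi> (ad z \<eta>) w = - snd (?d z \<eta>) (fst (?d w \<xi>))"
      if z: "z \<in> points L" and w: "w \<in> points L" for z w
      using lie_mixed(1)[OF w \<eta> ad[OF z \<xi>]] lie_mixed(1)[OF w \<xi> ad[OF z \<eta>]]
        fun_cong[OF lie_algebra_antisym[OF lie(2) ad[OF z \<xi>] \<eta>], of w] lie_mixed(2)[OF z \<xi>] lie_mixed(2)[OF z \<eta>]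
      by (simp_all add: ad_def)
    have d_in: "?d z \<zeta> \<in> points LL" if "z \<in> points L" "\<zeta> \<in> points (dual L)" for z \<zeta>
      by (intro D_in in_E that)
    note x0 = in_E(1)[OF x] and y0 = in_E(1)[OF y] and \<xi>0 = in_E(2)[OF \<xi>] and \<eta>0 = in_E(2)[OF \<eta>]
    have form: "linear_map LL scalars (std_form (x, 0))"
      by (rule bilinear_right[OF std_form_bilinear[OF L_space] x0])
    have jac: "D (y, 0) (D (0, \<xi>) (0, \<eta>)) = D (0, \<xi>) (?d y \<eta>) - D (0, \<eta>) (?d y \<xi>)"
    proof -
      have "D (y, 0) (D (0, \<xi>) (0, \<eta>)) + D (0, \<xi>) (D (0, \<eta>) (y, 0)) + D (0, \<eta>) (?d y \<xi>) = 0"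
        using lie(3) y0 \<xi>0 \<eta>0 unfolding lie_algebra_def by blast
      moreover have "D (0, \<xi>) (D (0, \<eta>) (y, 0)) = - D (0, \<xi>) (?d y \<eta>)"
        unfolding lie_algebra_antisym[OF lie(3) \<eta>0 y0]
        by (rule linear_map_neg[OF bilinear_right[OF bilD \<xi>0] LL_space d_in[OF y \<eta>]])
      ultimately show ?thesis by (simp add: algebra_simps eq_neg_iff_add_eq_0)
    qed
    have "br' \<xi> \<eta> (br x y) = std_form (D (x, 0) (y, 0)) (D (0, \<xi>) (0, \<eta>))"
      by (simp add: sub x y sub' \<xi> \<eta> std_form_def)
    also have "\<dots> = std_form (x, 0) (D (y, 0) (D (0, \<xi>) (0, \<eta>)))"
      by (intro inv x0 y0 D_in \<xi>0 \<eta>0)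
    also have "\<dots> = std_form (x, 0) (D (0, \<xi>) (?d y \<eta>)) - std_form (x, 0) (D (0, \<eta>) (?d y \<xi>))"
      unfolding jac by (intro linear_map_diff[OF form LL_space] D_in x0 y0 \<xi>0 \<eta>0)
    also have "\<dots> = std_form (?d x \<xi>) (?d y \<eta>) - std_form (?d x \<eta>) (?d y \<xi>)"
      by (simp only: inv x0 \<xi>0 \<eta>0 d_in y \<xi> \<eta>)
    finally have main: "br' \<xi> \<eta> (br x y) = std_form (?d x \<xi>) (?d y \<eta>) - std_form (?d x \<eta>) (?d y \<xi>)" .
    show "\<delta> (br x y) (\<xi>, \<eta>) = ((tleft L (br x) (\<delta> y) + tright L (br x) (\<delta> y))
        - (tleft L (br y) (\<delta> x) + tright L (br y) (\<delta> x))) (\<xi>, \<eta>)"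
      using x y \<xi> \<eta> main by (simp add: ev pair dual br_in std_form_def algebra_simps)
  qed
  show ?thesis unfolding lie_bialgebra_def using lie(1) lie_coalgebra_of_manin_triple cocycle by blast
qed

lemma bracket_of_manin_triple_eq:
  "x \<in> points L \<Longrightarrow> y \<in> points L \<Longrightarrow> bracket_of_manin_triple D x y = br x y"
  by (simp add: bracket_of_manin_triple_def sub)

lemma cobracket_of_manin_triple_eq:
  assumes x: "x \<in> points L"
  shows "cobracket_of_manin_triple L D x = \<delta> x"
  unfolding cobracket_of_manin_triple_def
proof (rule the_equality, intro conjI ballI)
  show "\<delta> x \<in> points (tensor L L)" by (rule linear_map_in[OF \<delta> x])
  show "tpair L L \<xi> \<eta> (\<delta> x) = snd (D (0, \<xi>) (0, \<eta>)) x"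
    if "\<xi> \<in> points (dual L)" "\<eta> \<in> points (dual L)" for \<xi> \<eta>
    using that x by (simp add: tpair_eq[OF L_space L_space] linear_map_in[OF \<delta>] dual sub')
  fix t assume t: "t \<in> points (tensor L L) \<and> (\<forall>\<xi>\<in>points (dual L). \<forall>\<eta>\<in>points (dual L).
      tpair L L \<xi> \<eta> t = snd (D (0, \<xi>) (0, \<eta>)) x)"
  show "t = \<delta> x"
  proof (rule tensor_eqI)
    show "t (\<xi>, \<eta>) = \<delta> x (\<xi>, \<eta>)" if "\<xi> \<in> points (dual L)" "\<eta> \<in> points (dual L)" for \<xi> \<eta>
      using that t x tpair_eq[OF L_space L_space that, of t] by (simp add: dual sub')
  qed (use t linear_map_in[OF \<delta> x] in auto)
qed

text \<open>Both brackets extend those of \<open>L\<close> and its dual, and invariance forces the mixed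
  brackets of \<open>D\<close> to be given by the coadjoint actions.\<close>

lemma lie_double_eq:
  assumes fin: "fin_dim_space L" and u: "u \<in> points LL" and v: "v \<in> points LL"
  shows "lie_double L br \<delta> u v = D u v"
proof -
  obtain x \<xi> y \<eta> where uv: "u = (x, \<xi>)" "v = (y, \<eta>)" and x: "x \<in> points L" and y: "y \<in> points L"
    and \<xi>: "\<xi> \<in> points (dual L)" and \<eta>: "\<eta> \<in> points (dual L)"
    using u v by auto
  note x0 = in_E(1)[OF x] and y0 = in_E(1)[OF y] and \<xi>0 = in_E(2)[OF \<xi>] and \<eta>0 = in_E(2)[OF \<eta>]
  have bidual: "neg_transpose_bidual L (dual_product L \<delta> \<zeta>) z = - fst (D (z, 0) (0, \<zeta>))"
    if z: "z \<in> points L" and \<zeta>: "\<zeta> \<in> points (dual L)" for z \<zeta>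
  proof (rule eq_if_dual_eq[OF L_space])
    note spec = neg_transpose_bidual_spec[OF fin bilinear_right[OF dual_product_bilinear[OF L_space \<delta>] \<zeta>] z]
    show "neg_transpose_bidual L (dual_product L \<delta> \<zeta>) z \<in> points L" using spec by blast
    show "- fst (D (z, 0) (0, \<zeta>)) \<in> points L" by (rule vspace_neg[OF L_space lie_mixed_in(1)[OF z \<zeta>]])
    show "g (neg_transpose_bidual L (dual_product L \<delta> \<zeta>) z) = g (- fst (D (z, 0) (0, \<zeta>)))"
      if g: "g \<in> points (dual L)" for g
      using spec g by (simp add: dual_neg[OF g L_space] lie_mixed_in[OF z \<zeta>] lie_mixed[OF z \<zeta>] dual_product_eq \<zeta>)
  qed
  have split: "D (x, \<xi>) (y, \<eta>) = D (x, 0) (y, 0) + D (x, 0) (0, \<eta>) + (D (0, \<xi>) (y, 0) + D (0, \<xi>) (0, \<eta>))"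
  proof -
    have 1: "D w (y, \<eta>) = D w (y, 0) + D w (0, \<eta>)" if "w \<in> points LL" for w
      using linear_map_add[OF bilinear_right[OF bilD that] y0 \<eta>0] by simp
    have "D (x, \<xi>) (y, \<eta>) = D (x, 0) (y, \<eta>) + D (0, \<xi>) (y, \<eta>)"
      using linear_map_add[OF bilinear_left[OF bilD v] x0 \<xi>0] uv by simp
    then show ?thesis unfolding 1[OF x0] 1[OF \<xi>0] .
  qed
  note anti = lie_algebra_antisym[OF lie(3) \<xi>0 y0]
  show ?thesis
    using x y \<xi> \<eta> unfolding uv lie_double_def Let_def
    by (intro prod_eqI) (simp_all add: split anti bidual sub sub' dual_product_eq neg_transpose_eq lie_mixed)
qed

end


section \<open>The Lie algebra induced by a Novikov and a right Novikov algebra\<close>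

lemma trilinear_eq_on_tensor:
  assumes V: "vspace V" and W: "vspace W"
    and f: "\<And>x y. x \<in> points (tensor V W) \<Longrightarrow> y \<in> points (tensor V W) \<Longrightarrow>
      linear_map (tensor V W) U (\<lambda>u. f u x y) \<and> linear_map (tensor V W) U (\<lambda>u. f x u y)
      \<and> linear_map (tensor V W) U (\<lambda>u. f x y u)"
    and g: "\<And>x y. x \<in> points (tensor V W) \<Longrightarrow> y \<in> points (tensor V W) \<Longrightarrow>
      linear_map (tensor V W) U (\<lambda>u. g u x y) \<and> linear_map (tensor V W) U (\<lambda>u. g x u y)
      \<and> linear_map (tensor V W) U (\<lambda>u. g x y u)"
    and eq: "\<And>v1 w1 v2 w2 v3 w3. v1 \<in> points V \<Longrightarrow> w1 \<in> points W \<Longrightarrow> v2 \<in> points V \<Longrightarrow> w2 \<in> points W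
      \<Longrightarrow> v3 \<in> points V \<Longrightarrow> w3 \<in> points W
      \<Longrightarrow> f (ten V W v1 w1) (ten V W v2 w2) (ten V W v3 w3) = g (ten V W v1 w1) (ten V W v2 w2) (ten V W v3 w3)"
    and x: "x \<in> points (tensor V W)" and y: "y \<in> points (tensor V W)" and z: "z \<in> points (tensor V W)"
  shows "f x y z = g x y z"
proof (rule linear_eq_on_tensor[OF V W _ _ _ x])
  show "linear_map (tensor V W) U (\<lambda>u. f u y z)" "linear_map (tensor V W) U (\<lambda>u. g u y z)"
    using f[OF y z] g[OF y z] by auto
  fix v w assume vw: "v \<in> points V" "w \<in> points W"
  let ?x = "ten V W v w"
  have x': "?x \<in> points (tensor V W)" by (rule ten_in[OF vw])
  show "f ?x y z = g ?x y z"
  proof (rule bilinear_eq_on_tensor[OF V W V W _ _ _ y z])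
    show "bilinear_map (tensor V W) (tensor V W) U (f ?x)"
      using f[OF x'] f[OF _ x'] by (intro bilinear_mapI) auto
    show "bilinear_map (tensor V W) (tensor V W) U (g ?x)"
      using g[OF x'] g[OF _ x'] by (intro bilinear_mapI) auto
  qed (rule eq[OF vw])
qed

context
  fixes V :: "('k::field, 'v::ab_group_add) space" and m :: "'v \<Rightarrow> 'v \<Rightarrow> 'v"
    and W :: "('k, 'w::ab_group_add) space" and d :: "'w \<Rightarrow> 'w \<Rightarrow> 'w"
  assumes V: "vspace V" and W: "vspace W" and m: "bilinear_map V V V m" and d: "bilinear_map W W W d"
begin

lemma
  shows induced_bracket_bilinear:
      "bilinear_map (tensor V W) (tensor V W) (tensor V W) (induced_bracket V m W d)" (is ?bil)
    and induced_bracket_ten: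
      "\<And>a b a' b'. a \<in> points V \<Longrightarrow> b \<in> points W \<Longrightarrow> a' \<in> points V \<Longrightarrow> b' \<in> points W
      \<Longrightarrow> induced_bracket V m W d (ten V W a b) (ten V W a' b')
        = ten V W (m a a') (d b b') - ten V W (m a' a) (d b' b)"
proof -
  let ?\<gamma> = "\<lambda>a b a' b'. ten V W (m a a') (d b b') - ten V W (m a' a) (d b' b)"
  have 1: "bilinear_map V W (tensor V W) (\<lambda>a b. ?\<gamma> a b a' b')" if "a' \<in> points V" "b' \<in> points W" for a' b'
    using that
    by (intro bilinear_map_minus bilinear_map_comp2[OF bilinear_ten] vspace_tensor V W
        bilinear_left[OF m] bilinear_left[OF d] bilinear_right[OF m] bilinear_right[OF d])
  have 2: "bilinear_map V W (tensor V W) (?\<gamma> a b)" if "a \<in> points V" "b \<in> points W" for a b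
    using that
    by (intro bilinear_map_minus bilinear_map_comp2[OF bilinear_ten] vspace_tensor V W
        bilinear_left[OF m] bilinear_left[OF d] bilinear_right[OF m] bilinear_right[OF d])
  show ?bil unfolding induced_bracket_def[abs_def]
    by (rule nested_tlift_bilinear[OF V W V W vspace_tensor[OF V W]]) (rule 1 2; assumption)+
  show "induced_bracket V m W d (ten V W a b) (ten V W a' b') = ?\<gamma> a b a' b'"
    if "a \<in> points V" "b \<in> points W" "a' \<in> points V" "b' \<in> points W" for a b a' b'
    unfolding induced_bracket_def
    by (rule nested_tlift_ten[OF V W V W vspace_tensor[OF V W]]) (rule 1 2 that; assumption?)+
qed

end

text \<open>On pure tensors, and paired with two functionals, the Jacobi identity is a bilinear identity
  between the values on the twelve products of three elements of either algebra. The axioms of each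
  algebra reduce its twelve values to six, after which the identity is one of polynomials.\<close>

lemma induced_bracket_lie_algebra:
  fixes V :: "('k::field_char_0, 'v::ab_group_add) space" and W :: "('k, 'w::ab_group_add) space"
  assumes nov: "novikov_algebra V m" and rnov: "right_novikov_algebra W d"
  shows "lie_algebra (tensor V W) (induced_bracket V m W d)"
proof -
  let ?T = "tensor V W" and ?br = "induced_bracket V m W d"
  have V: "vspace V" and W: "vspace W" and m: "bilinear_map V V V m" and d: "bilinear_map W W W d"
    using nov rnov by (auto simp: novikov_algebra_def right_novikov_algebra_def)
  note T = vspace_tensor[OF V W]
  note bil = induced_bracket_bilinear[OF V W m d] and pure = induced_bracket_ten[OF V W m d]
  note m_in = bilinear_in[OF m] and d_in = bilinear_in[OF d] and br_in = bilinear_in[OF bil]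
  have anti: "?br s t = - ?br t s" if s: "s \<in> points ?T" and t: "t \<in> points ?T" for s t
  proof (rule bilinear_eq_on_tensor[OF V W V W bil _ _ s t])
    show "bilinear_map ?T ?T ?T (\<lambda>s t. - ?br t s)"
      using bil by (intro bilinear_mapI linear_map_uminus T) (auto simp: bilinear_map_def)
  qed (simp add: pure fun_eq_iff)
  \<comment> \<open>Here characteristic zero enters.\<close>
  have alt: "?br s s = 0" if "s \<in> points ?T" for s
  proof
    fix p
    have "?br s s p = - ?br s s p" using fun_cong[OF anti[OF that that], of p] by simp
    then show "?br s s p = 0 p" by simp
  qed
  have jacobi: "?br x (?br y z) + ?br y (?br z x) + ?br z (?br x y) = 0"
    if x: "x \<in> points ?T" and y: "y \<in> points ?T" and z: "z \<in> points ?T" for x y z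
  proof (rule trilinear_eq_on_tensor[OF V W _ _ _ x y z,
      where f = "\<lambda>x y z. ?br x (?br y z) + ?br y (?br z x) + ?br z (?br x y)" and g = "\<lambda>x y z. 0" and U = ?T])
    fix x y assume "x \<in> points ?T" "y \<in> points ?T"
    note xy [simp] = this
    note comps = linear_map_comp[OF bilinear_left[OF bil] bilinear_left[OF bil]]
      linear_map_comp[OF bilinear_left[OF bil] bilinear_right[OF bil]]
      linear_map_comp[OF bilinear_right[OF bil] bilinear_left[OF bil]]
      linear_map_comp[OF bilinear_right[OF bil] bilinear_right[OF bil]]
      bilinear_left[OF bil] bilinear_right[OF bil]
    show "linear_map ?T ?T (\<lambda>u. ?br u (?br x y) + ?br x (?br y u) + ?br y (?br u x))
        \<and> linear_map ?T ?T (\<lambda>u. ?br x (?br u y) + ?br u (?br y x) + ?br y (?br x u))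
        \<and> linear_map ?T ?T (\<lambda>u. ?br x (?br y u) + ?br y (?br u x) + ?br u (?br x y))"
      by (intro conjI linear_map_plus T) (simp_all add: comps br_in)
    show "linear_map ?T ?T (\<lambda>u. 0) \<and> linear_map ?T ?T (\<lambda>u. 0) \<and> linear_map ?T ?T (\<lambda>u. 0)"
      using linear_map_zero[OF T] by simp
  next
    fix a b a' b' a'' b''
    assume a: "a \<in> points V" "a' \<in> points V" "a'' \<in> points V" and b: "b \<in> points W" "b' \<in> points W" "b'' \<in> points W"
    let ?x = "ten V W a b" and ?y = "ten V W a' b'" and ?z = "ten V W a'' b''"
    have xyz: "?x \<in> points ?T" "?y \<in> points ?T" "?z \<in> points ?T" using a b by (auto intro: ten_in)
    note brd = linear_map_diff[OF bilinear_right[OF bil] T]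
    show "?br ?x (?br ?y ?z) + ?br ?y (?br ?z ?x) + ?br ?z (?br ?x ?y) = 0"
    proof (rule tensor_eqI)
      show "?br ?x (?br ?y ?z) + ?br ?y (?br ?z ?x) + ?br ?z (?br ?x ?y) \<in> points ?T"
        by (intro vspace_add T br_in xyz)
      show "0 \<in> points ?T" by (rule tensor_0)
      fix \<xi> \<eta> assume \<xi>: "\<xi> \<in> points (dual V)" and \<eta>: "\<eta> \<in> points (dual W)"
      have comm: "\<xi> (m (m p q) r) = \<xi> (m (m p r) q)"
        and lsym: "\<xi> (m p (m q r)) = \<xi> (m q (m p r)) + \<xi> (m (m p q) r) - \<xi> (m (m q p) r)"
        if "p \<in> points V" "q \<in> points V" "r \<in> points V" for p q r
      proof -
        have "m (m p q) r - m p (m q r) = m (m q p) r - m q (m p r)" and c: "m (m p q) r = m (m p r) q"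
          using nov that by (auto simp: novikov_algebra_def)
        from arg_cong[OF this(1), of \<xi>]
        show "\<xi> (m p (m q r)) = \<xi> (m q (m p r)) + \<xi> (m (m p q) r) - \<xi> (m (m q p) r)"
          using that by (simp add: dual_diff[OF \<xi> V] m_in algebra_simps)
        show "\<xi> (m (m p q) r) = \<xi> (m (m p r) q)" using c by simp
      qed
      have comm': "\<eta> (d p (d q r)) = \<eta> (d q (d p r))"
        and rsym: "\<eta> (d (d p q) r) = \<eta> (d (d p r) q) + \<eta> (d p (d q r)) - \<eta> (d p (d r q))"
        if "p \<in> points W" "q \<in> points W" "r \<in> points W" for p q r
      proof -
        have "d (d p q) r - d p (d q r) = d (d p r) q - d p (d r q)" and c: "d p (d q r) = d q (d p r)"
          using rnov that by (auto simp: right_novikov_algebra_def)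
        from arg_cong[OF this(1), of \<eta>]
        show "\<eta> (d (d p q) r) = \<eta> (d (d p r) q) + \<eta> (d p (d q r)) - \<eta> (d p (d r q))"
          using that by (simp add: dual_diff[OF \<eta> W] d_in algebra_simps)
        show "\<eta> (d p (d q r)) = \<eta> (d q (d p r))" using c by simp
      qed
      note red = comm[of a' a a''] comm[of a a' a''] comm[of a'' a a'] lsym[of a a' a''] lsym[of a' a'' a] lsym[of a a'' a']
      note red' = comm'[of b b' b''] comm'[of b' b'' b] comm'[of b b'' b'] rsym[of b b' b''] rsym[of b' b b''] rsym[of b'' b b']
      have "(?br ?x (?br ?y ?z) + ?br ?y (?br ?z ?x) + ?br ?z (?br ?x ?y)) (\<xi>, \<eta>) = 0"
        using a b
        by (simp add: pure brd m_in d_in ten_in \<xi> \<eta> red red') (simp add: algebra_simps)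
      then show "(?br ?x (?br ?y ?z) + ?br ?y (?br ?z ?x) + ?br ?z (?br ?x ?y)) (\<xi>, \<eta>) = 0 (\<xi>, \<eta>)" by simp
    qed
  qed
  show ?thesis unfolding lie_algebra_def using T bil alt jacobi by blast
qed

section \<open>Transporting the induced Lie algebra of the double\<close>

lemma bilinear_map_Pair:
  "bilinear_map V W U \<beta> \<Longrightarrow> bilinear_map V W X \<gamma> \<Longrightarrow> bilinear_map V W (dsum U X) (\<lambda>v w. (\<beta> v w, \<gamma> v w))"
  by (simp add: bilinear_map_def linear_map_Pair)

lemma linear_map_Pair_0:
  "vspace V \<Longrightarrow> vspace W \<Longrightarrow> linear_map V (dsum V W) (\<lambda>v. (v, 0))"
  "vspace V \<Longrightarrow> vspace W \<Longrightarrow> linear_map W (dsum V W) (\<lambda>w. (0, w))"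
  by (auto intro: linear_map_Pair linear_map_id linear_map_zero)

context
  fixes A :: "('k::field_char_0, 'a::ab_group_add) space" and mA :: "'a \<Rightarrow> 'a \<Rightarrow> 'a"
    and n :: "('a \<Rightarrow> 'k) \<Rightarrow> ('a \<Rightarrow> 'k) \<Rightarrow> 'a \<Rightarrow> 'k"
    and M :: "'a \<times> ('a \<Rightarrow> 'k) \<Rightarrow> 'a \<times> ('a \<Rightarrow> 'k) \<Rightarrow> 'a \<times> ('a \<Rightarrow> 'k)"
    and B :: "('k, 'b::ab_group_add) space" and d :: "'b \<Rightarrow> 'b \<Rightarrow> 'b" and form :: "'b \<Rightarrow> 'b \<Rightarrow> 'k"
  assumes finA: "fin_dim_space A" and triple: "novikov_manin_triple A mA n M"
    and finB: "fin_dim_space B" and quad: "quadratic_right_novikov_algebra B d form"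
begin

private abbreviation (input) "L \<equiv> tensor A B"
private abbreviation (input) "L' \<equiv> tensor (dual A) (dual B)"
private abbreviation (input) "EA \<equiv> dsum A (dual A)"
private abbreviation (input) "T \<equiv> tensor EA B"
private abbreviation (input) "\<phi> \<equiv> form_map B form"
private abbreviation (input) "\<psi> \<equiv> inv_into (points B) (form_map B form)"
private abbreviation (input) "d' \<equiv> dual_form_product B d form"
private abbreviation (input) "\<kappa> \<equiv> dual_tensor_iso A B"
private abbreviation (input) "\<Psi> \<equiv> double_iso A B form"
private abbreviation (input) "br \<equiv> induced_bracket A mA B d"
private abbreviation (input) "brE \<equiv> induced_bracket EA M B d"
private abbreviation (input) "br0 \<equiv> induced_bracket (dual A) n (dual B) d'"
private abbreviation (input) "br' \<equiv> dual_induced_bracket A n B d'"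
private abbreviation (input) "D \<equiv> transported_bracket A M B d form"

private lemma A: "vspace A" and B: "vspace B"
  by (rule fin_dim_vspace[OF finA], rule fin_dim_vspace[OF finB])

private lemmas A' = vspace_dual[OF A] and B' = vspace_dual[OF B]

private lemmas E = vspace_dsum[OF A A'] and L = vspace_tensor[OF A B]

private lemmas T = vspace_tensor[OF E B] and L' = vspace_tensor[OF A' B'] and Ld = vspace_dual[OF L]

private lemmas LL = vspace_dsum[OF L Ld]

private lemma novikov_parts: "novikov_algebra A mA" "novikov_algebra (dual A) n" "novikov_algebra EA M"
  and M_vec: "a \<in> points A \<Longrightarrow> b \<in> points A \<Longrightarrow> M (a, 0) (b, 0) = (mA a b, 0)"
  and M_cov: "f \<in> points (dual A) \<Longrightarrow> g \<in> points (dual A) \<Longrightarrow> M (0, f) (0, g) = (0, n f g)"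
  and M_inv: "x \<in> points EA \<Longrightarrow> y \<in> points EA \<Longrightarrow> z \<in> points EA
    \<Longrightarrow> std_form (M x y) z = - std_form y (M x z + M z x)"
  using triple unfolding novikov_manin_triple_def by blast+

private lemma mA: "bilinear_map A A A mA" and n_bilinear: "bilinear_map (dual A) (dual A) (dual A) n"
  and M: "bilinear_map EA EA EA M"
  using novikov_parts by (simp_all add: novikov_algebra_def)

private lemma rnov: "right_novikov_algebra B d" and form: "bilinear_map B B scalars form"
  and sym: "a \<in> points B \<Longrightarrow> b \<in> points B \<Longrightarrow> form a b = form b a"
  and nondeg: "a \<in> points B \<Longrightarrow> (\<And>b. b \<in> points B \<Longrightarrow> form a b = 0) \<Longrightarrow> a = 0"
  and form_inv: "a \<in> points B \<Longrightarrow> b \<in> points B \<Longrightarrow> c \<in> points B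
    \<Longrightarrow> form (d a b) c = - form a (d b c + d c b)"
  using quad unfolding quadratic_right_novikov_algebra_def by blast+

private lemma d: "bilinear_map B B B d"
  using rnov by (simp add: right_novikov_algebra_def)

private lemmas \<phi> = form_map_linear[OF finB form sym nondeg]
  and \<phi>_apply = form_map_apply[OF finB form sym nondeg]
  and \<phi>_obtain = obtain_form_map[OF finB form sym nondeg]
  and \<psi> = form_map_inv_linear[OF finB form sym nondeg]
  and \<psi>_\<phi> = form_map_inv_left[OF finB form sym nondeg]
  and \<phi>_\<psi> = form_map_inv_right[OF finB form sym nondeg]

private lemma d'_eq: "d' f g = \<phi> (d (\<psi> f) (\<psi> g))"
  by (simp add: dual_form_product_def Let_def)

private lemma d': "bilinear_map (dual B) (dual B) (dual B) d'"
  unfolding d'_eq[abs_def] by (rule bilinear_map_comp[OF bilinear_map_comp2[OF d \<psi> \<psi>] \<phi>])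

private lemmas \<kappa> = dual_tensor_iso_linear[OF A B] and \<kappa>_ten = dual_tensor_iso_ten[OF A B]
  and \<kappa>_bij = dual_tensor_iso_bij[OF finA finB]

private lemmas br = induced_bracket_bilinear[OF A B mA d] and br_ten = induced_bracket_ten[OF A B mA d]
  and brE = induced_bracket_bilinear[OF E B M d] and brE_ten = induced_bracket_ten[OF E B M d]
  and br0 = induced_bracket_bilinear[OF A' B' n_bilinear d'] and br0_ten = induced_bracket_ten[OF A' B' n_bilinear d']

private lemma
  shows \<Psi>: "linear_map T (dsum L (dual L)) \<Psi>"
    and \<Psi>_ten: "e \<in> points EA \<Longrightarrow> b \<in> points B
      \<Longrightarrow> \<Psi> (ten EA B e b) = (ten A B (fst e) b, \<kappa> (ten (dual A) (dual B) (snd e) (\<phi> b)))"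
proof -
  have b: "bilinear_map EA B (dsum L (dual L))
      (\<lambda>(a, f) b. (ten A B a b, \<kappa> (ten (dual A) (dual B) f (\<phi> b))))"
    unfolding case_prod_unfold
    by (intro bilinear_map_Pair bilinear_map_comp2[OF bilinear_ten[OF A B] linear_map_fst linear_map_id]
        bilinear_map_comp[OF bilinear_map_comp2[OF bilinear_ten[OF A' B'] linear_map_snd \<phi>] \<kappa>])
  show "linear_map T (dsum L (dual L)) \<Psi>"
    unfolding double_iso_def by (rule tlift_linear[OF E B LL b])
  show "\<Psi> (ten EA B e b) = (ten A B (fst e) b, \<kappa> (ten (dual A) (dual B) (snd e) (\<phi> b)))"
    if "e \<in> points EA" "b \<in> points B"
    using tlift_ten[OF E B b that] unfolding double_iso_def case_prod_unfold .
qed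

text \<open>The inclusions of \<open>A \<otimes> B\<close> and of \<open>A* \<otimes> B*\<close> into \<open>(A \<oplus> A*) \<otimes> B\<close>, the second one through the
  inverse of the form map. Together they invert \<open>\<Psi>\<close>.\<close>

private definition "J = tmap A B EA B (\<lambda>a. (a, 0)) (\<lambda>b. b)"
private definition "J' = tmap (dual A) (dual B) EA B (\<lambda>f. (0, f)) \<psi>"

private lemmas incl = linear_map_Pair_0[OF A A']

private lemma J: "linear_map L T J" and J': "linear_map L' T J'"
  unfolding J_def J'_def
  by (rule tmap_linear_in[OF A B E B incl(1) linear_map_id], rule tmap_linear_in[OF A' B' E B incl(2) \<psi>])

private lemma J_ten: "a \<in> points A \<Longrightarrow> b \<in> points B \<Longrightarrow> J (ten A B a b) = ten EA B (a, 0) b"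
  and J'_ten: "f \<in> points (dual A) \<Longrightarrow> g \<in> points (dual B)
    \<Longrightarrow> J' (ten (dual A) (dual B) f g) = ten EA B (0, f) (\<psi> g)"
  unfolding J_def J'_def
  by (rule tmap_ten[OF A B E B incl(1) linear_map_id], assumption+)
    (rule tmap_ten[OF A' B' E B incl(2) \<psi>], assumption+)

private lemma ten_0: "b \<in> points B \<Longrightarrow> ten A B 0 b = 0" "g \<in> points (dual B) \<Longrightarrow> ten (dual A) (dual B) 0 g = 0"
  using linear_map_0[OF bilinear_left[OF bilinear_ten[OF A B]] A]
    linear_map_0[OF bilinear_left[OF bilinear_ten[OF A' B']] A'] by auto

private lemmas tensor_zeros = vspace_0[OF A] vspace_0[OF A'] ten_0 linear_map_0[OF \<kappa> L']

private lemma \<Psi>_J: "x \<in> points L \<Longrightarrow> \<Psi> (J x) = (x, 0)"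
  by (rule linear_eq_on_tensor[OF A B linear_map_comp[OF J \<Psi>] linear_map_Pair_0(1)[OF L Ld]])
    (simp_all add: J_ten \<Psi>_ten tensor_zeros linear_map_in[OF \<phi>])

private lemma \<Psi>_J': "s \<in> points L' \<Longrightarrow> \<Psi> (J' s) = (0, \<kappa> s)"
  by (rule linear_eq_on_tensor[OF A' B' linear_map_comp[OF J' \<Psi>]
        linear_map_comp[OF \<kappa> linear_map_Pair_0(2)[OF L Ld]]])
    (simp_all add: J'_ten \<Psi>_ten tensor_zeros linear_map_in[OF \<psi>] \<phi>_\<psi>)

private lemma \<Psi>_bij: "bij_betw \<Psi> (points T) (points (dsum L (dual L)))"
proof (rule bij_betw_byWitness)
  let ?\<iota> = "inv_into (points L') \<kappa>"
  let ?R = "\<lambda>u. J (fst u) + J' (?\<iota> (snd u))"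
  note \<iota> = inv_into_linear[OF L' \<kappa> \<kappa>_bij]
  have R: "linear_map (dsum L (dual L)) T ?R"
    by (intro linear_map_plus T linear_map_comp[OF linear_map_fst J]
        linear_map_comp[OF linear_map_comp[OF linear_map_snd \<iota>] J'])
  show "\<forall>t\<in>points T. ?R (\<Psi> t) = t"
  proof
    fix t assume t: "t \<in> points T"
    show "?R (\<Psi> t) = t"
    proof (rule linear_eq_on_tensor[OF E B linear_map_comp[OF \<Psi> R] linear_map_id _ t])
      fix e b assume e: "e \<in> points EA" and b: "b \<in> points B"
      then obtain a f where af: "e = (a, f)" "a \<in> points A" "f \<in> points (dual A)" by auto
      have "ten EA B (a, 0) b + ten EA B (0, f) b = ten EA B e b"
        using linear_map_add[OF bilinear_left[OF bilinear_ten[OF E B] b], of "(a, 0)" "(0, f)"] af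
        by (simp add: tensor_zeros)
      then show "?R (\<Psi> (ten EA B e b)) = ten EA B e b"
        using b af bij_betw_inv_into_left[OF \<kappa>_bij]
        by (simp add: \<Psi>_ten J_ten J'_ten ten_in linear_map_in[OF \<phi>] \<psi>_\<phi>)
    qed
  qed
  show "\<forall>u\<in>points (dsum L (dual L)). \<Psi> (?R u) = u"
  proof
    fix u assume "u \<in> points (dsum L (dual L))"
    then obtain x \<zeta> where u: "u = (x, \<zeta>)" "x \<in> points L" "\<zeta> \<in> points (dual L)" by auto
    have "\<Psi> (J x + J' (?\<iota> \<zeta>)) = \<Psi> (J x) + \<Psi> (J' (?\<iota> \<zeta>))"
      using u by (intro linear_map_add[OF \<Psi>] linear_map_in[OF J] linear_map_in[OF J'] linear_map_in[OF \<iota>])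
    then show "\<Psi> (?R u) = u"
      using u bij_betw_inv_into_right[OF \<kappa>_bij u(3)] by (simp add: \<Psi>_J \<Psi>_J' linear_map_in[OF \<iota>])
  qed
  show "\<Psi> ` points T \<subseteq> points (dsum L (dual L))" using linear_map_in[OF \<Psi>] by blast
  show "?R ` points (dsum L (dual L)) \<subseteq> points T" using linear_map_in[OF R] by blast
qed

private lemma D_\<Psi>: "s \<in> points T \<Longrightarrow> t \<in> points T \<Longrightarrow> D (\<Psi> s) (\<Psi> t) = \<Psi> (brE s t)"
  by (simp add: transported_bracket_def Let_def bij_betw_inv_into_left[OF \<Psi>_bij])

private lemma \<Psi>_obtain:
  assumes "u \<in> points (dsum L (dual L))"
  obtains t where "t \<in> points T" "u = \<Psi> t"
  using assms \<Psi>_bij unfolding bij_betw_def by blast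

private lemma \<kappa>_obtain:
  assumes "\<xi> \<in> points (dual L)"
  obtains s where "s \<in> points L'" "\<xi> = \<kappa> s"
  using assms \<kappa>_bij unfolding bij_betw_def by blast

private lemma br'_\<kappa>: "s \<in> points L' \<Longrightarrow> t \<in> points L' \<Longrightarrow> br' (\<kappa> s) (\<kappa> t) = \<kappa> (br0 s t)"
  by (simp add: dual_induced_bracket_def Let_def bij_betw_inv_into_left[OF \<kappa>_bij])

private lemma brE_J: "x \<in> points L \<Longrightarrow> y \<in> points L \<Longrightarrow> brE (J x) (J y) = J (br x y)"
  by (rule bilinear_eq_on_tensor[OF A B A B bilinear_map_comp2[OF brE J J] bilinear_map_comp[OF br J]])
    (simp_all add: J_ten brE_ten br_ten tensor_zeros M_vec linear_map_diff[OF J L] ten_in bilinear_in[OF mA]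
      bilinear_in[OF d])

private lemma brE_J': "s \<in> points L' \<Longrightarrow> t \<in> points L' \<Longrightarrow> brE (J' s) (J' t) = J' (br0 s t)"
  by (rule bilinear_eq_on_tensor[OF A' B' A' B' bilinear_map_comp2[OF brE J' J'] bilinear_map_comp[OF br0 J']])
    (simp_all add: J'_ten brE_ten br0_ten tensor_zeros M_cov linear_map_diff[OF J' L'] ten_in bilinear_in[OF n_bilinear]
      bilinear_in[OF d] bilinear_in[OF d'] linear_map_in[OF \<psi>] d'_eq linear_map_in[OF \<phi>] \<psi>_\<phi>)

private lemma D_vec: "x \<in> points L \<Longrightarrow> y \<in> points L \<Longrightarrow> D (x, 0) (y, 0) = (br x y, 0)"
  using D_\<Psi>[of "J x" "J y"]
  by (simp add: linear_map_in[OF J] brE_J \<Psi>_J bilinear_in[OF br])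

private lemma D_cov:
  assumes "\<xi> \<in> points (dual L)" "\<eta> \<in> points (dual L)"
  shows "D (0, \<xi>) (0, \<eta>) = (0, br' \<xi> \<eta>)"
proof -
  obtain s t where st: "s \<in> points L'" "\<xi> = \<kappa> s" "t \<in> points L'" "\<eta> = \<kappa> t"
    using assms by (metis \<kappa>_obtain)
  then show ?thesis
    using D_\<Psi>[of "J' s" "J' t"]
    by (simp add: linear_map_in[OF J'] brE_J' \<Psi>_J' bilinear_in[OF br0] br'_\<kappa>)
qed

private lemma br'_in: "\<xi> \<in> points (dual L) \<Longrightarrow> \<eta> \<in> points (dual L) \<Longrightarrow> br' \<xi> \<eta> \<in> points (dual L)"
  by (metis \<kappa>_obtain br'_\<kappa> linear_map_in[OF \<kappa>] bilinear_in[OF br0])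

private lemma lie_D: "lie_algebra (dsum L (dual L)) D"
proof (rule lie_algebra_embedding[OF LL induced_bracket_lie_algebra[OF novikov_parts(3) rnov]
      inv_into_linear[OF T \<Psi> \<Psi>_bij]])
  let ?\<iota> = "inv_into (points T) \<Psi>"
  show "inj_on ?\<iota> (points (dsum L (dual L)))"
    using bij_betw_inv_into[OF \<Psi>_bij] by (rule bij_betw_imp_inj_on)
  fix u v assume "u \<in> points (dsum L (dual L))" "v \<in> points (dsum L (dual L))"
  then obtain s t where st: "s \<in> points T" "u = \<Psi> s" "t \<in> points T" "v = \<Psi> t" by (metis \<Psi>_obtain)
  then show "D u v \<in> points (dsum L (dual L))" "?\<iota> (D u v) = brE (?\<iota> u) (?\<iota> v)"
    by (simp_all only: D_\<Psi> bij_betw_inv_into_left[OF \<Psi>_bij] bilinear_in[OF brE] linear_map_in[OF \<Psi>])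
qed

private lemma lie_br': "lie_algebra (dual L) br'"
proof (rule lie_algebra_embedding[OF Ld lie_D linear_map_Pair_0(2)[OF L Ld] _ br'_in])
  show "inj_on (\<lambda>\<xi>. (0, \<xi>)) (points (dual L))" by (simp add: inj_on_def)
qed (simp_all add: D_cov)

text \<open>On pure tensors the canonical form of \<open>L\<close> is the product of the canonical form of \<open>A\<close> and the
  form of \<open>B\<close>.\<close>

private lemma std_form_\<Psi>:
  assumes "e \<in> points EA" "b \<in> points B" "e' \<in> points EA" "b' \<in> points B"
  shows "std_form (\<Psi> (ten EA B e b)) (\<Psi> (ten EA B e' b')) = std_form e e' * form b b'"
  using assms sym[of b b']
  by (auto simp: std_form_def \<Psi>_ten \<kappa>_ten linear_map_in[OF \<phi>] ten_in \<phi>_apply algebra_simps)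

text \<open>Let \<open>t\<^sub>i\<close> be the value of \<open>\<langle>xy, z\<rangle>\<close> with the \<open>i\<close>-th of three elements in the place of \<open>y\<close>, and \<open>s\<^sub>i\<close> the
  value of \<open>(uv, w)\<close> with the \<open>i\<close>-th element in the place of \<open>u\<close>. By invariance these do not depend on the
  order of the other two elements, and \<open>t\<^sub>1 + t\<^sub>2 + t\<^sub>3 = s\<^sub>1 + s\<^sub>2 + s\<^sub>3 = 0\<close>. Invariance of the form on the
  induced Lie algebra is \<open>t\<^sub>2 s\<^sub>1 - t\<^sub>1 s\<^sub>2 = t\<^sub>3 s\<^sub>2 - t\<^sub>2 s\<^sub>3\<close>, which follows.\<close>

private lemma M_cyclic:
  assumes "x \<in> points EA" "y \<in> points EA" "z \<in> points EA"
  shows "std_form (M x y) z + std_form (M x z) y + std_form (M z x) y = 0"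
    and "std_form (M z x) y = std_form (M y x) z"
proof -
  have 1: "std_form (M x y) z + std_form (M x z) y + std_form (M z x) y = 0"
    if "x \<in> points EA" "y \<in> points EA" "z \<in> points EA" for x y z
    using M_inv[OF that] linear_map_add[OF bilinear_right[OF std_form_bilinear[OF A] that(2)]
        bilinear_in[OF M that(1,3)] bilinear_in[OF M that(3,1)]]
    by (simp add: std_form_sym[of y])
  show "std_form (M x y) z + std_form (M x z) y + std_form (M z x) y = 0" by (rule 1[OF assms])
  show "std_form (M z x) y = std_form (M y x) z"
    using 1[OF assms(1,2,3)] 1[OF assms(1,3,2)] by (metis add.commute add_left_cancel)
qed

private lemma form_cyclic:
  assumes "a \<in> points B" "b \<in> points B" "c \<in> points B"
  shows "form (d a b) c + form (d b c) a + form (d c b) a = 0"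
    and "form (d a b) c = form (d a c) b"
proof -
  have 1: "form (d a b) c + form (d b c) a + form (d c b) a = 0"
    if "a \<in> points B" "b \<in> points B" "c \<in> points B" for a b c
    using form_inv[OF that] linear_map_add[OF bilinear_right[OF form that(1)]
        bilinear_in[OF d that(2,3)] bilinear_in[OF d that(3,2)]]
      sym[OF that(1) bilinear_in[OF d that(2,3)]] sym[OF that(1) bilinear_in[OF d that(3,2)]]
    by simp
  show "form (d a b) c + form (d b c) a + form (d c b) a = 0" by (rule 1[OF assms])
  show "form (d a b) c = form (d a c) b"
    using 1[OF assms] 1[OF assms(1,3,2)] by (metis add.commute add.left_commute add_right_cancel)
qed

private lemma D_invariant:
  assumes "u \<in> points (dsum L (dual L))" "v \<in> points (dsum L (dual L))" "w \<in> points (dsum L (dual L))"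
  shows "std_form (D u v) w = std_form u (D v w)"
proof -
  define Q where "Q s t = std_form (\<Psi> s) (\<Psi> t)" for s t
  have Q: "bilinear_map T T scalars Q"
    unfolding Q_def by (rule bilinear_map_comp2[OF std_form_bilinear[OF L] \<Psi> \<Psi>])
  have Q_ten: "Q (ten EA B e b) (ten EA B e' b') = std_form e e' * form b b'"
    if "e \<in> points EA" "b \<in> points B" "e' \<in> points EA" "b' \<in> points B" for e b e' b'
    unfolding Q_def by (rule std_form_\<Psi>[OF that])
  have inv: "Q (brE s t) r = Q s (brE t r)"
    if s: "s \<in> points T" and t: "t \<in> points T" and r: "r \<in> points T" for s t r
  proof (rule trilinear_eq_on_tensor[OF E B _ _ _ s t r,
      where f = "\<lambda>s t r. Q (brE s t) r" and g = "\<lambda>s t r. Q s (brE t r)" and U = scalars])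
    note comps = linear_map_comp[OF bilinear_left[OF brE] bilinear_left[OF Q]]
      linear_map_comp[OF bilinear_right[OF brE] bilinear_left[OF Q]]
      linear_map_comp[OF bilinear_left[OF brE] bilinear_right[OF Q]]
      linear_map_comp[OF bilinear_right[OF brE] bilinear_right[OF Q]]
      bilinear_left[OF Q] bilinear_right[OF Q] bilinear_in[OF brE]
    fix x y assume "x \<in> points T" "y \<in> points T"
    then show "linear_map T scalars (\<lambda>u. Q (brE u x) y) \<and> linear_map T scalars (\<lambda>u. Q (brE x u) y)
        \<and> linear_map T scalars (\<lambda>u. Q (brE x y) u)"
      "linear_map T scalars (\<lambda>u. Q u (brE x y)) \<and> linear_map T scalars (\<lambda>u. Q x (brE u y))
        \<and> linear_map T scalars (\<lambda>u. Q x (brE y u))"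
      by (simp_all add: comps)
  next
    fix e1 b1 e2 b2 e3 b3
    assume e: "e1 \<in> points EA" "e2 \<in> points EA" "e3 \<in> points EA"
      and b: "b1 \<in> points B" "b2 \<in> points B" "b3 \<in> points B"
    let ?t = "ten EA B"
    note [simp del] = points_dsum
    note in' = ten_in[OF bilinear_in[OF M] bilinear_in[OF d]]
    define t1 t2 t3 where "t1 = std_form (M e2 e1) e3" and "t2 = std_form (M e1 e2) e3"
      and "t3 = std_form (M e1 e3) e2"
    define s1 s2 s3 where "s1 = form (d b1 b2) b3" and "s2 = form (d b2 b1) b3" and "s3 = form (d b3 b1) b2"
    have t: "std_form e1 (M e2 e3) = t3" "std_form e1 (M e3 e2) = t2" "t3 = - t1 - t2"
      unfolding t1_def t2_def t3_def std_form_sym[of e1]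
      using M_cyclic(2)[of e2 e1 e3] M_cyclic(2)[of e3 e1 e2] M_cyclic(1)[of e1 e2 e3] M_cyclic(2)[of e1 e2 e3] e
      by (simp_all add: algebra_simps eq_neg_iff_add_eq_0)
    have s: "form b1 (d b2 b3) = s2" "form b1 (d b3 b2) = s3" "s3 = - s1 - s2"
      unfolding s1_def s2_def s3_def
      using form_cyclic(2)[of b2 b1 b3] form_cyclic(2)[of b3 b1 b2] form_cyclic(1)[of b1 b2 b3] b
        sym[OF b(1) bilinear_in[OF d b(2,3)]] sym[OF b(1) bilinear_in[OF d b(3,2)]]
      by (simp_all add: algebra_simps eq_neg_iff_add_eq_0)
    have "Q (brE (?t e1 b1) (?t e2 b2)) (?t e3 b3)
        = std_form (M e1 e2) e3 * form (d b1 b2) b3 - std_form (M e2 e1) e3 * form (d b2 b1) b3"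
      using e b by (simp add: brE_ten in' linear_map_diff[OF bilinear_left[OF Q] T] ten_in Q_ten
          bilinear_in[OF M] bilinear_in[OF d])
    also have "\<dots> = t2 * s1 - t1 * s2" by (simp add: t1_def t2_def s1_def s2_def)
    also have "\<dots> = t3 * s2 - t2 * s3" unfolding t(3) s(3) by (simp add: algebra_simps)
    also have "\<dots> = std_form e1 (M e2 e3) * form b1 (d b2 b3) - std_form e1 (M e3 e2) * form b1 (d b3 b2)"
      by (simp only: t(1,2) s(1,2))
    also have "\<dots> = Q (?t e1 b1) (brE (?t e2 b2) (?t e3 b3))"
      using e b by (simp add: brE_ten in' linear_map_diff[OF bilinear_right[OF Q] T] ten_in Q_ten
          bilinear_in[OF M] bilinear_in[OF d])
    finally show "Q (brE (?t e1 b1) (?t e2 b2)) (?t e3 b3) = Q (?t e1 b1) (brE (?t e2 b2) (?t e3 b3))" .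
  qed
  obtain s t r where "s \<in> points T" "u = \<Psi> s" "t \<in> points T" "v = \<Psi> t" "r \<in> points T" "w = \<Psi> r"
    using assms by (metis \<Psi>_obtain)
  then show ?thesis using inv[of s t r] by (simp add: D_\<Psi> Q_def)
qed

lemma induced_lie_manin_triple: "lie_manin_triple L br br' D"
  unfolding lie_manin_triple_def
  by (intro conjI ballI induced_bracket_lie_algebra novikov_parts(1) rnov lie_br' lie_D D_vec D_cov D_invariant)
    (simp_all add: std_form_def dual_0[OF _ L])

context
  fixes \<Delta> :: "'a \<Rightarrow> ('k, 'a, 'a) tensor"
  assumes \<Delta>: "linear_map A (tensor A A) \<Delta>"
    and \<Delta>_eval: "\<And>a f g. a \<in> points A \<Longrightarrow> f \<in> points (dual A) \<Longrightarrow> g \<in> points (dual A) \<Longrightarrow> \<Delta> a (f, g) = n f g a"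
begin

private abbreviation (input) "\<Delta>\<^sub>B \<equiv> form_coproduct B d form"
private abbreviation (input) "\<delta> \<equiv> induced_cobracket A \<Delta> B \<Delta>\<^sub>B"

private lemmas \<Delta>\<^sub>B = form_coproduct_linear[OF finB form sym nondeg d]
  and \<Delta>\<^sub>B_eval = form_coproduct_eval[OF finB form sym nondeg d]

private lemma
  shows bullet: "bilinear_map (tensor A A) (tensor B B) (tensor L L) (bullet A B)"
    and bullet_eval: "f \<in> points (dual A) \<Longrightarrow> f' \<in> points (dual A) \<Longrightarrow> g \<in> points (dual B) \<Longrightarrow> g' \<in> points (dual B)
      \<Longrightarrow> s \<in> points (tensor A A) \<Longrightarrow> t \<in> points (tensor B B)
      \<Longrightarrow> bullet A B s t (prod_functional A B f g, prod_functional A B f' g') = s (f, f') * t (g, g')"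
proof -
  let ?\<gamma> = "\<lambda>a a' b b'. ten L L (ten A B a b) (ten A B a' b')"
  have 1: "bilinear_map A A (tensor L L) (\<lambda>a a'. ?\<gamma> a a' b b')" if "b \<in> points B" "b' \<in> points B" for b b'
    using that by (intro bilinear_map_comp2[OF bilinear_ten[OF L L]] bilinear_left[OF bilinear_ten[OF A B]])
  have 2: "bilinear_map B B (tensor L L) (?\<gamma> a a')" if "a \<in> points A" "a' \<in> points A" for a a'
    using that by (intro bilinear_map_comp2[OF bilinear_ten[OF L L]] bilinear_right[OF bilinear_ten[OF A B]])
  show bil: "bilinear_map (tensor A A) (tensor B B) (tensor L L) (bullet A B)"
    unfolding bullet_def[abs_def]
    by (rule nested_tlift_bilinear[OF A A B B vspace_tensor[OF L L]]) (rule 1 2; assumption)+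
  have pure: "bullet A B (ten A A a a') (ten B B b b') = ?\<gamma> a a' b b'"
    if "a \<in> points A" "a' \<in> points A" "b \<in> points B" "b' \<in> points B" for a a' b b'
    unfolding bullet_def
    by (rule nested_tlift_ten[OF A A B B vspace_tensor[OF L L]]) (rule 1 2 that; assumption?)+
  show "bullet A B s t (prod_functional A B f g, prod_functional A B f' g') = s (f, f') * t (g, g')"
    if fg: "f \<in> points (dual A)" "f' \<in> points (dual A)" "g \<in> points (dual B)" "g' \<in> points (dual B)"
      and s: "s \<in> points (tensor A A)" and t: "t \<in> points (tensor B B)"
    by (rule bilinear_eq_on_tensor[OF A A B B bilinear_map_comp[OF bil tensor_eval_linear]
          bilinear_map_mult[OF tensor_eval_linear tensor_eval_linear] _ s t])
      (simp add: pure fg prod_functional_dual A B ten_in)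
qed

lemma
  shows induced_cobracket_linear: "linear_map L (tensor L L) \<delta>"
    and induced_cobracket_ten: "a \<in> points A \<Longrightarrow> b \<in> points B \<Longrightarrow> \<delta> (ten A B a b)
      = bullet A B (\<Delta> a) (\<Delta>\<^sub>B b) - tflip L L (bullet A B (\<Delta> a) (\<Delta>\<^sub>B b))"
proof -
  note b1 = bilinear_map_comp2[OF bullet \<Delta> \<Delta>\<^sub>B]
  have b: "bilinear_map A B (tensor L L)
      (\<lambda>a b. let t = bullet A B (\<Delta> a) (\<Delta>\<^sub>B b) in t - tflip L L t)"
    unfolding Let_def
    by (intro bilinear_map_minus vspace_tensor L b1 bilinear_map_comp[OF b1 tflip_linear])
  show "linear_map L (tensor L L) \<delta>"
    unfolding induced_cobracket_def by (rule tlift_linear[OF A B vspace_tensor[OF L L] b])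
  show "\<delta> (ten A B a b) = bullet A B (\<Delta> a) (\<Delta>\<^sub>B b) - tflip L L (bullet A B (\<Delta> a) (\<Delta>\<^sub>B b))"
    if "a \<in> points A" "b \<in> points B"
    using tlift_ten[OF A B b that] unfolding induced_cobracket_def Let_def .
qed

text \<open>By definition of \<open>\<Delta>\<^sub>B\<close>, both sides are \<open>(f \<cdot> f')(a) (b, c c') - (f' \<cdot> f)(a) (b, c' c)\<close> on pure
  tensors.\<close>

lemma induced_cobracket_dual:
  assumes x: "x \<in> points L" and \<xi>: "\<xi> \<in> points (dual L)" and \<eta>: "\<eta> \<in> points (dual L)"
  shows "\<delta> x (\<xi>, \<eta>) = br' \<xi> \<eta> x"
proof -
  obtain s t where st: "s \<in> points L'" "\<xi> = \<kappa> s" "t \<in> points L'" "\<eta> = \<kappa> t"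
    using \<xi> \<eta> by (metis \<kappa>_obtain)
  have "\<delta> x (\<kappa> s, \<kappa> t) = \<kappa> (br0 s t) x"
  proof (rule linear_eq_on_tensor[OF A B linear_map_comp[OF induced_cobracket_linear tensor_eval_linear]
        dual_linear[OF linear_map_in[OF \<kappa> bilinear_in[OF br0 st(1,3)]]] _ x])
    fix a b assume a: "a \<in> points A" and b: "b \<in> points B"
    note ab = ten_in[OF a b] and \<delta>ab = linear_map_in[OF induced_cobracket_linear ten_in[OF a b]]
    show "\<delta> (ten A B a b) (\<kappa> s, \<kappa> t) = \<kappa> (br0 s t) (ten A B a b)"
    proof (rule bilinear_eq_on_tensor[OF A' B' A' B'
          bilinear_map_comp2[OF tensor_eval_bilinear[OF \<delta>ab L L] \<kappa> \<kappa>]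
          bilinear_map_comp[OF bilinear_map_comp[OF br0 \<kappa>] dual_eval] _ st(1,3)])
      fix f g f' g'
      assume f: "f \<in> points (dual A)" "f' \<in> points (dual A)" and g: "g \<in> points (dual B)" "g' \<in> points (dual B)"
      obtain c c' where c: "c \<in> points B" "c' \<in> points B" "g = \<phi> c" "g' = \<phi> c'"
        using g by (metis \<phi>_obtain)
      have mem: "bullet A B (\<Delta> a) (\<Delta>\<^sub>B b) \<in> points (tensor L L)"
        by (intro bilinear_in[OF bullet] linear_map_in[OF \<Delta> a] linear_map_in[OF \<Delta>\<^sub>B b])
      have "\<delta> (ten A B a b) (prod_functional A B f g, prod_functional A B f' g')
          = n f f' a * form b (d c c') - n f' f a * form b (d c' c)"
        using f g a b c
        by (simp add: induced_cobracket_ten tflip_eval[OF L L _ _ mem] prod_functional_dual A B bullet_eval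
            linear_map_in[OF \<Delta>] linear_map_in[OF \<Delta>\<^sub>B] \<Delta>_eval \<Delta>\<^sub>B_eval)
      also have "\<dots> = \<kappa> (br0 (ten (dual A) (dual B) f g) (ten (dual A) (dual B) f' g')) (ten A B a b)"
        using f g a b c sym[OF b bilinear_in[OF d c(1,2)]] sym[OF b bilinear_in[OF d c(2,1)]]
        by (simp add: br0_ten linear_map_diff[OF \<kappa> L'] ten_in bilinear_in[OF n_bilinear] bilinear_in[OF d'] \<kappa>_ten
            ab d'_eq \<psi>_\<phi> linear_map_in[OF \<phi>] bilinear_in[OF d] \<phi>_apply)
      finally show "\<delta> (ten A B a b) (\<kappa> (ten (dual A) (dual B) f g), \<kappa> (ten (dual A) (dual B) f' g'))
          = \<kappa> (br0 (ten (dual A) (dual B) f g) (ten (dual A) (dual B) f' g')) (ten A B a b)"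
        using f g by (simp add: \<kappa>_ten)
    qed
  qed
  then show ?thesis using st by (simp add: br'_\<kappa>)
qed

end

end


section \<open>The two constructions agree\<close>

theorem proposition3p20:
  fixes A :: "('k::field_char_0, 'a::ab_group_add) space"
    and mA :: "'a \<Rightarrow> 'a \<Rightarrow> 'a" and \<Delta>A :: "'a \<Rightarrow> ('k, 'a, 'a) tensor"
    and B :: "('k, 'b::ab_group_add) space"
    and mB :: "'b \<Rightarrow> 'b \<Rightarrow> 'b" and form :: "'b \<Rightarrow> 'b \<Rightarrow> 'k"
  assumes "fin_dim_space A" and "novikov_bialgebra A mA \<Delta>A"
    and "fin_dim_space B" and "quadratic_right_novikov_algebra B mB form"
  shows "let L = tensor A B;
             br = induced_bracket A mA B mB;
             \<delta> = induced_cobracket A \<Delta>A B (form_coproduct B mB form);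
             nA = dual_product A \<Delta>A;
             M = novikov_double A mA \<Delta>A;
             br' = dual_induced_bracket A nA B (dual_form_product B mB form);
             D = transported_bracket A M B mB form
         in lie_bialgebra L br \<delta>
            \<and> novikov_manin_triple A mA nA M
            \<and> lie_manin_triple L br br' D
            \<and> (\<forall>x\<in>points L. \<forall>y\<in>points L. bracket_of_manin_triple D x y = br x y)
            \<and> (\<forall>x\<in>points L. cobracket_of_manin_triple L D x = \<delta> x)
            \<and> (\<forall>u\<in>points (dsum L (dual L)). \<forall>v\<in>points (dsum L (dual L)).
                 lie_double L br \<delta> u v = D u v)"
proof -
  have A: "vspace A" by (rule fin_dim_vspace[OF assms(1)])
  have \<Delta>A: "linear_map A (tensor A A) \<Delta>A"
    using assms(2) by (simp add: novikov_bialgebra_def novikov_coalgebra_def)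
  note nov = novikov_bialgebra_manin_triple[OF assms(1,2)]
  note lie = induced_lie_manin_triple[OF assms(1) nov assms(3,4)]
  note ctxt = assms(1) nov assms(3,4) \<Delta>A dual_product_eval[OF A \<Delta>A, symmetric]
  note \<delta> = induced_cobracket_linear[OF ctxt] induced_cobracket_dual[OF ctxt]
  note L = fin_dim_tensor[OF assms(1,3)]
  show ?thesis
    unfolding Let_def
    using lie_bialgebra_of_manin_triple[OF lie \<delta>] nov lie bracket_of_manin_triple_eq[OF lie \<delta>]
      cobracket_of_manin_triple_eq[OF lie \<delta>] lie_double_eq[OF lie \<delta> L]
    by blast
qed

end
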